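(* Let $n\in\{2,3\}$, let $\Omega\subset\mathbb{R}^n$ be a bounded open domain satisfying the cone condition, let $\epsilon>0$, $\tau>0$, and let $\varphi^{k-1}\in H^1(\Omega)$ be the given phase field from the previous time instance. For a (large) parameter $s>0$ let $(\varphi^s,\mu^s)\in H^1(\Omega)\times H^1(\Omega)$ be the unique solution of the relaxed time-discrete Cahn--Hilliard system $$(\varphi^s,v)+\tau(\nabla\mu^s,\nabla v)=(\varphi^{k-1},v)\quad\forall v\in H^1(\Omega),$$ $$\epsilon(\nabla\varphi^s,\nabla v)+\epsilon^{-1}(s\lambda(\varphi^s),v)-\epsilon^{-1}(\varphi^{k-1},v)=(\mu^s,v)\quad\forall v\in H^1(\Omega),$$ where $\lambda(\varphi)=\max(0,\varphi-1)+\min(0,\varphi+1)$. Then for $0<\beta<2-\frac n2$ there is a constant $C=C(\Omega,n,\beta)>0$, independent of $s$, such that for all large $s$ $$\|\lambda(\varphi^s)\|_{L^\infty(\Omega)}\le C\,\|\lambda(\varphi^s)\|_{L^1(\Omega)}^{\frac{\beta}{\beta+n}}.$$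
   Context: $(\cdot,\cdot)$ denotes the $L^2(\Omega)$ inner product (for scalar or vector valued functions). $H^k(\Omega)=W^{k,2}(\Omega)$ are the usual Sobolev spaces. $\Omega$ satisfies the cone condition if there is a fixed finite cone such that every $x\in\Omega$ is the vertex of a cone contained in $\Omega$ and congruent to the fixed one. The system is the Moreau--Yosida relaxation (relaxation parameter $s$, regarded as large) of one time step, of size $\tau$, of the Cahn--Hilliard system with double-obstacle free energy; $\epsilon$ is the interface parameter. Existence and uniqueness of the solution for each $s$ is quoted from the literature. The function $\lambda(\varphi^s)$ measures the violation of the constraint $|\varphi^s|\le1$. The parameter $\beta$ is a Hölder exponent of $\varphi^s$, coming from the embedding $H^2(\Omega)\hookrightarrow C^{0,\beta}(\overline\Omega)$ for $\beta<2-\frac n2$. The problem data $\epsilon,\tau,\varphi^{k-1}$ are fixed; $C(\Omega,n,\beta)$ may depend on them through an $s$-independent bound of $\varphi^s$ in $C^{0,\beta}(\overline\Omega)$, but not on $s$. *)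

theory Defs
  imports "HOL-Analysis.Analysis" "HOL-Probability.Essential_Supremum"
begin

(* The closed finite cone with vertex 0, axis direction v (a unit vector), height \<rho> and
   opening angle \<kappa>: the points of norm at most \<rho> whose angle with v is at most \<kappa>/2. *)
definition finite_cone :: "'a::euclidean_space \<Rightarrow> real \<Rightarrow> real \<Rightarrow> 'a set" where
  "finite_cone v \<rho> \<kappa> = {y. norm y \<le> \<rho> \<and> norm y * cos (\<kappa> / 2) \<le> y \<bullet> v}"

definition cone_condition :: "'a::euclidean_space set \<Rightarrow> bool" where
  "cone_condition \<Omega> \<longleftrightarrow>
     (\<exists>(v::'a) \<rho> \<kappa>. norm v = 1 \<and> 0 < \<rho> \<and> 0 < \<kappa> \<and> \<kappa> \<le> pi \<and>
        (\<forall>x\<in>\<Omega>. \<exists>f. orthogonal_transformation f \<and>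
           (\<lambda>y. x + f y) ` finite_cone v \<rho> \<kappa> \<subseteq> \<Omega>))"

primrec Ck :: "nat \<Rightarrow> ('a::euclidean_space \<Rightarrow> real) \<Rightarrow> bool" where
  "Ck 0 f \<longleftrightarrow> continuous_on UNIV f"
| "Ck (Suc k) f \<longleftrightarrow> (\<forall>x. f differentiable (at x)) \<and>
     (\<forall>i\<in>Basis. Ck k (\<lambda>x. frechet_derivative f (at x) i))"

definition test_functions :: "'a::euclidean_space set \<Rightarrow> ('a \<Rightarrow> real) set" where
  "test_functions \<Omega> =
     {\<psi>. (\<forall>k. Ck k \<psi>) \<and> compact (closure {x. \<psi> x \<noteq> 0}) \<and> closure {x. \<psi> x \<noteq> 0} \<subseteq> \<Omega>}"

(* Elements of the function spaces below are representatives, not classes modulo null sets. *)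
definition L2_space :: "'a::euclidean_space set \<Rightarrow> ('a \<Rightarrow> 'b::euclidean_space) set" where
  "L2_space \<Omega> = {u. u \<in> borel_measurable (lebesgue_on \<Omega>) \<and>
     integrable (lebesgue_on \<Omega>) (\<lambda>x. (norm (u x))\<^sup>2)}"

definition L2_inner ::
  "'a::euclidean_space set \<Rightarrow> ('a \<Rightarrow> 'b::euclidean_space) \<Rightarrow> ('a \<Rightarrow> 'b) \<Rightarrow> real" where
  "L2_inner \<Omega> u v = (\<integral>x. u x \<bullet> v x \<partial>lebesgue_on \<Omega>)"

definition is_weak_grad ::
  "'a::euclidean_space set \<Rightarrow> ('a \<Rightarrow> real) \<Rightarrow> ('a \<Rightarrow> 'a) \<Rightarrow> bool" where
  "is_weak_grad \<Omega> u g \<longleftrightarrow> g \<in> L2_space \<Omega> \<and>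
     (\<forall>\<psi>\<in>test_functions \<Omega>. \<forall>i\<in>Basis.
        (\<integral>x. u x * frechet_derivative \<psi> (at x) i \<partial>lebesgue_on \<Omega>)
        = - (\<integral>x. (g x \<bullet> i) * \<psi> x \<partial>lebesgue_on \<Omega>))"

definition H1_space :: "'a::euclidean_space set \<Rightarrow> ('a \<Rightarrow> real) set" where
  "H1_space \<Omega> = {u \<in> L2_space \<Omega>. \<exists>g. is_weak_grad \<Omega> u g}"

(* Weak gradients agree almost everywhere on an open set, so the choice does not affect L2_inner. *)
definition weak_grad :: "'a::euclidean_space set \<Rightarrow> ('a \<Rightarrow> real) \<Rightarrow> 'a \<Rightarrow> 'a" where
  "weak_grad \<Omega> u = (SOME g. is_weak_grad \<Omega> u g)"

definition L1_norm :: "'a::euclidean_space set \<Rightarrow> ('a \<Rightarrow> real) \<Rightarrow> real" where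
  "L1_norm \<Omega> u = (\<integral>x. \<bar>u x\<bar> \<partial>lebesgue_on \<Omega>)"

(* Extended-real valued: the value is \<infinity> when u is not essentially bounded. *)
definition Linf_norm :: "'a::euclidean_space set \<Rightarrow> ('a \<Rightarrow> real) \<Rightarrow> ereal" where
  "Linf_norm \<Omega> u = esssup (lebesgue_on \<Omega>) (\<lambda>x. ereal \<bar>u x\<bar>)"

definition obstacle_violation :: "real \<Rightarrow> real" where
  "obstacle_violation t = max 0 (t - 1) + min 0 (t + 1)"

definition relaxed_CH_solution ::
  "'a::euclidean_space set \<Rightarrow> real \<Rightarrow> real \<Rightarrow> ('a \<Rightarrow> real) \<Rightarrow> real
     \<Rightarrow> ('a \<Rightarrow> real) \<Rightarrow> ('a \<Rightarrow> real) \<Rightarrow> bool" where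
  "relaxed_CH_solution \<Omega> \<epsilon> \<tau> \<phi>old s \<phi> \<mu> \<longleftrightarrow>
     \<phi> \<in> H1_space \<Omega> \<and> \<mu> \<in> H1_space \<Omega> \<and>
     (\<forall>v\<in>H1_space \<Omega>.
        L2_inner \<Omega> \<phi> v + \<tau> * L2_inner \<Omega> (weak_grad \<Omega> \<mu>) (weak_grad \<Omega> v)
        = L2_inner \<Omega> \<phi>old v) \<and>
     (\<forall>v\<in>H1_space \<Omega>.
        \<epsilon> * L2_inner \<Omega> (weak_grad \<Omega> \<phi>) (weak_grad \<Omega> v)
        + inverse \<epsilon> * L2_inner \<Omega> (\<lambda>x. s * obstacle_violation (\<phi> x)) v
        - inverse \<epsilon> * L2_inner \<Omega> \<phi>old v
        = L2_inner \<Omega> \<mu> v)"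

end

theory Submission
  imports Defs
begin

text \<open>The bound is obtained from Stampacchia's truncation method rather than from Hoelder continuity of
  the phase field, whose \<open>H\<^sup>2\<close> regularity may fail on a domain with the cone condition only. Write
  \<open>f = \<mu> + \<phi>old / \<epsilon>\<close> and let \<open>c\<close> be its mean. Testing with constants gives
  \<open>s / \<epsilon> * \<integral>\<lambda>(\<phi>) = c * |\<Omega>|\<close>, so truncation levels above \<open>\<parallel>\<lambda>(\<phi>)\<parallel>\<^sub>1 / |\<Omega>|\<close> absorb \<open>c\<close>, and only
  \<open>f - c\<close> matters. An energy estimate and Poincare's inequality bound \<open>f - c\<close> in \<open>L\<^sup>2\<close> uniformly
  in \<open>s\<close>; no bound on \<open>c\<close> is needed. Testing with truncations of \<open>\<phi>\<close> then gives
  \<open>(h - k) * |A h| \<le> C * |A k| powr (1 + \<beta> / n)\<close> for the measures of the sets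
  \<open>A k = {\<phi> > 1 + k}\<close>. Iterating from \<open>k0 = \<parallel>\<lambda>(\<phi>)\<parallel>\<^sub>1 powr (\<beta> / (\<beta> + n)) + \<parallel>\<lambda>(\<phi>)\<parallel>\<^sub>1 / |\<Omega>|\<close>, where
  Markov's inequality bounds \<open>|A k0|\<close>, yields the claim.

  The Sobolev input is a single pointwise inequality: a function differs from its average over a ball
  inside the cone at \<open>x\<close> by at most a Riesz potential of its gradient. Schur's test turns it into both
  the Poincare inequality and the gain of the factor \<open>|A k| powr \<theta>\<close> for any \<open>\<theta> < 1 / n\<close>. The exponent
  \<open>2 * \<theta> - 1 / 2 = \<beta> / n\<close> is attainable exactly because \<open>\<beta> < 2 - n / 2\<close>.\<close>

section \<open>Smooth bump functions\<close>

text \<open>The exponents come from two balances. Let E be the squared H^1 norm of the truncation v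
  at level 1 + k. The gain |A k| powr \<theta> is used twice: against f - c it gives E \<le> const *
  |A k| powr (2 * \<theta>), and against the indicator of A k, with this bound on E, it gives
  \<integral>v \<le> const * |A k| powr (2 * \<theta> + 1/2). Asking for the exponent 1 + \<gamma>
  with \<gamma> = \<beta> / n fixes \<theta>. Starting at height N powr e, where N is the L^1 norm
  of the violation, Markov leaves |A k0| \<le> N powr (1 - e), and the iteration adds a height of
  order N powr ((1 - e) * \<gamma>). The two heights agree for e = \<gamma> / (1 + \<gamma>) =
  \<beta> / (\<beta> + n). The further summand N / |\<Omega>| is dominated by N powr e because N is
  bounded uniformly in s. Largeness of s enters as s \<ge> \<epsilon>^2: then the quadratic part of
  the penalty supplies the L^2 half of E. Weak gradients are accessible only through smooth
  compactly supported test functions, which is why explicit bumps, averages against them and a chain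
  rule have to be built before any estimate.\<close>

lemma Ck_Suc_imp: "Ck (Suc k) f \<Longrightarrow> Ck k f"
proof (induction k arbitrary: f)
  case 0
  then show ?case
    by (auto intro!: continuous_at_imp_continuous_on differentiable_imp_continuous_within)
next
  case (Suc k)
  show ?case
    unfolding Ck.simps(2)[of k]
  proof (intro conjI ballI)
    show "\<forall>x. f differentiable at x" using Suc.prems by simp
    fix i :: 'a assume "i \<in> Basis"
    then have "Ck (Suc k) (\<lambda>x. frechet_derivative f (at x) i)"
      using Suc.prems by (metis Ck.simps(2))
    then show "Ck k (\<lambda>x. frechet_derivative f (at x) i)" by (rule Suc.IH)
  qed
qed

lemma Ck_SucI:
  assumes "\<And>x. (f has_derivative f' x) (at x)" and "\<And>i. i \<in> Basis \<Longrightarrow> Ck k (\<lambda>x. f' x i)"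
  shows "Ck (Suc k) f"
proof -
  have "frechet_derivative f (at x) = f' x" for x
    using assms(1) frechet_derivative_at by metis
  then show ?thesis using assms by (auto simp: differentiable_def)
qed

lemma Ck_SucD:
  assumes "Ck (Suc k) f"
  shows "(f has_derivative frechet_derivative f (at x)) (at x)"
    and "i \<in> Basis \<Longrightarrow> Ck k (\<lambda>x. frechet_derivative f (at x) i)"
  using assms by (auto simp: frechet_derivative_works)

lemma Ck_const [simp]: "Ck k (\<lambda>x. c)"
proof (induction k arbitrary: c)
  case (Suc k)
  show ?case by (rule Ck_SucI[where f' = "\<lambda>x h. 0"]) (auto simp: Suc)
qed simp

lemma Ck_add: "Ck k f \<Longrightarrow> Ck k g \<Longrightarrow> Ck k (\<lambda>x. f x + g x)"
proof (induction k arbitrary: f g)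
  case 0
  then show ?case by (auto intro: continuous_intros)
next
  case (Suc k)
  show ?case
    by (rule Ck_SucI, rule has_derivative_add[OF Ck_SucD(1)[OF Suc.prems(1)] Ck_SucD(1)[OF Suc.prems(2)]])
       (intro Suc.IH Ck_SucD(2)[OF Suc.prems(1)] Ck_SucD(2)[OF Suc.prems(2)])
qed

lemma Ck_mult: "Ck k f \<Longrightarrow> Ck k g \<Longrightarrow> Ck k (\<lambda>x. f x * g x)"
proof (induction k arbitrary: f g)
  case 0
  then show ?case by (auto intro: continuous_intros)
next
  case (Suc k)
  show ?case
    by (rule Ck_SucI, rule has_derivative_mult[OF Ck_SucD(1)[OF Suc.prems(1)] Ck_SucD(1)[OF Suc.prems(2)]])
       (intro Ck_add Suc.IH Ck_SucD(2)[OF Suc.prems(1)] Ck_SucD(2)[OF Suc.prems(2)]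
          Suc.prems[THEN Ck_Suc_imp])
qed

lemma Ck_affine: "Ck k (\<lambda>x. (x - c) \<bullet> a)"
proof (cases k)
  case 0
  then show ?thesis by (auto intro!: continuous_intros)
next
  case (Suc k)
  show ?thesis unfolding Suc
    by (rule Ck_SucI[where f' = "\<lambda>x h. h \<bullet> a"]) (auto intro!: derivative_eq_intros)
qed

lemma Ck_sqdist: "Ck k (\<lambda>x. (x - c) \<bullet> (x - c))"
proof (cases k)
  case 0
  then show ?thesis by (auto intro!: continuous_intros)
next
  case (Suc k)
  show ?thesis unfolding Suc
  proof (rule Ck_SucI[where f' = "\<lambda>x h. 2 * ((x - c) \<bullet> h)"])
    show "((\<lambda>x. (x - c) \<bullet> (x - c)) has_derivative (\<lambda>h. 2 * ((x - c) \<bullet> h))) (at x)" for x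
      by (auto intro!: derivative_eq_intros simp: inner_commute)
    show "Ck k (\<lambda>x. 2 * ((x - c) \<bullet> i))" for i
      by (intro Ck_mult Ck_const Ck_affine)
  qed
qed

text \<open>The index m records negative powers of x. Differentiation turns index m into a
  combination of m + 1 and m + 2, so this family, rather than exp (-1/x) alone, is stable under an
  induction over derivatives.\<close>

definition flat_exp :: "nat \<Rightarrow> real \<Rightarrow> real" where
  "flat_exp m x = (if x \<le> 0 then 0 else inverse x ^ m * exp (- inverse x))"

lemma tendsto_flat_exp: "((\<lambda>x. inverse x ^ m * exp (- inverse x)) \<longlongrightarrow> 0) (at_right (0::real))"
proof -
  have "((\<lambda>x::real. x ^ m / exp x) \<longlongrightarrow> 0) at_top" by (rule tendsto_power_div_exp_0)
  then have "((\<lambda>x::real. inverse x ^ m / exp (inverse x)) \<longlongrightarrow> 0) (at_right 0)"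
    by (rule filterlim_compose[OF _ filterlim_inverse_at_top_right])
  then show ?thesis by (simp add: exp_minus divide_inverse)
qed

lemma tendsto_flat_exp_0: "(flat_exp m \<longlongrightarrow> 0) (at 0)"
proof -
  have "(flat_exp m \<longlongrightarrow> 0) (at_left 0)"
    by (rule tendsto_eventually) (auto simp: flat_exp_def eventually_at_filter)
  moreover have "(flat_exp m \<longlongrightarrow> 0) (at_right 0)"
    using tendsto_flat_exp[of m]
    by (rule filterlim_cong[THEN iffD1, rotated -1]) (auto simp: flat_exp_def eventually_at_filter)
  ultimately show ?thesis by (simp add: filterlim_split_at)
qed

lemma flat_exp_deriv:
  "(flat_exp m has_real_derivative (- real m * flat_exp (Suc m) x + flat_exp (m + 2) x)) (at x)"
proof -
  consider "x < 0" | "x = 0" | "x > 0" by linarith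
  then show ?thesis
  proof cases
    case 1
    have "((\<lambda>x. 0) has_real_derivative 0) (at x)" by simp
    then have "(flat_exp m has_real_derivative 0) (at x)"
      by (rule has_field_derivative_transform_within_open[where S = "{..<0}"])
         (use 1 in \<open>auto simp: flat_exp_def\<close>)
    then show ?thesis using 1 by (simp add: flat_exp_def)
  next
    case 2
    \<comment> \<open>For h \<noteq> 0 the difference quotient at 0 is
      \<open>flat_exp (Suc m) h\<close>, which tends to 0.\<close>
    have "((\<lambda>h. (flat_exp m (0 + h) - flat_exp m 0) / h) \<longlongrightarrow> 0) (at 0)"
      using tendsto_flat_exp_0[of "Suc m"]
      by (rule filterlim_cong[THEN iffD1, rotated -1])
         (auto simp: flat_exp_def eventually_at_filter divide_inverse)
    then show ?thesis unfolding 2 by (simp add: has_field_derivative_iff flat_exp_def)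
  next
    case 3
    have "((\<lambda>x. inverse x ^ m * exp (- inverse x)) has_real_derivative
        (- real m * flat_exp (Suc m) x + flat_exp (m + 2) x)) (at x)"
      using 3
      apply (auto intro!: derivative_eq_intros simp: flat_exp_def power2_eq_square)
      apply (cases m)
       apply (auto simp: field_simps)
      done
    then show ?thesis
      by (rule has_field_derivative_transform_within_open[where S = "{0<..}"])
         (use 3 in \<open>auto simp: flat_exp_def\<close>)
  qed
qed

lemma flat_exp_nonneg: "0 \<le> flat_exp m x"
  by (simp add: flat_exp_def)

lemma flat_exp_pos: "0 < x \<Longrightarrow> 0 < flat_exp m x"
  by (simp add: flat_exp_def)

lemma flat_exp_0_le_1: "flat_exp 0 x \<le> 1"
  by (simp add: flat_exp_def)

lemma continuous_on_flat_exp: "continuous_on A (flat_exp m)"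
  using flat_exp_deriv DERIV_isCont by (meson continuous_at_imp_continuous_on)

text \<open>The induction generalises over m because each derivative raises the index. Smoothness of
  every order is asked of f since its derivative appears as a factor next to the composition
  itself.\<close>

lemma Ck_flat_exp: "(\<And>j. Ck j f) \<Longrightarrow> Ck k (\<lambda>x. flat_exp m (f x))"
proof (induction k arbitrary: m)
  case 0
  have "continuous_on UNIV f" using "0.prems"[of 0] by simp
  then show ?case
    using continuous_on_compose2[OF continuous_on_flat_exp[of UNIV m]] by simp
next
  case (Suc k)
  let ?f' = "\<lambda>x. frechet_derivative f (at x)"
  have f': "(f has_derivative ?f' x) (at x)" for x
    using Suc.prems[of 1] Ck_SucD(1)[of 0 f] by simp
  show ?case
  proof (rule Ck_SucI)
    show "((\<lambda>x. flat_exp m (f x)) has_derivative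
        (\<lambda>h. (- real m * flat_exp (Suc m) (f x) + flat_exp (m + 2) (f x)) * ?f' x h)) (at x)" for x
      using has_derivative_compose[OF f' flat_exp_deriv[of m "f x", unfolded has_field_derivative_def]]
      by (simp add: o_def)
    show "Ck k (\<lambda>x. (- real m * flat_exp (Suc m) (f x) + flat_exp (m + 2) (f x)) * ?f' x i)"
      if "i \<in> Basis" for i
      by (intro Ck_mult Ck_add Ck_const Suc.IH Suc.prems Ck_SucD(2)[OF Suc.prems that])
  qed
qed

text \<open>The classical mollifier profile exp (-1 / (1 - |y - c|^2 / t^2)), left unnormalised; its
  mass is accounted for later by \<open>bump_mass\<close>.\<close>

definition bump :: "'a::euclidean_space \<Rightarrow> real \<Rightarrow> 'a \<Rightarrow> real" where
  "bump c t y = flat_exp 0 (1 - ((y - c) \<bullet> (y - c)) / t\<^sup>2)"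

lemma Ck_bump: "Ck k (bump c t)"
proof -
  have "Ck k (\<lambda>x. flat_exp 0 (1 + (- 1 / t\<^sup>2) * ((x - c) \<bullet> (x - c))))"
    by (intro Ck_flat_exp Ck_add Ck_mult Ck_const Ck_sqdist)
  then show ?thesis by (simp add: bump_def[abs_def])
qed

lemma bump_nonneg: "0 \<le> bump c t y" and bump_le_1: "bump c t y \<le> 1"
  by (simp_all add: bump_def flat_exp_nonneg flat_exp_0_le_1)

lemma bump_eq_0: "t > 0 \<Longrightarrow> t \<le> dist c y \<Longrightarrow> bump c t y = 0"
proof -
  assume t: "t > 0" "t \<le> dist c y"
  then have "t\<^sup>2 \<le> (dist c y)\<^sup>2" by (intro power_mono) auto
  then show "bump c t y = 0"
    using t by (simp add: bump_def flat_exp_def dist_norm norm_minus_commute[of c y] power2_norm_eq_inner)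
qed

lemma bump_pos: "t > 0 \<Longrightarrow> dist c y < t \<Longrightarrow> 0 < bump c t y"
proof -
  assume t: "t > 0" "dist c y < t"
  then have "(dist c y)\<^sup>2 < t\<^sup>2" by (intro power_strict_mono) auto
  then show "0 < bump c t y"
    using t unfolding bump_def
    by (intro flat_exp_pos) (simp add: dist_norm norm_minus_commute[of c y] power2_norm_eq_inner)
qed

lemma test_functionI:
  assumes "\<And>k. Ck k \<psi>" "t > 0" "\<And>y. dist c y \<ge> t \<Longrightarrow> \<psi> y = 0" "cball c t \<subseteq> \<Omega>"
  shows "\<psi> \<in> test_functions \<Omega>"
proof -
  have "{x. \<psi> x \<noteq> 0} \<subseteq> cball c t" using assms(3) by (force simp: not_le)
  then have c: "closure {x. \<psi> x \<noteq> 0} \<subseteq> cball c t" by (simp add: closure_minimal)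
  then have "compact (closure {x. \<psi> x \<noteq> 0})"
    by (metis bounded_cball bounded_subset closed_closure compact_eq_bounded_closed)
  then show ?thesis using assms c by (auto simp: test_functions_def)
qed

lemma bump_test_function: "t > 0 \<Longrightarrow> cball c t \<subseteq> \<Omega> \<Longrightarrow> bump c t \<in> test_functions \<Omega>"
  by (rule test_functionI) (auto simp: Ck_bump bump_eq_0)

text \<open>\<open>flat_exp 2\<close> is the derivative of \<open>flat_exp 0\<close>, so this
  controls the gradient of a bump. With z = 1/x it is the inequality z^2 / 2 \<le> exp z.\<close>

lemma flat_exp_2_le: "flat_exp 2 x \<le> 2"
proof (cases "x \<le> 0")
  case False
  let ?z = "inverse x"
  have "?z > 0" using False by simp
  then have "1 + ?z + ?z\<^sup>2 / 2 \<le> exp ?z" by (simp add: exp_lower_Taylor_quadratic)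
  then have "?z\<^sup>2 \<le> 2 * exp ?z" using \<open>?z > 0\<close> by linarith
  then have "?z\<^sup>2 * exp (- ?z) \<le> (2 * exp ?z) * exp (- ?z)"
    by (intro mult_right_mono) auto
  moreover have "(2 * exp z) * exp (- z) = 2" for z :: real by (simp add: mult.assoc mult_exp_exp)
  ultimately have "?z\<^sup>2 * exp (- ?z) \<le> 2" by metis
  then show ?thesis using False by (simp add: flat_exp_def)
qed (simp add: flat_exp_def)

lemma bump_measurable [measurable]: "bump c t \<in> borel_measurable borel"
  using Ck_bump[of 0 c t] by (intro borel_measurable_continuous_onI) simp

section \<open>Averages of weakly differentiable functions\<close>

lemma integrable_mult_bounded:
  fixes u K :: "'a::euclidean_space \<Rightarrow> real"
  assumes "integrable lborel u" "K \<in> borel_measurable borel" "\<And>y. \<bar>K y\<bar> \<le> B"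
  shows "integrable lborel (\<lambda>y. u y * K y)"
proof (rule Bochner_Integration.integrable_bound[where f = "\<lambda>y. B * u y"])
  show "AE y in lborel. norm (u y * K y) \<le> norm (B * u y)"
  proof (intro always_eventually allI)
    fix y
    have "\<bar>u y\<bar> * \<bar>K y\<bar> \<le> \<bar>u y\<bar> * \<bar>B\<bar>"
      by (intro mult_left_mono order.trans[OF assms(3)]) auto
    then show "norm (u y * K y) \<le> norm (B * u y)" by (simp add: abs_mult mult.commute)
  qed
qed (use assms in auto)

text \<open>Differentiation under the integral sign, with all regularity placed on the kernel
  because u is merely integrable. The mean value inequality bounds the difference quotients of K by
  B, so a multiple of |u| dominates.\<close>

lemma has_real_derivative_integral_kernel:
  fixes u :: "'a::euclidean_space \<Rightarrow> real" and K K' :: "real \<Rightarrow> 'a \<Rightarrow> real"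
  assumes u: "integrable lborel u" and \<delta>: "\<delta> > 0"
    and K: "\<And>s y. \<bar>s - s0\<bar> < \<delta> \<Longrightarrow> ((\<lambda>s. K s y) has_real_derivative K' s y) (at s)"
    and B: "\<And>s y. \<bar>s - s0\<bar> < \<delta> \<Longrightarrow> \<bar>K' s y\<bar> \<le> B"
    and Kb: "\<And>s y. \<bar>s - s0\<bar> < \<delta> \<Longrightarrow> \<bar>K s y\<bar> \<le> B'"
    and Km: "\<And>s. K s \<in> borel_measurable borel" and K'm: "\<And>s. K' s \<in> borel_measurable borel"
  shows "((\<lambda>s. \<integral>y. u y * K s y \<partial>lborel) has_real_derivative (\<integral>y. u y * K' s0 y \<partial>lborel)) (at s0)"
  unfolding has_field_derivative_iff tendsto_at_iff_sequentially comp_def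
proof (intro allI impI)
  fix X :: "nat \<Rightarrow> real"
  assume X: "\<forall>i. X i \<in> UNIV - {s0}" "X \<longlonglongrightarrow> s0"
  have "eventually (\<lambda>i. dist (X i) s0 < \<delta>) sequentially"
    using X(2) \<delta> by (rule tendstoD)
  then obtain N where N: "\<And>i. i \<ge> N \<Longrightarrow> \<bar>X i - s0\<bar> < \<delta>"
    by (auto simp: eventually_sequentially dist_real_def)
  \<comment> \<open>Dropping the first N terms keeps the whole sequence in the neighbourhood where
    the bounds on K and K' hold.\<close>
  define Y where "Y i = X (i + N)" for i
  have Y: "Y i \<noteq> s0" "\<bar>Y i - s0\<bar> < \<delta>" for i using X N by (auto simp: Y_def)
  have Ylim: "Y \<longlonglongrightarrow> s0" unfolding Y_def using X(2) by (rule LIMSEQ_ignore_initial_segment)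
  have s0: "\<bar>s0 - s0\<bar> < \<delta>" using \<delta> by simp
  have lip: "\<bar>K (Y i) y - K s0 y\<bar> \<le> B * \<bar>Y i - s0\<bar>" for i y
  proof -
    have "norm (K (Y i) y - K s0 y) \<le> B * norm (Y i - s0)"
    proof (rule field_differentiable_bound[of "ball s0 \<delta>" "\<lambda>s. K s y" "\<lambda>s. K' s y"])
      show "((\<lambda>s. K s y) has_field_derivative K' z y) (at z within ball s0 \<delta>)" if "z \<in> ball s0 \<delta>" for z
        using K[of z y] that by (auto simp: dist_real_def abs_minus_commute intro: has_field_derivative_at_within)
      show "norm (K' z y) \<le> B" if "z \<in> ball s0 \<delta>" for z
        using B[of z y] that by (auto simp: dist_real_def abs_minus_commute)
    qed (use Y[of i] \<delta> in \<open>auto simp: dist_real_def abs_minus_commute\<close>)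
    then show ?thesis by simp
  qed
  have int: "integrable lborel (\<lambda>y. u y * K s y)" if "\<bar>s - s0\<bar> < \<delta>" for s
    using integrable_mult_bounded[OF u Km Kb[OF that]] .
  have "(\<lambda>i. \<integral>y. u y * ((K (Y i) y - K s0 y) / (Y i - s0)) \<partial>lborel)
      \<longlonglongrightarrow> (\<integral>y. u y * K' s0 y \<partial>lborel)"
  proof (rule integral_dominated_convergence[where w = "\<lambda>y. \<bar>B\<bar> * \<bar>u y\<bar>"])
    show "AE y in lborel. (\<lambda>i. u y * ((K (Y i) y - K s0 y) / (Y i - s0))) \<longlonglongrightarrow> u y * K' s0 y"
    proof (intro always_eventually allI tendsto_mult tendsto_const)
      fix y
      have "((\<lambda>s. (K s y - K s0 y) / (s - s0)) \<longlongrightarrow> K' s0 y) (at s0)"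
        using K[OF s0, of y] by (simp add: has_field_derivative_iff)
      then show "(\<lambda>i. (K (Y i) y - K s0 y) / (Y i - s0)) \<longlonglongrightarrow> K' s0 y"
        by (rule filterlim_compose) (use Y Ylim in \<open>auto simp: filterlim_at\<close>)
    qed
    fix i
    show "AE y in lborel. norm (u y * ((K (Y i) y - K s0 y) / (Y i - s0))) \<le> \<bar>B\<bar> * \<bar>u y\<bar>"
    proof (intro always_eventually allI)
      fix y
      have "\<bar>K (Y i) y - K s0 y\<bar> / \<bar>Y i - s0\<bar> \<le> \<bar>B\<bar>"
        using lip[of i y] Y(1)[of i] by (simp add: field_simps) (smt (verit) mult_right_mono)
      then have "\<bar>u y\<bar> * (\<bar>K (Y i) y - K s0 y\<bar> / \<bar>Y i - s0\<bar>) \<le> \<bar>u y\<bar> * \<bar>B\<bar>"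
        by (intro mult_left_mono) auto
      then show "norm (u y * ((K (Y i) y - K s0 y) / (Y i - s0))) \<le> \<bar>B\<bar> * \<bar>u y\<bar>"
        by (simp add: abs_mult mult.commute)
    qed
  qed (use u Km K'm in \<open>auto\<close>)
  moreover have "(\<integral>y. u y * ((K (Y i) y - K s0 y) / (Y i - s0)) \<partial>lborel)
      = ((\<integral>y. u y * K (Y i) y \<partial>lborel) - (\<integral>y. u y * K s0 y \<partial>lborel)) / (Y i - s0)" for i
  proof -
    have "(\<integral>y. u y * ((K (Y i) y - K s0 y) / (Y i - s0)) \<partial>lborel)
        = (\<integral>y. (u y * K (Y i) y - u y * K s0 y) / (Y i - s0) \<partial>lborel)"
      by (simp add: algebra_simps diff_divide_distrib)
    then show ?thesis using int[OF Y(2)[of i]] int[OF s0] by simp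
  qed
  ultimately have "(\<lambda>i. ((\<integral>y. u y * K (Y i) y \<partial>lborel) - (\<integral>y. u y * K s0 y \<partial>lborel)) / (Y i - s0))
      \<longlonglongrightarrow> (\<integral>y. u y * K' s0 y \<partial>lborel)"
    by (simp only:)
  then show "(\<lambda>i. ((\<integral>y. u y * K (X i) y \<partial>lborel) - (\<integral>y. u y * K s0 y \<partial>lborel)) / (X i - s0))
      \<longlonglongrightarrow> (\<integral>y. u y * K' s0 y \<partial>lborel)"
    unfolding Y_def by (rule LIMSEQ_offset)
qed

text \<open>Functions are Borel, live on the whole space and vanish off \<open>\<Omega>\<close>, so that Fubini and
  translations apply directly.\<close>

definition weak_grad_pair :: "'a::euclidean_space set \<Rightarrow> ('a \<Rightarrow> real) \<Rightarrow> ('a \<Rightarrow> 'a) \<Rightarrow> bool" where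
  "weak_grad_pair \<Omega> u g \<longleftrightarrow> integrable lborel u \<and> integrable lborel g \<and>
     (\<forall>x. x \<notin> \<Omega> \<longrightarrow> u x = 0 \<and> g x = 0) \<and>
     (\<forall>\<psi>\<in>test_functions \<Omega>. \<forall>i\<in>Basis.
        (\<integral>x. u x * frechet_derivative \<psi> (at x) i \<partial>lborel) = - (\<integral>x. (g x \<bullet> i) * \<psi> x \<partial>lborel))"

text \<open>The weight has total mass \<open>bump_mass\<close>, whatever c and t, thanks to the
  factor t^-n; averages are therefore compared with \<open>bump_mass\<close> times values of
  u.\<close>

definition ball_avg :: "'a::euclidean_space \<Rightarrow> real \<Rightarrow> ('a \<Rightarrow> real) \<Rightarrow> real" where
  "ball_avg c t u = (\<integral>y. u y * (bump c t y / t ^ DIM('a)) \<partial>lborel)"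

lemma bump_has_derivative:
  "(bump c t has_derivative
     (\<lambda>h. flat_exp 2 (1 - ((y - c) \<bullet> (y - c)) / t\<^sup>2) * (- 2 / t\<^sup>2 * ((y - c) \<bullet> h)))) (at y)"
proof -
  have "((\<lambda>y. 1 - k * ((y - c) \<bullet> (y - c))) has_derivative (\<lambda>h. - (2 * k) * ((y - c) \<bullet> h))) (at y)" for k
    by (auto intro!: derivative_eq_intros simp: inner_commute)
  from this[of "1 / t\<^sup>2"] have 1: "((\<lambda>y. 1 - ((y - c) \<bullet> (y - c)) / t\<^sup>2) has_derivative (\<lambda>h. - 2 / t\<^sup>2 * ((y - c) \<bullet> h))) (at y)"
    by simp
  have "(flat_exp 0 has_real_derivative flat_exp 2 z) (at z)" for z
    using flat_exp_deriv[of 0 z] by (simp add: numeral_2_eq_2)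
  then have 2: "(flat_exp 0 has_derivative (\<lambda>h. flat_exp 2 z * h)) (at z)" for z
    by (simp add: has_field_derivative_def)
  show ?thesis
    using has_derivative_compose[OF 1 2] by (simp add: bump_def[abs_def])
qed

lemma flat_exp_2_eq_0:
  assumes "t > 0" "t \<le> norm (y - c)"
  shows "flat_exp 2 (1 - ((y - c) \<bullet> (y - c)) / t\<^sup>2) = 0"
proof -
  have "t\<^sup>2 \<le> (norm (y - c))\<^sup>2" using assms by (intro power_mono) auto
  then show ?thesis
    using assms(1) by (simp add: flat_exp_def power2_norm_eq_inner)
qed

text \<open>If the centre and the radius move linearly, the scaled bump solves a transport equation: its time
  derivative is minus the divergence of (velocity field times scaled bump), a test field for \<open>g\<close>.\<close>

lemma ball_avg_deriv_0:
  fixes c d :: "'a::euclidean_space" and t e :: real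
  assumes ug: "weak_grad_pair \<Omega> u g" and t: "t > 0" and sub: "cball c t \<subseteq> \<Omega>"
  shows "((\<lambda>s. ball_avg (c + s *\<^sub>R d) (t + s * e) u) has_real_derivative
      (\<integral>y. (g y \<bullet> (d + (e / t) *\<^sub>R (y - c))) * (bump c t y / t ^ DIM('a)) \<partial>lborel)) (at 0)"
proof -
  let ?n = "DIM('a)"
  have u: "integrable lborel u" and g: "integrable lborel g" using ug by (auto simp: weak_grad_pair_def)
  define F where "F s y = flat_exp 2 (1 - ((y - (c + s *\<^sub>R d)) \<bullet> (y - (c + s *\<^sub>R d))) / (t + s * e)\<^sup>2)" for s y
  define V where "V s y = d + (e / (t + s * e)) *\<^sub>R (y - (c + s *\<^sub>R d))" for s y
  define K where "K s y = bump (c + s *\<^sub>R d) (t + s * e) y / (t + s * e) ^ ?n" for s y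
  define K' where "K' s y = (2 / (t + s * e)\<^sup>2 * ((y - (c + s *\<^sub>R d)) \<bullet> V s y) * F s y) / (t + s * e) ^ ?n
      - real ?n * e / (t + s * e) * K s y" for s y
  \<comment> \<open>For |s| < \<delta> the radius t + s * e stays above t / 2; the summand 1 keeps
    the quotient meaningful when e = 0.\<close>
  define \<delta> where "\<delta> = t / 2 / (\<bar>e\<bar> + 1)"
  have \<delta>: "\<delta> > 0" and e1: "\<bar>e\<bar> + 1 \<noteq> 0" using t by (auto simp: \<delta>_def)
  have ts: "t + s * e \<ge> t / 2" if "\<bar>s - 0\<bar> < \<delta>" for s
  proof -
    have "\<bar>s * e\<bar> \<le> \<delta> * \<bar>e\<bar>" using that by (simp add: abs_mult mult_right_mono)
    also have "\<dots> \<le> \<delta> * (\<bar>e\<bar> + 1)" using \<delta> by (intro mult_left_mono) auto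
    also have "\<dots> = t / 2" unfolding \<delta>_def using nonzero_eq_divide_eq[OF e1, of "t / 2 / (\<bar>e\<bar> + 1)" "t / 2"] by blast
    finally show ?thesis by linarith
  qed
  have Kder: "((\<lambda>s. K s y) has_real_derivative K' s y) (at s)" if "\<bar>s - 0\<bar> < \<delta>" for s y
  proof -
    have pos: "t + s * e > 0" using ts[OF that] t by linarith
    let ?z = "y - (c + s *\<^sub>R d)" and ?t = "t + s * e"
    have "((\<lambda>s. (y - (c + s *\<^sub>R d)) \<bullet> (y - (c + s *\<^sub>R d))) has_real_derivative (- 2 * (?z \<bullet> d))) (at s)"
      unfolding has_field_derivative_def
      by (auto intro!: derivative_eq_intros simp: inner_commute algebra_simps)
    moreover have "((\<lambda>s. (t + s * e)\<^sup>2) has_real_derivative 2 * ?t * e) (at s)"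
      by (auto intro!: derivative_eq_intros)
    ultimately have "((\<lambda>s. 1 - ((y - (c + s *\<^sub>R d)) \<bullet> (y - (c + s *\<^sub>R d))) / (t + s * e)\<^sup>2) has_real_derivative
        0 - ((- 2 * (?z \<bullet> d)) * ?t\<^sup>2 - (?z \<bullet> ?z) * (2 * ?t * e)) / (?t\<^sup>2 * ?t\<^sup>2)) (at s)"
      using pos by (intro DERIV_diff DERIV_const DERIV_divide) auto
    also have "0 - ((- 2 * (?z \<bullet> d)) * ?t\<^sup>2 - (?z \<bullet> ?z) * (2 * ?t * e)) / (?t\<^sup>2 * ?t\<^sup>2)
        = 2 / ?t\<^sup>2 * (?z \<bullet> V s y)"
    proof -
      have "?z \<bullet> V s y = ?z \<bullet> d + e / ?t * (?z \<bullet> ?z)"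
        unfolding V_def by (metis inner_add_right inner_scaleR_right)
      moreover have "0 - ((- 2 * a) * b\<^sup>2 - k * (2 * b * e)) / (b\<^sup>2 * b\<^sup>2) = 2 / b\<^sup>2 * (a + e / b * k)"
        if "b > 0" for a b k :: real
        using that by (simp add: field_simps power2_eq_square)
      ultimately show ?thesis using pos by metis
    qed
    finally have "((\<lambda>s. 1 - ((y - (c + s *\<^sub>R d)) \<bullet> (y - (c + s *\<^sub>R d))) / (t + s * e)\<^sup>2) has_real_derivative
        2 / ?t\<^sup>2 * (?z \<bullet> V s y)) (at s)" .
    moreover have "(flat_exp 0 has_real_derivative flat_exp 2 z) (at z)" for z
      using flat_exp_deriv[of 0 z] by (simp add: numeral_2_eq_2)
    ultimately have "((\<lambda>s. bump (c + s *\<^sub>R d) (t + s * e) y) has_real_derivative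
        F s y * (2 / ?t\<^sup>2 * (?z \<bullet> V s y))) (at s)"
      unfolding bump_def F_def by (rule DERIV_chain2[rotated])
    moreover have "((\<lambda>s. (t + s * e) ^ ?n) has_real_derivative real ?n * e * ?t ^ (?n - 1)) (at s)"
      by (auto intro!: derivative_eq_intros)
    ultimately have "((\<lambda>s. K s y) has_real_derivative
       (F s y * (2 / ?t\<^sup>2 * (?z \<bullet> V s y)) * ?t ^ ?n - bump (c + s *\<^sub>R d) ?t y * (real ?n * e * ?t ^ (?n - 1)))
         / (?t ^ ?n * ?t ^ ?n)) (at s)"
      unfolding K_def by (rule DERIV_divide) (use pos in auto)
    moreover have "(F s y * (2 / ?t\<^sup>2 * (?z \<bullet> V s y)) * ?t ^ ?n - bump (c + s *\<^sub>R d) ?t y * (real ?n * e * ?t ^ (?n - 1)))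
         / (?t ^ ?n * ?t ^ ?n) = K' s y"
    proof -
      have pw: "?t ^ ?n = ?t * ?t ^ (?n - 1)"
        by (metis DIM_positive power_minus_mult mult.commute)
      have gen: "(a * k * b - p * (real ?n * e * q)) / (b * b)
          = k * a / b - real ?n * e / r * (p / b)" if "b = r * q" "r > 0" "q > 0" for a b k p q r :: real
        using that by (simp add: field_simps)
      show ?thesis unfolding K'_def K_def by (rule gen[OF pw pos zero_less_power[OF pos]])
    qed
    ultimately show ?thesis by simp
  qed
  have Fm: "F s \<in> borel_measurable borel" for s
    unfolding F_def[abs_def]
    by (intro borel_measurable_continuous_onI continuous_on_compose2[OF continuous_on_flat_exp[of UNIV]])
       (auto intro!: continuous_intros simp: divide_inverse)
  have Vm: "(\<lambda>y. (y - (c + s *\<^sub>R d)) \<bullet> V s y) \<in> borel_measurable borel" for s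
    unfolding V_def[abs_def] by (intro borel_measurable_continuous_onI continuous_intros)
  have Km: "K s \<in> borel_measurable borel" for s
    unfolding K_def[abs_def] by simp
  have K'm: "K' s \<in> borel_measurable borel" for s
    unfolding K'_def[abs_def] using Fm Km Vm by simp
  have Kb: "\<bar>K s y\<bar> \<le> 1 / (t / 2) ^ ?n" if "\<bar>s - 0\<bar> < \<delta>" for s y
  proof -
    have "t / 2 \<le> t + s * e" "0 < t / 2" using ts[OF that] t by auto
    then have "(t / 2) ^ ?n \<le> (t + s * e) ^ ?n" "0 < (t / 2) ^ ?n" by (auto intro: power_mono)
    moreover from this have "bump (c + s *\<^sub>R d) (t + s * e) y / (t + s * e) ^ ?n \<le> 1 / (t / 2) ^ ?n"
      by (intro frac_le bump_le_1) auto
    ultimately show ?thesis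
      unfolding K_def using bump_nonneg[of "c + s *\<^sub>R d" "t + s * e" y] by simp
  qed
  \<comment> \<open>A crude bound: the radius lies between t / 2 and 3/2 * t, F is at most 2, and on
    the moving ball the velocity V is at most |d| + |e|.\<close>
  define B where "B = 2 / (t/2)\<^sup>2 * (3/2 * t) * (norm d + \<bar>e\<bar>) * 2 / (t/2) ^ ?n + real ?n * \<bar>e\<bar> / (t/2) * (1 / (t/2) ^ ?n)"
  have K'b: "\<bar>K' s y\<bar> \<le> B" if s: "\<bar>s - 0\<bar> < \<delta>" for s y
  proof -
    let ?z = "y - (c + s *\<^sub>R d)" and ?t = "t + s * e"
    have tl: "t / 2 \<le> ?t" using ts[OF s] .
    have se: "\<bar>s * e\<bar> \<le> t / 2"
      using ts[OF s] ts[of "-s"] s by (simp add: abs_le_iff)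
    then have tu: "?t \<le> 3/2 * t" by linarith
    have n: "(t / 2) ^ ?n \<le> ?t ^ ?n" "0 < (t / 2) ^ ?n" "(t/2)\<^sup>2 \<le> ?t\<^sup>2"
      using tl t by (auto intro: power_mono)
    have F: "0 \<le> F s y" "F s y \<le> 2" by (auto simp: F_def flat_exp_nonneg flat_exp_2_le)
    have zV: "\<bar>(?z \<bullet> V s y) * F s y\<bar> \<le> (3/2 * t) * (norm d + \<bar>e\<bar>) * 2"
    proof (cases "norm ?z < ?t")
      case True
      have "norm (V s y) \<le> norm d + norm ((e / ?t) *\<^sub>R ?z)" unfolding V_def by (rule norm_triangle_ineq)
      also have "norm ((e / ?t) *\<^sub>R ?z) = \<bar>e\<bar> * (norm ?z / ?t)" using tl t by (simp add: abs_div)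
      also have "\<dots> \<le> \<bar>e\<bar> * 1" using True tl t by (intro mult_left_mono) auto
      finally have "norm (V s y) \<le> norm d + \<bar>e\<bar>" by simp
      moreover have "norm ?z \<le> 3/2 * t" using True tu by linarith
      ultimately have "norm ?z * norm (V s y) \<le> (3/2 * t) * (norm d + \<bar>e\<bar>)"
        using t by (intro mult_mono) auto
      then have "\<bar>?z \<bullet> V s y\<bar> \<le> (3/2 * t) * (norm d + \<bar>e\<bar>)"
        using Cauchy_Schwarz_ineq2[of ?z "V s y"] by linarith
      then show ?thesis unfolding abs_mult using F t by (intro mult_mono) auto
    next
      case False
      then have "F s y = 0" unfolding F_def using tl t by (intro flat_exp_2_eq_0) auto
      then show ?thesis using t by simp
    qed
    have "\<bar>K' s y\<bar> \<le> \<bar>(2 / ?t\<^sup>2 * (?z \<bullet> V s y) * F s y) / ?t ^ ?n\<bar> + \<bar>real ?n * e / ?t * K s y\<bar>"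
      unfolding K'_def by (rule abs_triangle_ineq4)
    also have "\<bar>(2 / ?t\<^sup>2 * (?z \<bullet> V s y) * F s y) / ?t ^ ?n\<bar> = 2 / ?t\<^sup>2 * \<bar>(?z \<bullet> V s y) * F s y\<bar> / ?t ^ ?n"
      using tl t by (simp add: abs_mult)
    also have "\<dots> \<le> 2 / (t/2)\<^sup>2 * ((3/2 * t) * (norm d + \<bar>e\<bar>) * 2) / (t/2) ^ ?n"
      using zV n t tl by (intro frac_le mult_mono) (auto intro!: divide_left_mono simp: mult_nonneg_nonneg)
    also have "\<bar>real ?n * e / ?t * K s y\<bar> = real ?n * \<bar>e\<bar> / ?t * \<bar>K s y\<bar>"
      using tl t by (simp add: abs_mult)
    also have "\<dots> \<le> real ?n * \<bar>e\<bar> / (t/2) * (1 / (t/2) ^ ?n)"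
      using Kb[OF s, of y] tl t by (intro mult_mono frac_le) auto
    finally show ?thesis by (simp add: B_def mult.assoc)
  qed
  have der: "((\<lambda>s. \<integral>y. u y * K s y \<partial>lborel) has_real_derivative (\<integral>y. u y * K' 0 y \<partial>lborel)) (at 0)"
    by (rule has_real_derivative_integral_kernel[OF u \<delta> Kder K'b Kb Km K'm])
  have supp0: "bump c t y = 0" if "t \<le> norm (y - c)" for y
    using bump_eq_0[of t c y] t that by (simp add: dist_norm norm_minus_commute)
  \<comment> \<open>Component i of velocity times scaled bump at time 0. It is supported in the
    ball, hence an admissible test function.\<close>
  define \<eta> where "\<eta> i y = (d \<bullet> i + e / t * ((y - c) \<bullet> i)) * (bump c t y * (1 / t ^ ?n))" for i y
  have \<eta>test: "\<eta> i \<in> test_functions \<Omega>" for i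
  proof (rule test_functionI[OF _ t _ sub])
    show "Ck k (\<eta> i)" for k
      unfolding \<eta>_def[abs_def] by (intro Ck_mult Ck_add Ck_const Ck_affine Ck_bump)
    show "\<eta> i y = 0" if "dist c y \<ge> t" for y using that t by (simp add: \<eta>_def bump_eq_0)
  qed
  have \<eta>der: "frechet_derivative (\<eta> i) (at y) i =
      e / t * K 0 y - (V 0 y \<bullet> i) * ((y - c) \<bullet> i) * (2 / t\<^sup>2 * F 0 y / t ^ ?n)" if i: "i \<in> Basis" for i y
  proof -
    have F0: "F 0 y = flat_exp 2 (1 - ((y - c) \<bullet> (y - c)) / t\<^sup>2)" by (simp add: F_def)
    have "(\<eta> i has_derivative (\<lambda>h. (d \<bullet> i + e / t * ((y - c) \<bullet> i)) *
        ((F 0 y * (- 2 / t\<^sup>2 * ((y - c) \<bullet> h))) * (1 / t ^ ?n)) + (e / t * (h \<bullet> i)) * (bump c t y * (1 / t ^ ?n)))) (at y)"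
      unfolding \<eta>_def[abs_def]
    proof (rule has_derivative_mult)
      show "((\<lambda>y. d \<bullet> i + e / t * ((y - c) \<bullet> i)) has_derivative (\<lambda>h. e / t * (h \<bullet> i))) (at y)"
        using t by (auto intro!: derivative_eq_intros)
      show "((\<lambda>y. bump c t y * (1 / t ^ ?n)) has_derivative
          (\<lambda>h. F 0 y * (- 2 / t\<^sup>2 * ((y - c) \<bullet> h)) * (1 / t ^ ?n))) (at y)"
        unfolding F0 by (rule has_derivative_mult_left[OF bump_has_derivative])
    qed
    then have fd: "frechet_derivative (\<eta> i) (at y) = (\<lambda>h. (d \<bullet> i + e / t * ((y - c) \<bullet> i)) *
        ((F 0 y * (- 2 / t\<^sup>2 * ((y - c) \<bullet> h))) * (1 / t ^ ?n)) + (e / t * (h \<bullet> i)) * (bump c t y * (1 / t ^ ?n)))"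
      by (rule frechet_derivative_at[symmetric])
    have V0: "V 0 y \<bullet> i = d \<bullet> i + e / t * ((y - c) \<bullet> i)" by (simp add: V_def inner_add_left)
    have K0: "K 0 y = bump c t y / t ^ ?n" by (simp add: K_def)
    have gen: "a * ((f * (- 2 / p * z)) * (1 / w)) + (r * 1) * (b * (1 / w)) = r * (b / w) - a * z * (2 / p * f / w)"
      for a f p z w r b :: real
      by (simp add: divide_inverse mult_ac)
    show ?thesis unfolding fd V0 K0 inner_same_Basis[OF i] by (rule gen)
  qed
  \<comment> \<open>The transport equation. Differentiating the bump produces the term with F; the
    divergence of the velocity field is n * e / t and produces the remaining term of K'.\<close>
  have divK: "(\<Sum>i\<in>Basis. frechet_derivative (\<eta> i) (at y) i) = - K' 0 y" for y
  proof -
    have "(\<Sum>i\<in>Basis. frechet_derivative (\<eta> i) (at y) i)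
      = (\<Sum>i\<in>Basis. e / t * K 0 y - (V 0 y \<bullet> i) * ((y - c) \<bullet> i) * (2 / t\<^sup>2 * F 0 y / t ^ ?n))"
      by (intro sum.cong refl \<eta>der)
    also have "\<dots> = real ?n * (e / t * K 0 y) - (\<Sum>i\<in>Basis. (V 0 y \<bullet> i) * ((y - c) \<bullet> i)) * (2 / t\<^sup>2 * F 0 y / t ^ ?n)"
      by (simp only: sum_distrib_right sum_subtractf sum_constant)
    also have "(\<Sum>i\<in>Basis. (V 0 y \<bullet> i) * ((y - c) \<bullet> i)) = (y - c) \<bullet> V 0 y"
      using euclidean_inner[of "V 0 y" "y - c"] by (simp only: inner_commute[of "y - c" "V 0 y"])
    finally show ?thesis by (simp add: K'_def mult_ac)
  qed
  have \<eta>b: "\<bar>\<eta> i y\<bar> \<le> (norm d + \<bar>e\<bar>) / t ^ ?n" if i: "i \<in> Basis" for i y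
  proof (cases "norm (y - c) < t")
    case True
    have "\<bar>d \<bullet> i\<bar> \<le> norm d" using i by (rule Basis_le_norm)
    moreover have "\<bar>e / t * ((y - c) \<bullet> i)\<bar> \<le> \<bar>e\<bar>"
    proof -
      have "\<bar>(y - c) \<bullet> i\<bar> \<le> t" using Basis_le_norm[OF i, of "y - c"] True by linarith
      then have "\<bar>e\<bar> * (\<bar>(y - c) \<bullet> i\<bar> / t) \<le> \<bar>e\<bar> * 1" using t by (intro mult_left_mono) auto
      then show ?thesis using t by (simp add: abs_mult)
    qed
    ultimately have "\<bar>d \<bullet> i + e / t * ((y - c) \<bullet> i)\<bar> \<le> norm d + \<bar>e\<bar>" by linarith
    moreover have "\<bar>bump c t y * (1 / t ^ ?n)\<bar> \<le> 1 * (1 / t ^ ?n)"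
      unfolding abs_mult using bump_nonneg[of c t y] bump_le_1[of c t y] t by (intro mult_mono) auto
    ultimately have "\<bar>d \<bullet> i + e / t * ((y - c) \<bullet> i)\<bar> * \<bar>bump c t y * (1 / t ^ ?n)\<bar> \<le> (norm d + \<bar>e\<bar>) * (1 * (1 / t ^ ?n))"
      by (intro mult_mono) auto
    then show ?thesis by (simp add: \<eta>_def abs_mult)
  next
    case False
    then show ?thesis using supp0[of y] t by (simp add: \<eta>_def)
  qed
  have \<eta>m: "\<eta> i \<in> borel_measurable borel" for i
    using \<eta>test[of i] by (intro borel_measurable_continuous_onI) (auto simp: test_functions_def dest: spec[of _ 0])
  have \<eta>'b: "\<exists>b. \<forall>y. \<bar>frechet_derivative (\<eta> i) (at y) i\<bar> \<le> b"
    and \<eta>'m: "(\<lambda>y. frechet_derivative (\<eta> i) (at y) i) \<in> borel_measurable borel" if i: "i \<in> Basis" for i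
  proof -
    have cont: "continuous_on UNIV (\<lambda>y. frechet_derivative (\<eta> i) (at y) i)"
      using \<eta>test[of i] i by (auto simp: test_functions_def dest: spec[of _ "Suc 0"])
    then show "(\<lambda>y. frechet_derivative (\<eta> i) (at y) i) \<in> borel_measurable borel"
      by (rule borel_measurable_continuous_onI)
    have "compact ((\<lambda>y. frechet_derivative (\<eta> i) (at y) i) ` cball c t)"
      by (intro compact_continuous_image continuous_on_subset[OF cont]) auto
    then obtain b where b: "\<And>y. y \<in> cball c t \<Longrightarrow> \<bar>frechet_derivative (\<eta> i) (at y) i\<bar> \<le> b"
      by (fastforce dest: compact_imp_bounded simp: bounded_iff)
    have "frechet_derivative (\<eta> i) (at y) i = 0" if "y \<notin> cball c t" for y
    proof -
      have n: "norm (y - c) > t" using that by (simp add: dist_norm norm_minus_commute)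
      then have "F 0 y = 0" unfolding F_def using flat_exp_2_eq_0[of t y c] t by simp
      moreover have "K 0 y = 0" unfolding K_def using supp0 n by simp
      ultimately show ?thesis using \<eta>der[OF i] by simp
    qed
    then show "\<exists>b. \<forall>y. \<bar>frechet_derivative (\<eta> i) (at y) i\<bar> \<le> b"
      using b by (intro exI[of _ "max b 0"]) (smt (verit, best) max.cobounded1 max.cobounded2)
  qed
  have int1: "integrable lborel (\<lambda>y. u y * frechet_derivative (\<eta> i) (at y) i)" if "i \<in> Basis" for i
    using \<eta>'b[OF that] integrable_mult_bounded[OF u \<eta>'m[OF that]] by blast
  have gi: "integrable lborel (\<lambda>y. g y \<bullet> i)" for i
    using g by (rule integrable_inner_left)
  have int2: "integrable lborel (\<lambda>y. (g y \<bullet> i) * \<eta> i y)" if "i \<in> Basis" for i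
    by (rule integrable_mult_bounded[OF gi \<eta>m \<eta>b[OF that]])
  have "(\<integral>y. u y * K' 0 y \<partial>lborel) = (\<integral>y. - (\<Sum>i\<in>Basis. u y * frechet_derivative (\<eta> i) (at y) i) \<partial>lborel)"
    using divK by (simp add: sum_distrib_left[symmetric])
  also have "\<dots> = - (\<Sum>i\<in>Basis. \<integral>y. u y * frechet_derivative (\<eta> i) (at y) i \<partial>lborel)"
    by (simp add: int1)
  also have "\<dots> = (\<Sum>i\<in>Basis. \<integral>y. (g y \<bullet> i) * \<eta> i y \<partial>lborel)"
    using ug \<eta>test by (simp add: weak_grad_pair_def sum_negf)
  also have "\<dots> = (\<integral>y. (\<Sum>i\<in>Basis. (g y \<bullet> i) * \<eta> i y) \<partial>lborel)"
    by (simp add: int2)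
  also have "\<dots> = (\<integral>y. (g y \<bullet> (d + (e / t) *\<^sub>R (y - c))) * (bump c t y / t ^ DIM('a)) \<partial>lborel)"
  proof (intro Bochner_Integration.integral_cong refl)
    fix y
    have "(\<Sum>i\<in>Basis. (g y \<bullet> i) * \<eta> i y) = (\<Sum>i\<in>Basis. (g y \<bullet> i) * ((d + (e / t) *\<^sub>R (y - c)) \<bullet> i)) * (bump c t y / t ^ DIM('a))"
      unfolding \<eta>_def sum_distrib_right by (rule sum.cong) (simp_all add: inner_add_left)
    also have "(\<Sum>i\<in>Basis. (g y \<bullet> i) * ((d + (e / t) *\<^sub>R (y - c)) \<bullet> i)) = g y \<bullet> (d + (e / t) *\<^sub>R (y - c))"
      by (rule euclidean_inner[symmetric])
    finally show "(\<Sum>i\<in>Basis. (g y \<bullet> i) * \<eta> i y) = (g y \<bullet> (d + (e / t) *\<^sub>R (y - c))) * (bump c t y / t ^ DIM('a))" .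
  qed
  finally show ?thesis using der by (simp add: ball_avg_def K_def)
qed


lemma ball_avg_deriv:
  fixes c d :: "'a::euclidean_space" and s :: real
  assumes ug: "weak_grad_pair \<Omega> u g" and t: "t + s * e > 0" and sub: "cball (c + s *\<^sub>R d) (t + s * e) \<subseteq> \<Omega>"
  shows "((\<lambda>s. ball_avg (c + s *\<^sub>R d) (t + s * e) u) has_real_derivative
      (\<integral>y. (g y \<bullet> (d + (e / (t + s * e)) *\<^sub>R (y - (c + s *\<^sub>R d)))) *
          (bump (c + s *\<^sub>R d) (t + s * e) y / (t + s * e) ^ DIM('a)) \<partial>lborel)) (at s)"
proof -
  have "((\<lambda>z. ball_avg (c + (z + s) *\<^sub>R d) (t + (z + s) * e) u) has_real_derivative
      (\<integral>y. (g y \<bullet> (d + (e / (t + s * e)) *\<^sub>R (y - (c + s *\<^sub>R d)))) *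
          (bump (c + s *\<^sub>R d) (t + s * e) y / (t + s * e) ^ DIM('a)) \<partial>lborel)) (at 0)"
    using ball_avg_deriv_0[OF ug t sub, of d e] by (simp add: algebra_simps)
  then show ?thesis
    using DERIV_shift[of "\<lambda>s. ball_avg (c + s *\<^sub>R d) (t + s * e) u" _ 0 s] by simp
qed

text \<open>Mean value theorem along the linear motion from one ball to the other. On the moving
  ball the velocity is at most |d| + |e| and the kernel at most r^-n. Only the gradient in a set B
  containing all intermediate balls is charged; this localisation is what later produces a potential
  instead of a plain L^1 norm.\<close>

lemma ball_avg_diff_le:
  fixes c d :: "'a::euclidean_space" and t e r :: real
  assumes ug: "weak_grad_pair \<Omega> u g" and r: "r > 0" "r \<le> t" "r \<le> t + e" and B: "B \<in> sets borel"
    and sub: "\<And>s. 0 \<le> s \<Longrightarrow> s \<le> 1 \<Longrightarrow> cball (c + s *\<^sub>R d) (t + s * e) \<subseteq> \<Omega> \<inter> B"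
  shows "\<bar>ball_avg (c + d) (t + e) u - ball_avg c t u\<bar>
    \<le> (norm d + \<bar>e\<bar>) / r ^ DIM('a) * (\<integral>y. indicator B y * norm (g y) \<partial>lborel)"
proof -
  let ?n = "DIM('a)"
  let ?V = "\<lambda>s y. d + (e / (t + s * e)) *\<^sub>R (y - (c + s *\<^sub>R d))"
  let ?K = "\<lambda>s y. bump (c + s *\<^sub>R d) (t + s * e) y / (t + s * e) ^ DIM('a)"
  have g: "integrable lborel g" using ug by (simp add: weak_grad_pair_def)
  have ts: "r \<le> t + s * e" if "0 \<le> s" "s \<le> 1" for s
  proof -
    have "t + s * e = (1 - s) * t + s * (t + e)" by (simp add: algebra_simps)
    moreover have "(1 - s) * r + s * r \<le> (1 - s) * t + s * (t + e)"
      using that r by (intro add_mono mult_left_mono) auto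
    ultimately show ?thesis by (simp add: algebra_simps)
  qed
  obtain z where z: "0 < z" "z < 1"
    and eq: "ball_avg (c + 1 *\<^sub>R d) (t + 1 * e) u - ball_avg (c + 0 *\<^sub>R d) (t + 0 * e) u
      = (1 - 0) * (\<integral>y. (g y \<bullet> ?V z y) * ?K z y \<partial>lborel)"
  proof -
    have "\<exists>z. 0 < z \<and> z < 1 \<and> ball_avg (c + 1 *\<^sub>R d) (t + 1 * e) u - ball_avg (c + 0 *\<^sub>R d) (t + 0 * e) u
      = (1 - 0) * (\<integral>y. (g y \<bullet> ?V z y) * ?K z y \<partial>lborel)"
    proof (rule MVT2[of 0 1 "\<lambda>s. ball_avg (c + s *\<^sub>R d) (t + s * e) u"])
      fix s :: real assume s: "0 \<le> s" "s \<le> 1"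
      show "DERIV (\<lambda>s. ball_avg (c + s *\<^sub>R d) (t + s * e) u) s :> (\<integral>y. (g y \<bullet> ?V s y) * ?K s y \<partial>lborel)"
        using ts[OF s] r sub[OF s] by (intro ball_avg_deriv[OF ug]) auto
    qed simp
    then show ?thesis using that by blast
  qed
  have zt: "r \<le> t + z * e" using ts z by simp
  have bd: "norm ((g y \<bullet> ?V z y) * ?K z y) \<le> (norm d + \<bar>e\<bar>) / r ^ ?n * (indicator B y * norm (g y))" for y
  proof (cases "dist (c + z *\<^sub>R d) y < t + z * e")
    case True
    then have yB: "y \<in> B" using sub[of z] z by (auto simp: subset_iff)
    let ?w = "y - (c + z *\<^sub>R d)"
    have "norm (?V z y) \<le> norm d + norm ((e / (t + z * e)) *\<^sub>R ?w)" by (rule norm_triangle_ineq)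
    also have "norm ((e / (t + z * e)) *\<^sub>R ?w) = \<bar>e\<bar> * (norm ?w / (t + z * e))" using zt r by (simp add: abs_div)
    also have "\<dots> \<le> \<bar>e\<bar> * 1"
      using True zt r by (intro mult_left_mono) (auto simp: dist_norm norm_minus_commute)
    finally have V: "norm (?V z y) \<le> norm d + \<bar>e\<bar>" by simp
    have "\<bar>g y \<bullet> ?V z y\<bar> \<le> norm (g y) * norm (?V z y)" by (rule Cauchy_Schwarz_ineq2)
    also have "\<dots> \<le> norm (g y) * (norm d + \<bar>e\<bar>)" using V by (intro mult_left_mono) auto
    finally have 1: "\<bar>g y \<bullet> ?V z y\<bar> \<le> norm (g y) * (norm d + \<bar>e\<bar>)" .
    have "r ^ ?n \<le> (t + z * e) ^ ?n" using zt r by (intro power_mono) auto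
    then have "?K z y \<le> 1 / r ^ ?n" using r by (intro frac_le bump_le_1) auto
    moreover have "0 \<le> ?K z y" using bump_nonneg zt r by (intro divide_nonneg_nonneg) auto
    ultimately have 2: "\<bar>?K z y\<bar> \<le> 1 / r ^ ?n" by linarith
    have "norm ((g y \<bullet> ?V z y) * ?K z y) \<le> (norm (g y) * (norm d + \<bar>e\<bar>)) * (1 / r ^ ?n)"
      unfolding real_norm_def abs_mult[of "g y \<bullet> ?V z y"] by (rule mult_mono[OF 1 2]) auto
    then show ?thesis using yB by (simp add: mult_ac)
  next
    case False
    then have "bump (c + z *\<^sub>R d) (t + z * e) y = 0" using zt r by (intro bump_eq_0) auto
    then show ?thesis using r by (simp add: indicator_def)
  qed
  have int: "integrable lborel (\<lambda>y. (norm d + \<bar>e\<bar>) / r ^ ?n * (indicator B y * norm (g y)))"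
    using integrable_mult_indicator[of B lborel "\<lambda>y. norm (g y)"] g B by auto
  have "\<bar>\<integral>y. (g y \<bullet> ?V z y) * ?K z y \<partial>lborel\<bar>
      \<le> (\<integral>y. (norm d + \<bar>e\<bar>) / r ^ ?n * (indicator B y * norm (g y)) \<partial>lborel)"
  \<comment> \<open>A non-integrable integrand has Bochner integral 0, so that case is
    trivial.\<close>
  proof (cases "integrable lborel (\<lambda>y. (g y \<bullet> ?V z y) * ?K z y)")
    case True
    then show ?thesis
      using Bochner_Integration.integral_norm_bound_integral[OF _ int, of "\<lambda>y. (g y \<bullet> ?V z y) * ?K z y"] bd by simp
  next
    case False
    have "0 \<le> (\<integral>y. (norm d + \<bar>e\<bar>) / r ^ ?n * (indicator B y * norm (g y)) \<partial>lborel)"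
      using r by (intro Bochner_Integration.integral_nonneg) auto
    then show ?thesis unfolding not_integrable_integral_eq[OF False] by simp
  qed
  then show ?thesis using eq by simp
qed

section \<open>Lebesgue points\<close>

lemma integrable_translate:
  fixes f :: "'a::euclidean_space \<Rightarrow> 'b::{banach, second_countable_topology}"
  assumes "integrable lborel f"
  shows "integrable lborel (\<lambda>x. f (z + x))"
proof -
  have "f \<in> borel_measurable borel" using borel_measurable_integrable[OF assms] by simp
  moreover have "integrable (distr lborel borel ((+) z)) f" using assms by (simp add: lborel_distr_plus)
  ultimately show ?thesis by (subst (asm) integrable_distr_eq) simp_all
qed

lemma integral_translate:
  fixes f :: "'a::euclidean_space \<Rightarrow> 'b::{banach, second_countable_topology}"
  assumes "f \<in> borel_measurable borel"
  shows "(\<integral>x. f (z + x) \<partial>lborel) = (\<integral>x. f x \<partial>lborel)"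
  using assms by (subst lborel_distr_plus[symmetric, of z], subst integral_distr) auto

lemma lborel_integrable_borel:
  "integrable lborel f \<Longrightarrow> f \<in> borel_measurable borel"
  using borel_measurable_integrable by force

section \<open>Continuity of translations in L^1\<close>

definition L1_shift :: "('a::euclidean_space \<Rightarrow> real) \<Rightarrow> 'a \<Rightarrow> real" where
  "L1_shift u z = (\<integral>x. \<bar>u (z + x) - u x\<bar> \<partial>lborel)"

lemma L1_shift_nonneg: "0 \<le> L1_shift u z"
  by (simp add: L1_shift_def)

lemma L1_shift_add:
  assumes "integrable lborel u" "integrable lborel v"
  shows "L1_shift (\<lambda>x. u x + v x) z \<le> L1_shift u z + L1_shift v z"
proof -
  have i: "integrable lborel (\<lambda>x. \<bar>u (z + x) - u x\<bar>)" "integrable lborel (\<lambda>x. \<bar>v (z + x) - v x\<bar>)"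
    using assms by (auto intro!: integrable_translate)
  show ?thesis
    unfolding L1_shift_def Bochner_Integration.integral_add[OF i, symmetric]
    using assms i by (intro integral_mono) (auto intro!: integrable_translate Bochner_Integration.integrable_add)
qed

lemma L1_shift_le:
  assumes "integrable lborel u"
  shows "L1_shift u z \<le> 2 * (\<integral>x. \<bar>u x\<bar> \<partial>lborel)"
proof -
  have i: "integrable lborel (\<lambda>x. \<bar>u (z + x)\<bar>)" "integrable lborel (\<lambda>x. \<bar>u x\<bar>)"
    using assms by (auto intro!: integrable_translate)
  have "L1_shift u z \<le> (\<integral>x. \<bar>u (z + x)\<bar> + \<bar>u x\<bar> \<partial>lborel)"
    unfolding L1_shift_def using assms i by (intro integral_mono) (auto intro!: integrable_translate)
  also have "\<dots> = (\<integral>x. \<bar>u (z + x)\<bar> \<partial>lborel) + (\<integral>x. \<bar>u x\<bar> \<partial>lborel)"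
    by (rule Bochner_Integration.integral_add[OF i])
  also have "(\<integral>x. \<bar>u (z + x)\<bar> \<partial>lborel) = (\<integral>x. \<bar>u x\<bar> \<partial>lborel)"
    using assms lborel_integrable_borel by (intro integral_translate) auto
  finally show ?thesis by simp
qed

text \<open>Split f as (f - s i) + s i: shifting the first summand costs at most twice its L^1 norm,
  uniformly in z. The domination by 2 * |f| is the form of limit that
  \<open>integrable_induct\<close> supplies.\<close>

lemma L1_shift_limit:
  assumes s: "\<And>i. integrable lborel (s i)" "\<And>i. (L1_shift (s i) \<longlongrightarrow> 0) (at 0)"
    and lim: "\<And>x. (\<lambda>i. s i x) \<longlonglongrightarrow> f x" and le: "\<And>i x. \<bar>s i x\<bar> \<le> 2 * \<bar>f x\<bar>"
    and f: "integrable lborel f"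
  shows "(L1_shift f \<longlongrightarrow> 0) (at 0)"
proof (rule tendstoI)
  fix e :: real assume e: "e > 0"
  have "(\<lambda>i. \<integral>x. \<bar>s i x - f x\<bar> \<partial>lborel) \<longlonglongrightarrow> (\<integral>x. 0 \<partial>(lborel :: 'a measure))"
  proof (rule integral_dominated_convergence[where w = "\<lambda>x. 3 * \<bar>f x\<bar>"])
    show "AE x in lborel. (\<lambda>i. \<bar>s i x - f x\<bar>) \<longlonglongrightarrow> 0"
    proof (intro always_eventually allI)
      fix x
      have "(\<lambda>i. \<bar>s i x - f x\<bar>) \<longlonglongrightarrow> \<bar>f x - f x\<bar>" by (intro tendsto_intros lim)
      then show "(\<lambda>i. \<bar>s i x - f x\<bar>) \<longlonglongrightarrow> 0" by simp
    qed
    show "AE x in lborel. norm \<bar>s i x - f x\<bar> \<le> 3 * \<bar>f x\<bar>" for i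
      using le[of i] by (intro always_eventually allI) (smt (verit) real_norm_def)
  qed (use s f in auto)
  then have "eventually (\<lambda>i. dist (\<integral>x. \<bar>s i x - f x\<bar> \<partial>lborel) 0 < e / 4) sequentially"
    using e by (intro tendstoD) auto
  then obtain i where i: "(\<integral>x. \<bar>s i x - f x\<bar> \<partial>lborel) < e / 4"
    by (auto simp: eventually_sequentially dest: spec)
  have "eventually (\<lambda>z. dist (L1_shift (s i) z) 0 < e / 2) (at 0)"
    using s(2) e by (intro tendstoD) auto
  then show "eventually (\<lambda>z. dist (L1_shift f z) 0 < e) (at 0)"
  proof eventually_elim
    case (elim z)
    have "L1_shift (\<lambda>x. (f x - s i x) + s i x) z \<le> L1_shift (\<lambda>x. f x - s i x) z + L1_shift (s i) z"
      using s f by (intro L1_shift_add) auto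
    moreover have "L1_shift (\<lambda>x. f x - s i x) z \<le> 2 * (\<integral>x. \<bar>f x - s i x\<bar> \<partial>lborel)"
      using s f by (intro L1_shift_le) auto
    ultimately show ?case
      using i elim L1_shift_nonneg[of f z] L1_shift_nonneg[of "s i" z]
      by (simp add: abs_minus_commute)
  qed
qed

text \<open>Squeeze A between a compact K and an open U of almost the same measure. A shift shorter
  than the distance from K to the complement of U changes the indicator of A at x only if x or z + x
  lies in U - K.\<close>

lemma L1_shift_indicator_bounded:
  fixes A :: "'a::euclidean_space set"
  assumes A: "A \<in> sets borel" "bounded A"
  shows "(L1_shift (indicator A) \<longlongrightarrow> 0) (at 0)"
proof (rule tendstoI)
  fix e :: real assume e: "e > 0"
  have Al: "A \<in> sets lebesgue" using A(1) sets_completionI_sets[of A lborel] by simp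
  \<comment> \<open>Four masses are added in the end, those of A - K and U - A, each once shifted
    and once not: 4 * e / 5 < e.\<close>
  have e5: "0 < e / 5" using e by simp
  obtain U where U: "open U" "A \<subseteq> U" "emeasure lebesgue (U - A) < ennreal (e / 5)"
    using sets_lebesgue_outer_open[OF Al e5] by blast
  obtain K where K: "closed K" "K \<subseteq> A" "emeasure lebesgue (A - K) < ennreal (e / 5)"
    using sets_lebesgue_inner_closed[OF Al e5] by metis
  have sets: "U \<in> sets borel" "K \<in> sets borel" using borel_open[OF U(1)] borel_closed[OF K(1)] by simp_all
  have sUA: "U - A \<in> sets lborel" and sAK: "A - K \<in> sets lborel" using sets A(1) by (simp_all add: sets.Diff)
  have mU: "emeasure lborel (U - A) < ennreal (e / 5)" and mK: "emeasure lborel (A - K) < ennreal (e / 5)"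
    using U(3) K(3) sUA sAK by simp_all
  have iU: "integrable lborel (indicator (U - A) :: 'a \<Rightarrow> real)"
    by (rule integrable_real_indicator[OF sUA less_trans[OF mU]]) simp
  have iK: "integrable lborel (indicator (A - K) :: 'a \<Rightarrow> real)"
    by (rule integrable_real_indicator[OF sAK less_trans[OF mK]]) simp
  have IU: "(\<integral>x. indicator (U - A) x \<partial>lborel) \<le> e / 5" and IK: "(\<integral>x. indicator (A - K) x \<partial>lborel) \<le> e / 5"
    using enn2real_leI[OF less_imp_le[OF e5] less_imp_le[OF mU]] enn2real_leI[OF less_imp_le[OF e5] less_imp_le[OF mK]]
    by (simp_all add: measure_def)
  have "compact K" using K A bounded_subset compact_eq_bounded_closed by blast
  have "\<exists>\<delta>>0. \<forall>x\<in>K. ball x \<delta> \<subseteq> U"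
  proof -
    obtain \<delta> where "\<delta> > 0" "(\<Union>x\<in>K. ball x \<delta>) \<subseteq> U"
      using compact_subset_open_imp_ball_epsilon_subset[OF \<open>compact K\<close> U(1)] K U by blast
    then show ?thesis by blast
  qed
  then obtain \<delta> where \<delta>: "\<delta> > 0" "\<And>x. x \<in> K \<Longrightarrow> ball x \<delta> \<subseteq> U" by blast
  have "eventually (\<lambda>z::'a. dist z 0 < \<delta>) (at 0)" using \<delta> by (auto simp: eventually_at)
  then show "eventually (\<lambda>z. dist (L1_shift (indicator A) z) 0 < e) (at 0)"
  proof eventually_elim
    case (elim z)
    let ?f = "\<lambda>x. indicator (A - K) x + indicator (U - A) x :: real"
    have f: "integrable lborel ?f" using iU iK by auto
    have "L1_shift (indicator A) z \<le> (\<integral>x. ?f (z + x) + ?f x \<partial>lborel)"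
      unfolding L1_shift_def
    proof (rule integral_mono)
      have "emeasure lborel A < \<infinity>" using A emeasure_bounded_finite by blast
      then have "integrable lborel (indicator A :: 'a \<Rightarrow> real)" using A by (intro integrable_real_indicator) auto
      then show "integrable lborel (\<lambda>x. \<bar>indicator A (z + x) - indicator A x :: real\<bar>)"
        by (intro integrable_abs Bochner_Integration.integrable_diff integrable_translate)
      show "integrable lborel (\<lambda>x. ?f (z + x) + ?f x)"
        by (rule Bochner_Integration.integrable_add[OF integrable_translate[OF f] f])
      fix x
      have 1: "z + x \<in> U" if "x \<in> K" using \<delta>(2)[OF that] elim by (auto simp: subset_iff dist_norm)
      have 2: "x \<in> U" if "z + x \<in> K" using \<delta>(2)[OF that] elim by (auto simp: subset_iff dist_norm)
      show "\<bar>indicator A (z + x) - indicator A x :: real\<bar> \<le> ?f (z + x) + ?f x"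
        using 1 2 by (auto simp: indicator_def)
    qed
    also have "\<dots> = (\<integral>x. ?f (z + x) \<partial>lborel) + (\<integral>x. ?f x \<partial>lborel)"
      by (rule Bochner_Integration.integral_add[OF integrable_translate[OF f] f])
    also have "(\<integral>x. ?f (z + x) \<partial>lborel) = (\<integral>x. ?f x \<partial>lborel)"
      using f by (intro integral_translate lborel_integrable_borel)
    also have "(\<integral>x. ?f x \<partial>lborel) = (\<integral>x. indicator (A - K) x \<partial>lborel) + (\<integral>x. indicator (U - A) x \<partial>lborel)"
      using iU iK by (intro Bochner_Integration.integral_add) auto
    finally show ?case using IU IK e L1_shift_nonneg[of "indicator A" z] by simp
  qed
qed

text \<open>Induction over integrable functions; an indicator of finite measure is first
  approximated by its restrictions to balls, where the squeezing argument applies.\<close>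

lemma L1_shift_tendsto_0:
  fixes u :: "'a::euclidean_space \<Rightarrow> real"
  assumes "integrable lborel u"
  shows "(L1_shift u \<longlongrightarrow> 0) (at 0)"
  using assms
proof (induction rule: integrable_induct)
  case (base A c)
  have Am: "A \<in> sets borel" using base by simp
  let ?B = "\<lambda>n::nat. A \<inter> cball 0 (real n)"
  have "(L1_shift (indicator A) \<longlongrightarrow> 0) (at 0)"
  proof (rule L1_shift_limit)
    show "(L1_shift (indicator (?B n)) \<longlongrightarrow> 0) (at 0)" for n
      using Am by (intro L1_shift_indicator_bounded) auto
    show "integrable lborel (indicator (?B n) :: 'a \<Rightarrow> real)" for n
      using Am by (intro integrable_real_indicator emeasure_bounded_finite) auto
    show "integrable lborel (indicator A :: 'a \<Rightarrow> real)" using base by (intro integrable_real_indicator) auto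
    show "\<bar>indicator (?B n) x\<bar> \<le> 2 * \<bar>indicator A x :: real\<bar>" for n x by (auto simp: indicator_def)
    show "(\<lambda>n. indicator (?B n) x :: real) \<longlonglongrightarrow> indicator A x" for x
    proof (rule tendsto_eventually)
      obtain N :: nat where "norm x \<le> real N" using real_arch_simple by blast
      then show "eventually (\<lambda>n. indicator (?B n) x = (indicator A x :: real)) sequentially"
        unfolding eventually_sequentially by (intro exI[of _ N]) (auto simp: indicator_def)
    qed
  qed
  then have "((\<lambda>z. \<bar>c\<bar> * L1_shift (indicator A) z) \<longlongrightarrow> 0) (at 0)" by (rule tendsto_mult_right_zero)
  moreover have "\<bar>c\<bar> * L1_shift (indicator A) z = L1_shift (\<lambda>x. indicator A x *\<^sub>R c) z" for z
  proof -
    have "\<bar>indicator A (z + x) *\<^sub>R c - indicator A x *\<^sub>R c\<bar> = \<bar>c\<bar> * \<bar>indicator A (z + x) - indicator A x\<bar>" for x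
      by (simp add: abs_mult[symmetric] algebra_simps)
    then show ?thesis by (simp add: L1_shift_def)
  qed
  ultimately show ?case by simp
next
  case (add f g)
  show ?case
  proof (rule tendsto_sandwich[of "\<lambda>_. 0" _ _ "\<lambda>z. L1_shift f z + L1_shift g z"])
    show "((\<lambda>z. L1_shift f z + L1_shift g z) \<longlongrightarrow> 0) (at 0)" using tendsto_add[OF add(3,4)] by simp
  qed (use add in \<open>auto intro!: always_eventually L1_shift_nonneg L1_shift_add\<close>)
next
  case (lim f s)
  show ?case by (rule L1_shift_limit[of s]) (use lim in auto)
qed

lemma L1_shift_measurable:
  assumes "integrable lborel u"
  shows "L1_shift u \<in> borel_measurable borel"
proof -
  have [measurable]: "u \<in> borel_measurable borel" using assms by (rule lborel_integrable_borel)
  have "(\<lambda>z. \<integral>x. \<bar>u (z + x) - u x\<bar> \<partial>lborel) \<in> borel_measurable lborel"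
    by (intro lborel.borel_measurable_lebesgue_integral) measurable
  then show ?thesis by (simp add: L1_shift_def[abs_def])
qed

section \<open>Lebesgue points along a subsequence of radii\<close>

lemma integrable_indicator_ball: "integrable lborel (indicator (ball c r) :: 'a::euclidean_space \<Rightarrow> real)"
  by (intro integrable_real_indicator emeasure_bounded_finite) auto

text \<open>Substituting y = x + z and exchanging integrals turns the total local oscillation into
  an integral of the translation modulus over a small ball, where that modulus is small.\<close>

lemma local_oscillation_integral:
  fixes u :: "'a::euclidean_space \<Rightarrow> real"
  assumes u: "integrable lborel u"
  defines "osc \<equiv> \<lambda>r x. \<integral>y. \<bar>u y - u x\<bar> * indicator (ball x r) y \<partial>lborel"
  shows "integrable lborel (osc r)"
    and "(\<integral>x. osc r x \<partial>lborel) = (\<integral>z. indicator (ball 0 r) z * L1_shift u z \<partial>lborel)"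
proof -
  have [measurable]: "u \<in> borel_measurable borel" using u by (rule lborel_integrable_borel)
  let ?f = "\<lambda>z x. \<bar>u (z + x) - u x\<bar> * indicator (ball 0 r) z"
  have ix: "integrable lborel (\<lambda>x. \<bar>u (z + x) - u x\<bar>)" for z
    using u by (intro integrable_abs Bochner_Integration.integrable_diff integrable_translate)
  have int: "integrable (lborel \<Otimes>\<^sub>M lborel) (case_prod ?f)"
  proof (rule lborel_pair.Fubini_integrable)
    have 1: "(\<lambda>p. \<bar>u (fst p + snd p) - u (snd p)\<bar>) \<in> borel_measurable (lborel \<Otimes>\<^sub>M lborel)" by measurable
    have 2: "(\<lambda>p. indicator (ball 0 r) (fst p) :: real) \<in> borel_measurable ((lborel :: 'a measure) \<Otimes>\<^sub>M (lborel :: 'a measure))"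
      by (rule measurable_compose[OF measurable_fst]) (auto intro!: borel_measurable_indicator)
    show "case_prod ?f \<in> borel_measurable (lborel \<Otimes>\<^sub>M lborel)"
      using borel_measurable_times[OF 1 2] by (simp add: split_beta')
    have "(\<integral>x. norm (case (z, x) of (z, x) \<Rightarrow> ?f z x) \<partial>lborel) = indicator (ball 0 r) z * L1_shift u z" for z
      by (simp add: L1_shift_def abs_mult mult.commute)
    moreover have "integrable lborel (\<lambda>z. indicator (ball 0 r) z * L1_shift u z)"
    proof (rule integrable_mult_bounded[OF integrable_indicator_ball L1_shift_measurable[OF u]])
      show "\<bar>L1_shift u y\<bar> \<le> 2 * (\<integral>x. \<bar>u x\<bar> \<partial>lborel)" for y
        using L1_shift_le[OF u, of y] L1_shift_nonneg[of u y] by simp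
    qed
    ultimately show "integrable lborel (\<lambda>z. \<integral>x. norm (case (z, x) of (z, x) \<Rightarrow> ?f z x) \<partial>lborel)" by (simp only:)
    show "AE z in lborel. integrable lborel (\<lambda>x. case (z, x) of (z, x) \<Rightarrow> ?f z x)"
      using ix by (intro always_eventually allI) simp
  qed
  have osc: "osc r x = (\<integral>z. ?f z x \<partial>lborel)" for x
  proof -
    have "(\<integral>z. \<bar>u (x + z) - u x\<bar> * indicator (ball x r) (x + z) \<partial>lborel) = osc r x"
      unfolding osc_def by (rule integral_translate[of "\<lambda>y. \<bar>u y - u x\<bar> * indicator (ball x r) y"])
         (auto intro!: borel_measurable_times borel_measurable_indicator)
    then show ?thesis by (simp add: indicator_def dist_norm add.commute)
  qed
  show "integrable lborel (osc r)"
    unfolding osc[abs_def] by (rule lborel_pair.integrable_snd[OF int])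
  have "(\<integral>x. osc r x \<partial>lborel) = (\<integral>z. (\<integral>x. ?f z x \<partial>lborel) \<partial>lborel)"
    unfolding osc using lborel_pair.integral_snd[OF int] lborel_pair.integral_fst[OF int] by simp
  then show "(\<integral>x. osc r x \<partial>lborel) = (\<integral>z. indicator (ball 0 r) z * L1_shift u z \<partial>lborel)"
    by (simp add: L1_shift_def mult.commute)
qed

text \<open>The mean oscillations tend to 0 in L^1, so a subsequence tends to 0 almost everywhere.
  This replaces the full differentiation theorem and its covering argument: the limits taken later
  may run along a subsequence of radii. The dilation R makes room for averaging balls that are not
  centred at x.\<close>

lemma Lebesgue_points_subseq:
  fixes u :: "'a::euclidean_space \<Rightarrow> real" and a :: "nat \<Rightarrow> real"
  assumes u: "integrable lborel u" and a: "\<And>j. a j > 0" "a \<longlonglongrightarrow> 0" and R: "R > 0"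
  shows "\<exists>r::nat \<Rightarrow> nat. strict_mono r \<and> (AE x in lborel.
    (\<lambda>j. (\<integral>y. \<bar>u y - u x\<bar> * indicator (ball x (R * a (r j))) y \<partial>lborel) / a (r j) ^ DIM('a)) \<longlonglongrightarrow> 0)"
proof -
  let ?n = "DIM('a)" and ?v = "measure lborel (ball (0::'a) 1)"
  define osc where "osc r x = (\<integral>y. \<bar>u y - u x\<bar> * indicator (ball x r) y \<partial>lborel)" for r x
  have osc0: "osc r x \<ge> 0" for r x unfolding osc_def by (intro Bochner_Integration.integral_nonneg) auto
  have int: "integrable lborel (osc r)"
    and eq: "(\<integral>x. osc r x \<partial>lborel) = (\<integral>z. indicator (ball 0 r) z * L1_shift u z \<partial>lborel)" for r
    using local_oscillation_integral[OF u, of r] by (simp_all add: osc_def[abs_def])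
  have int_le: "integrable lborel (\<lambda>z. indicator (ball 0 r) z * L1_shift u z)" for r
    by (rule integrable_mult_bounded[OF integrable_indicator_ball L1_shift_measurable[OF u], where B = "2 * (\<integral>x. \<bar>u x\<bar> \<partial>lborel)"])
       (use L1_shift_le[OF u] L1_shift_nonneg[of u] in auto)
  have lim: "(\<lambda>j. \<integral>x. norm (osc (R * a j) x / a j ^ ?n) \<partial>lborel) \<longlonglongrightarrow> 0"
  proof (rule tendstoI)
    fix e :: real assume e: "e > 0"
    \<comment> \<open>The summand 1 makes c exceed the volume factor strictly, which gives the
      strict bound by e at the end.\<close>
    define c where "c = R ^ ?n * ?v + 1"
    have c: "c > 0" using R unfolding c_def by (intro add_nonneg_pos) auto
    have "eventually (\<lambda>z. dist (L1_shift u z) 0 < e / c) (at 0)"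
      using L1_shift_tendsto_0[OF u] e c by (intro tendstoD) auto
    then obtain d where d: "d > 0" "\<And>z. z \<noteq> 0 \<Longrightarrow> dist z 0 < d \<Longrightarrow> dist (L1_shift u z) 0 < e / c"
      unfolding eventually_at by auto
    have L0: "L1_shift u 0 = 0" by (simp add: L1_shift_def)
    have d': "L1_shift u z \<le> e / c" if "norm z < d" for z
      using d(2)[of z] that e c L0 by (cases "z = 0") auto
    have "eventually (\<lambda>j. dist (a j) 0 < d / R) sequentially"
      using a d R by (intro tendstoD) auto
    then show "eventually (\<lambda>j. dist (\<integral>x. norm (osc (R * a j) x / a j ^ ?n) \<partial>lborel) 0 < e) sequentially"
    proof eventually_elim
      case (elim j)
      have Ra: "R * a j < d" "0 < R * a j" using elim R a(1)[of j] by (auto simp: field_simps)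
      have "(\<integral>x. norm (osc (R * a j) x / a j ^ ?n) \<partial>lborel) = (\<integral>x. osc (R * a j) x \<partial>lborel) / a j ^ ?n"
        using osc0 a(1)[of j] by simp
      also have "\<dots> \<le> (\<integral>z. indicator (ball 0 (R * a j)) z * (e / c) \<partial>(lborel :: 'a measure)) / a j ^ ?n"
        unfolding eq
      proof (intro divide_right_mono integral_mono int_le)
        show "integrable lborel (\<lambda>z::'a. indicator (ball 0 (R * a j)) z * (e / c))"
          using integrable_indicator_ball by (rule integrable_mult_left)
        show "indicator (ball 0 (R * a j)) z * L1_shift u z \<le> indicator (ball 0 (R * a j)) z * (e / c)" for z
          using d'[of z] Ra by (auto simp: indicator_def)
      qed (use a(1)[of j] in auto)
      also have "(\<integral>z. indicator (ball 0 (R * a j)) z * (e / c) \<partial>(lborel :: 'a measure)) = (R * a j) ^ ?n * ?v * (e / c)"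
        using content_ball_conv_unit_ball[of "R * a j" "0::'a"] Ra by simp
      also have "\<dots> / a j ^ ?n = R ^ ?n * ?v * e / c" using a(1)[of j] by (simp add: power_mult_distrib)
      also have "\<dots> < e"
      proof -
        have "R ^ ?n * ?v < c" by (simp add: c_def)
        then have "R ^ ?n * ?v * e < c * e" using e by (rule mult_strict_right_mono)
        then show ?thesis using c by (simp add: field_simps)
      qed
      finally have "(\<integral>x. norm (osc (R * a j) x / a j ^ ?n) \<partial>lborel) < e" .
      moreover have "0 \<le> (\<integral>x. norm (osc (R * a j) x / a j ^ ?n) \<partial>lborel)" by (intro Bochner_Integration.integral_nonneg) auto
      ultimately show ?case by simp
    qed
  qed
  have "\<exists>r::nat \<Rightarrow> nat. strict_mono r \<and> (AE x in lborel. (\<lambda>j. osc (R * a (r j)) x / a (r j) ^ ?n) \<longlonglongrightarrow> 0)"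
    using tendsto_L1_AE_subseq[OF _ lim] int by simp
  then show ?thesis by (simp add: osc_def)
qed

text \<open>Only the space matters, hence the type argument; by \<open>integral_bump\<close> every
  scaled bump has this mass.\<close>

definition bump_mass :: "'a::euclidean_space itself \<Rightarrow> real" where
  "bump_mass _ = (\<integral>y. bump (0::'a) 1 y \<partial>lborel)"

lemma integrable_bump: "t > 0 \<Longrightarrow> integrable lborel (bump c t)"
proof -
  assume t: "t > 0"
  have "bump c t = (\<lambda>y. indicator (ball c t) y * bump c t y)"
    using bump_eq_0[OF t, of c] by (auto simp: indicator_def fun_eq_iff)
  moreover have "integrable lborel (\<lambda>y. indicator (ball c t) y * bump c t y)"
    by (rule integrable_mult_bounded[OF integrable_indicator_ball, of _ 1])
       (auto simp: bump_le_1 bump_nonneg)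
  ultimately show ?thesis by simp
qed

lemma bump_mass_pos: "bump_mass TYPE('a::euclidean_space) > 0"
proof -
  have "\<not> (AE y in lborel. bump (0::'a) 1 y = 0)"
  proof
    assume "AE y in lborel. bump (0::'a) 1 y = 0"
    then have "AE y in lborel. y \<notin> ball (0::'a) 1"
      by eventually_elim (use bump_pos[of 1 "0::'a"] in force)
    then have "emeasure lborel (ball (0::'a) 1) = 0"
      using AE_iff_null_sets[of "ball (0::'a) 1" lborel] by (simp add: null_sets_def)
    then show False using content_ball_pos[of 1 "0::'a"] by (simp add: measure_def)
  qed
  then have "(\<integral>y. bump (0::'a) 1 y \<partial>lborel) \<noteq> 0"
    using integral_nonneg_eq_0_iff_AE[of lborel "bump (0::'a) 1"] integrable_bump[of 1 "0::'a"]
    by (simp add: bump_nonneg)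
  moreover have "(\<integral>y. bump (0::'a) 1 y \<partial>lborel) \<ge> 0"
    by (intro Bochner_Integration.integral_nonneg bump_nonneg)
  ultimately show ?thesis by (simp add: bump_mass_def)
qed

lemma integral_bump:
  fixes c :: "'a::euclidean_space"
  assumes t: "t > 0"
  shows "(\<integral>y. bump c t y / t ^ DIM('a) \<partial>lborel) = bump_mass TYPE('a)"
proof -
  have "(\<integral>y. bump c t y / t ^ DIM('a) \<partial>lborel)
      = (\<integral>y. bump c t y / t ^ DIM('a) \<partial>(density (distr lborel borel (\<lambda>x. c + t *\<^sub>R x)) (\<lambda>_. \<bar>t\<bar> ^ DIM('a))))"
    using t by (subst lborel_affine[of t c]) auto
  also have "\<dots> = (\<integral>y. t ^ DIM('a) *\<^sub>R (bump c t y / t ^ DIM('a)) \<partial>(distr lborel borel (\<lambda>x. c + t *\<^sub>R x)))"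
    using t by (subst integral_density) auto
  also have "\<dots> = (\<integral>x. bump c t (c + t *\<^sub>R x) \<partial>lborel)"
    using t by (subst integral_distr) auto
  also have "\<dots> = (\<integral>x. bump (0::'a) 1 x \<partial>lborel)"
    using t by (intro Bochner_Integration.integral_cong) (auto simp: bump_def power2_eq_square)
  finally show ?thesis by (simp add: bump_mass_def)
qed

text \<open>The kernel is at most t^-n and has mass \<open>bump_mass\<close>, so the error is an
  integral of u y - u x. The ball need not be centred at x, as is required for balls on the axis of
  a cone with vertex x.\<close>

lemma ball_avg_close:
  fixes x :: "'a::euclidean_space"
  assumes u: "integrable lborel u" and t: "t > 0" and sub: "ball c t \<subseteq> ball x \<rho>"
  shows "\<bar>ball_avg c t u - bump_mass TYPE('a) * u x\<bar>
    \<le> (\<integral>y. \<bar>u y - u x\<bar> * indicator (ball x \<rho>) y \<partial>lborel) / t ^ DIM('a)"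
proof -
  let ?k = "\<lambda>y. bump c t y / t ^ DIM('a)"
  have tn: "0 < t ^ DIM('a)" using t by simp
  have k: "\<bar>?k y\<bar> \<le> 1 / t ^ DIM('a)" "0 \<le> ?k y" for y
    using tn bump_nonneg[of c t y] bump_le_1[of c t y] by (auto simp: divide_right_mono)
  have i1: "integrable lborel (\<lambda>y. u y * ?k y)"
    by (rule integrable_mult_bounded[OF u _ k(1)]) simp
  have i2: "integrable lborel (\<lambda>y. u x * ?k y)"
    using integrable_bump[OF t, of c] by auto
  have um: "u \<in> borel_measurable borel" using u by (rule lborel_integrable_borel)
  have i3: "integrable lborel (\<lambda>y. \<bar>u y - u x\<bar> * indicator (ball x \<rho>) y)"
  proof (rule Bochner_Integration.integrable_bound[where f = "\<lambda>y. \<bar>u y\<bar> + \<bar>u x\<bar> * indicator (ball x \<rho>) y"])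
    show "integrable lborel (\<lambda>y. \<bar>u y\<bar> + \<bar>u x\<bar> * indicator (ball x \<rho>) y)"
      by (intro Bochner_Integration.integrable_add integrable_abs u integrable_mult_right integrable_indicator_ball)
    show "AE y in lborel. norm (\<bar>u y - u x\<bar> * indicator (ball x \<rho>) y) \<le> norm (\<bar>u y\<bar> + \<bar>u x\<bar> * indicator (ball x \<rho>) y)"
      by (intro always_eventually allI) (auto simp: indicator_def)
  qed (use um in \<open>auto intro!: borel_measurable_times borel_measurable_indicator\<close>)
  have i4: "integrable lborel (\<lambda>y. (u y - u x) * ?k y)"
    using Bochner_Integration.integrable_diff[OF i1 i2] by (simp add: algebra_simps diff_divide_distrib)
  have "ball_avg c t u - bump_mass TYPE('a) * u x = (\<integral>y. u y * ?k y \<partial>lborel) - (\<integral>y. u x * ?k y \<partial>lborel)"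
    unfolding ball_avg_def integral_bump[OF t, of c, symmetric] by simp
  also have "\<dots> = (\<integral>y. u y * ?k y - u x * ?k y \<partial>lborel)"
    by (rule Bochner_Integration.integral_diff[OF i1 i2, symmetric])
  also have "\<dots> = (\<integral>y. (u y - u x) * ?k y \<partial>lborel)" by (simp add: algebra_simps diff_divide_distrib)
  finally have eq: "ball_avg c t u - bump_mass TYPE('a) * u x = (\<integral>y. (u y - u x) * ?k y \<partial>lborel)" .
  have "\<bar>\<integral>y. (u y - u x) * ?k y \<partial>lborel\<bar> \<le> (\<integral>y. \<bar>u y - u x\<bar> * indicator (ball x \<rho>) y / t ^ DIM('a) \<partial>lborel)"
  proof (rule integral_abs_bound_integral[OF i4])
    show "integrable lborel (\<lambda>y. \<bar>u y - u x\<bar> * indicator (ball x \<rho>) y / t ^ DIM('a))" using i3 by simp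
    fix y
    show "\<bar>(u y - u x) * ?k y\<bar> \<le> \<bar>u y - u x\<bar> * indicator (ball x \<rho>) y / t ^ DIM('a)"
    proof (cases "dist c y < t")
      case True
      then have "y \<in> ball x \<rho>" using sub by auto
      moreover have "\<bar>u y - u x\<bar> * \<bar>?k y\<bar> \<le> \<bar>u y - u x\<bar> * (1 / t ^ DIM('a))"
        by (intro mult_left_mono k) auto
      ultimately show ?thesis by (simp add: abs_mult)
    next
      case False
      then show ?thesis using bump_eq_0[OF t, of c y] tn by simp
    qed
  qed
  then show ?thesis unfolding eq by simp
qed

text \<open>Fundamental lemma of the calculus of variations: test with shrinking bumps at a Lebesgue
  point, where the vanishing averages converge to a positive multiple of u x.\<close>

lemma AE_eq_0_if_orthogonal_test_functions:
  fixes u :: "'a::euclidean_space \<Rightarrow> real"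
  assumes u: "integrable lborel u" and \<Omega>: "open \<Omega>"
    and ortho: "\<And>\<psi>. \<psi> \<in> test_functions \<Omega> \<Longrightarrow> (\<integral>y. u y * \<psi> y \<partial>lborel) = 0"
  shows "AE x in lborel. x \<in> \<Omega> \<longrightarrow> u x = 0"
proof -
  define a where "a j = 1 / real (Suc j)" for j
  have a: "a j > 0" "a \<longlonglongrightarrow> 0" for j
    unfolding a_def[abs_def] using LIMSEQ_inverse_real_of_nat by (auto simp: inverse_eq_divide)
  obtain r :: "nat \<Rightarrow> nat" where r: "strict_mono r" and AE: "AE x in lborel.
    (\<lambda>j. (\<integral>y. \<bar>u y - u x\<bar> * indicator (ball x (1 * a (r j))) y \<partial>lborel) / a (r j) ^ DIM('a)) \<longlonglongrightarrow> 0"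
    using Lebesgue_points_subseq[OF u a, of 1] by auto
  have ar: "(\<lambda>j. a (r j)) \<longlonglongrightarrow> 0" using LIMSEQ_subseq_LIMSEQ[OF a(2) r] by (simp add: comp_def)
  from AE show ?thesis
  proof eventually_elim
    case (elim x)
    show ?case
    proof
      assume "x \<in> \<Omega>"
      then obtain d where d: "d > 0" "cball x d \<subseteq> \<Omega>" using \<Omega> open_contains_cball by blast
      have "eventually (\<lambda>j. dist (a (r j)) 0 < d) sequentially" using ar d(1) by (rule tendstoD)
      then have "eventually (\<lambda>j. \<bar>bump_mass TYPE('a) * u x\<bar> \<le>
         (\<integral>y. \<bar>u y - u x\<bar> * indicator (ball x (1 * a (r j))) y \<partial>lborel) / a (r j) ^ DIM('a)) sequentially"
      proof eventually_elim
        case (elim j)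
        have "cball x (a (r j)) \<subseteq> \<Omega>" using d elim a(1)[of "r j"] by (auto simp: subset_iff)
        then have "(\<integral>y. u y * bump x (a (r j)) y \<partial>lborel) = 0"
          using a(1) by (intro ortho bump_test_function)
        then have "ball_avg x (a (r j)) u = 0" by (simp add: ball_avg_def)
        then show ?case using ball_avg_close[OF u a(1)[of "r j"], of x x "1 * a (r j)"] by simp
      qed
      from tendsto_lowerbound[OF elim this] have "\<bar>bump_mass TYPE('a) * u x\<bar> \<le> 0" by simp
      then show "u x = 0" using bump_mass_pos[where 'a = 'a] by simp
    qed
  qed
qed

section \<open>The pointwise Poincare inequality under the cone condition\<close>

text \<open>Only balls around axis points are used of the cone. The averages below live on radius a
  * \<sigma>; the factor 3 is the spare room on which \<open>ball_avg_compare_uniform\<close>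
  relies.\<close>

lemma cone_condition_balls:
  fixes \<Omega> :: "'a::euclidean_space set"
  assumes "cone_condition \<Omega>"
  obtains \<rho> \<sigma> where "\<rho> > 0" "\<sigma> > 0" "\<sigma> \<le> 1/6"
    "\<And>x. x \<in> \<Omega> \<Longrightarrow> \<exists>e. norm e = 1 \<and> (\<forall>a. 0 < a \<and> a \<le> \<rho> \<longrightarrow> cball (x + a *\<^sub>R e) (3 * a * \<sigma>) \<subseteq> \<Omega>)"
proof -
  obtain v :: 'a and \<rho> \<kappa> where v: "norm v = 1" and \<rho>: "0 < \<rho>" and \<kappa>: "0 < \<kappa>" "\<kappa> \<le> pi"
    and cone: "\<And>x. x \<in> \<Omega> \<Longrightarrow> \<exists>f. orthogonal_transformation f \<and> (\<lambda>y. x + f y) ` finite_cone v \<rho> \<kappa> \<subseteq> \<Omega>"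
    using assms by (auto simp: cone_condition_def)
  have "cos (\<kappa> / 2) < cos 0" using \<kappa> by (intro cos_monotone_0_pi) auto
  then have cos1: "cos (\<kappa> / 2) < 1" by simp
  have cos0: "0 \<le> cos (\<kappa> / 2)" using \<kappa> by (intro cos_ge_zero) auto
  \<comment> \<open>Chosen so that cos (\<kappa> / 2) = 1 - 6 * \<sigma>. Then (1 + 3 * \<sigma>) *
    (1 - 6 * \<sigma>) \<le> 1 - 3 * \<sigma> puts the ball inside the opening angle, and 3 *
    \<sigma> \<le> 1 keeps it within height 2 * a \<le> \<rho>.\<close>
  define \<sigma> where "\<sigma> = (1 - cos (\<kappa> / 2)) / 6"
  have \<sigma>: "0 < \<sigma>" "\<sigma> \<le> 1/6" "6 * \<sigma> = 1 - cos (\<kappa> / 2)" using cos0 cos1 by (auto simp: \<sigma>_def)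
  have ball: "z \<in> finite_cone v \<rho> \<kappa>" if a: "0 < a" "a \<le> \<rho> / 2" and z: "dist (a *\<^sub>R v) z \<le> 3 * a * \<sigma>" for a z
  proof -
    have n: "norm (z - a *\<^sub>R v) \<le> 3 * a * \<sigma>" using z by (simp add: dist_norm norm_minus_commute)
    have "norm z \<le> norm (a *\<^sub>R v) + norm (z - a *\<^sub>R v)"
      using norm_triangle_ineq[of "a *\<^sub>R v" "z - a *\<^sub>R v"] by simp
    then have nz: "norm z \<le> a + 3 * a * \<sigma>" using n v a by simp
    have "a * (3 * \<sigma>) \<le> a * 1" using a \<sigma> by (intro mult_left_mono) auto
    then have "3 * a * \<sigma> \<le> a" by (simp only: mult_ac mult_1)
    then have 1: "norm z \<le> \<rho>" using nz a by linarith
    have "z \<bullet> v = a + (z - a *\<^sub>R v) \<bullet> v" using v by (simp add: inner_diff_left norm_eq_1)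
    moreover have "\<bar>(z - a *\<^sub>R v) \<bullet> v\<bar> \<le> 3 * a * \<sigma>"
      using Cauchy_Schwarz_ineq2[of "z - a *\<^sub>R v" v] n v by simp
    ultimately have zv: "a - 3 * a * \<sigma> \<le> z \<bullet> v" by linarith
    have "norm z * cos (\<kappa> / 2) \<le> (a + 3 * a * \<sigma>) * (1 - 6 * \<sigma>)"
      using nz cos0 \<sigma> by (intro mult_mono) (use a in auto)
    also have "\<dots> = a - 3 * a * \<sigma> - 18 * a * \<sigma>\<^sup>2" by (simp add: algebra_simps power2_eq_square)
    also have "\<dots> \<le> a - 3 * a * \<sigma>" using a by simp
    finally show ?thesis using 1 zv by (simp add: finite_cone_def)
  qed
  show ?thesis
  proof
    show "0 < \<rho> / 2" "0 < \<sigma>" "\<sigma> \<le> 1/6" using \<rho> \<sigma> by auto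
    fix x assume "x \<in> \<Omega>"
    then obtain f where f: "orthogonal_transformation f" and sub: "(\<lambda>y. x + f y) ` finite_cone v \<rho> \<kappa> \<subseteq> \<Omega>"
      using cone by blast
    have lin: "linear f" and nf: "norm (f y) = norm y" for y
      using f by (auto simp: orthogonal_transformation_linear orthogonal_transformation_norm)
    have surj: "surj f" using f by (rule orthogonal_transformation_surj)
    show "\<exists>e. norm e = 1 \<and> (\<forall>a. 0 < a \<and> a \<le> \<rho> / 2 \<longrightarrow> cball (x + a *\<^sub>R e) (3 * a * \<sigma>) \<subseteq> \<Omega>)"
    proof (intro exI conjI allI impI subsetI)
      show "norm (f v) = 1" using nf v by simp
      fix a y assume a: "0 < a \<and> a \<le> \<rho> / 2" and y: "y \<in> cball (x + a *\<^sub>R f v) (3 * a * \<sigma>)"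
      obtain z where z: "y - x = f z" using surj by (metis surjD)
      have "dist (a *\<^sub>R v) z = norm (f (a *\<^sub>R v - z))" by (simp add: nf dist_norm)
      also have "f (a *\<^sub>R v - z) = (x + a *\<^sub>R f v) - y"
        using z lin by (simp add: linear_diff linear_scale algebra_simps)
      finally have "z \<in> finite_cone v \<rho> \<kappa>" using a y by (intro ball[of a]) (auto simp: dist_norm)
      moreover have "y = x + f z" using z by (simp add: algebra_simps)
      ultimately show "y \<in> \<Omega>" using sub by blast
    qed
  qed
qed

lemma pred_cball [measurable]: "Measurable.pred borel (\<lambda>y. y \<in> cball (x::'a::euclidean_space) r)"
proof -
  have "{y \<in> space borel. y \<in> cball x r} = cball x r" by auto
  then show ?thesis unfolding pred_def by (metis borel_closed closed_cball)
qed

text \<open>A dyadic version of the Riesz kernel \<open>dist x y powr (1 - n)\<close>, truncated at distance \<open>R\<close>: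
  one term per step of the telescoping sum over halved radii.\<close>

definition dyadic_kernel :: "real \<Rightarrow> 'a::euclidean_space \<Rightarrow> 'a \<Rightarrow> ennreal" where
  "dyadic_kernel R x y = (\<Sum>j. ennreal ((2 ^ j) ^ (DIM('a) - 1)) * indicator (cball x (R / 2 ^ j)) y)"

text \<open>The term j = 0 is already 1 there. Once R is at least the diameter of \<Omega>, plain
  L^1 norms of functions vanishing off \<Omega> can be absorbed into potentials.\<close>

lemma dyadic_kernel_ge_1: "dist x y \<le> R \<Longrightarrow> 1 \<le> dyadic_kernel R x y"
proof -
  assume d: "dist x y \<le> R"
  have "1 = (\<Sum>j<Suc 0. ennreal ((2 ^ j) ^ (DIM('a) - 1)) * indicator (cball x (R / 2 ^ j)) y)"
    using d by simp
  also have "\<dots> \<le> dyadic_kernel R x y"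
    unfolding dyadic_kernel_def by (rule sum_le_suminf) auto
  finally show ?thesis .
qed

lemma dyadic_kernel_measurable [measurable]: "dyadic_kernel R x \<in> borel_measurable borel"
  unfolding dyadic_kernel_def[abs_def] by measurable

text \<open>Valued in \<open>ennreal\<close>, so finiteness is no issue until real integrals are
  recovered in \<open>integral_le_Schur\<close>.\<close>

definition dyadic_potential :: "real \<Rightarrow> ('a::euclidean_space \<Rightarrow> real) \<Rightarrow> 'a \<Rightarrow> ennreal" where
  "dyadic_potential R h x = (\<integral>\<^sup>+y. dyadic_kernel R x y * ennreal (h y) \<partial>lborel)"

lemma dyadic_potential_eq_suminf:
  fixes x :: "'a::euclidean_space"
  assumes "h \<in> borel_measurable borel"
  shows "dyadic_potential R h x =
    (\<Sum>j. ennreal ((2 ^ j) ^ (DIM('a) - 1)) * (\<integral>\<^sup>+y. indicator (cball x (R / 2 ^ j)) y * ennreal (h y) \<partial>lborel))"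
proof -
  note assms [measurable]
  have "dyadic_potential R h x = (\<integral>\<^sup>+y. (\<Sum>j. ennreal ((2 ^ j) ^ (DIM('a) - 1)) * (indicator (cball x (R / 2 ^ j)) y * ennreal (h y))) \<partial>lborel)"
    unfolding dyadic_potential_def dyadic_kernel_def by (simp add: ennreal_suminf_multc[symmetric] mult.assoc)
  also have "\<dots> = (\<Sum>j. \<integral>\<^sup>+y. ennreal ((2 ^ j) ^ (DIM('a) - 1)) * (indicator (cball x (R / 2 ^ j)) y * ennreal (h y)) \<partial>lborel)"
    by (intro nn_integral_suminf) measurable
  also have "\<dots> = (\<Sum>j. ennreal ((2 ^ j) ^ (DIM('a) - 1)) * (\<integral>\<^sup>+y. indicator (cball x (R / 2 ^ j)) y * ennreal (h y) \<partial>lborel))"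
    by (simp add: nn_integral_cmult)
  finally show ?thesis .
qed

text \<open>Halve the distance a to x repeatedly along the axis. A step moves centre and radius by
  at most a in total inside the ball of radius 2 * a about x, and costs (2 / \<sigma>)^n * a^(1 - n)
  times the gradient integral over that ball. For a = \<rho> / 2^j this is a constant times the j-th
  term of the potential.\<close>

lemma cone_telescope:
  fixes x e :: "'a::euclidean_space"
  assumes ug: "weak_grad_pair \<Omega> u g" and \<rho>: "\<rho> > 0" and \<sigma>: "0 < \<sigma>" "\<sigma> \<le> 1" and R: "2 * \<rho> \<le> R"
    and e: "norm e = 1" and sub: "\<And>a. 0 < a \<Longrightarrow> a \<le> \<rho> \<Longrightarrow> cball (x + a *\<^sub>R e) (a * \<sigma>) \<subseteq> \<Omega>"
  shows "ennreal \<bar>ball_avg (x + (\<rho> / 2 ^ N) *\<^sub>R e) (\<rho> / 2 ^ N * \<sigma>) u - ball_avg (x + \<rho> *\<^sub>R e) (\<rho> * \<sigma>) u\<bar>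
    \<le> ennreal ((2 / \<sigma>) ^ DIM('a) / \<rho> ^ (DIM('a) - 1)) * dyadic_potential R (\<lambda>y. norm (g y)) x"
proof -
  let ?n = "DIM('a)" and ?C = "(2 / \<sigma>) ^ DIM('a) / \<rho> ^ (DIM('a) - 1)"
  define a where "a j = \<rho> / 2 ^ j" for j :: nat
  have a: "0 < a j" "a j \<le> \<rho>" "a (Suc j) = a j / 2" for j
    using \<rho> by (auto simp: a_def field_simps)
  define F where "F j = ball_avg (x + a j *\<^sub>R e) (a j * \<sigma>) u" for j
  define J where "J j = (\<integral>y. indicator (cball x (R / 2 ^ j)) y * norm (g y) \<partial>lborel)" for j
  have g: "integrable lborel g" using ug by (simp add: weak_grad_pair_def)
  then have gm: "g \<in> borel_measurable borel" using borel_measurable_integrable[OF g] by simp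
  have step: "\<bar>F (Suc j) - F j\<bar> \<le> ?C * ((2 ^ j) ^ (?n - 1) * J j)" for j
  proof -
    have "\<bar>ball_avg ((x + a j *\<^sub>R e) + (- a j / 2) *\<^sub>R e) (a j * \<sigma> + (- a j / 2 * \<sigma>)) u - ball_avg (x + a j *\<^sub>R e) (a j * \<sigma>) u\<bar>
      \<le> (norm ((- a j / 2) *\<^sub>R e) + \<bar>- a j / 2 * \<sigma>\<bar>) / (a j / 2 * \<sigma>) ^ ?n * J j"
      unfolding J_def
    proof (rule ball_avg_diff_le[OF ug])
      show "0 < a j / 2 * \<sigma>" "a j / 2 * \<sigma> \<le> a j * \<sigma>" "a j / 2 * \<sigma> \<le> a j * \<sigma> + - a j / 2 * \<sigma>"
        using a[of j] \<sigma> by auto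
      show "cball x (R / 2 ^ j) \<in> sets borel" by simp
      fix s :: real assume s: "0 \<le> s" "s \<le> 1"
      \<comment> \<open>At time s the moving ball has centre x + b e and radius b * \<sigma>: it is
        again one of the balls of the cone, hence inside \<Omega>.\<close>
      define b where "b = a j - s * (a j / 2)"
      have "s * (a j / 2) \<le> 1 * (a j / 2)" "0 \<le> s * (a j / 2)" using s a[of j] by (auto intro: mult_right_mono)
      then have b: "0 < b" "b \<le> a j" using a(1)[of j] by (auto simp: b_def)
      have eq: "x + a j *\<^sub>R e + s *\<^sub>R (- a j / 2) *\<^sub>R e = x + b *\<^sub>R e" "a j * \<sigma> + s * (- a j / 2 * \<sigma>) = b * \<sigma>"
        by (simp_all add: b_def algebra_simps)
      have "cball (x + b *\<^sub>R e) (b * \<sigma>) \<subseteq> \<Omega>" using b a(2)[of j] by (intro sub) auto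
      moreover have "cball (x + b *\<^sub>R e) (b * \<sigma>) \<subseteq> cball x (R / 2 ^ j)"
      proof
        fix y assume "y \<in> cball (x + b *\<^sub>R e) (b * \<sigma>)"
        then have "dist (x + b *\<^sub>R e) y \<le> b * \<sigma>" by simp
        moreover have "b * \<sigma> \<le> b * 1" using b \<sigma> by (intro mult_left_mono) auto
        moreover have "dist x (x + b *\<^sub>R e) = b" using b e by (simp add: dist_norm)
        moreover have "dist x y \<le> dist x (x + b *\<^sub>R e) + dist (x + b *\<^sub>R e) y" by (rule dist_triangle)
        ultimately have "dist x y \<le> 2 * a j" using b by linarith
        also have "\<dots> = 2 * \<rho> / 2 ^ j" by (simp add: a_def)
        also have "\<dots> \<le> R / 2 ^ j" using R by (intro divide_right_mono) auto
        finally show "y \<in> cball x (R / 2 ^ j)" by simp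
      qed
      ultimately show "cball (x + a j *\<^sub>R e + s *\<^sub>R (- a j / 2) *\<^sub>R e) (a j * \<sigma> + s * (- a j / 2 * \<sigma>)) \<subseteq> \<Omega> \<inter> cball x (R / 2 ^ j)"
        unfolding eq by blast
    qed
    moreover have "(x + a j *\<^sub>R e) + (- a j / 2) *\<^sub>R e = x + a (Suc j) *\<^sub>R e"
      unfolding a(3) add.assoc scaleR_add_left[symmetric] by simp
    moreover have "a j * \<sigma> + (- a j / 2 * \<sigma>) = a (Suc j) * \<sigma>" by (simp add: a(3) field_simps)
    ultimately have 1: "\<bar>F (Suc j) - F j\<bar> \<le> (norm ((- a j / 2) *\<^sub>R e) + \<bar>- a j / 2 * \<sigma>\<bar>) / (a j / 2 * \<sigma>) ^ ?n * J j"
      unfolding F_def by metis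
    have J0: "J j \<ge> 0" unfolding J_def by (intro Bochner_Integration.integral_nonneg) auto
    have "a j * \<sigma> \<le> a j * 1" using a(1)[of j] \<sigma> by (intro mult_left_mono) auto
    moreover have "norm ((- a j / 2) *\<^sub>R e) + \<bar>- a j / 2 * \<sigma>\<bar> = a j / 2 + a j * \<sigma> / 2"
      using e a(1)[of j] \<sigma> by (simp add: abs_mult)
    ultimately have "norm ((- a j / 2) *\<^sub>R e) + \<bar>- a j / 2 * \<sigma>\<bar> \<le> a j" by linarith
    then have "(norm ((- a j / 2) *\<^sub>R e) + \<bar>- a j / 2 * \<sigma>\<bar>) / (a j / 2 * \<sigma>) ^ ?n \<le> a j / (a j / 2 * \<sigma>) ^ ?n"
      using a(1)[of j] \<sigma> by (intro divide_right_mono) auto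
    also have "\<dots> = ?C * (2 ^ j) ^ (?n - 1)"
    proof -
      obtain m where m: "?n = Suc m" using DIM_positive[where 'a = 'a] gr0_conv_Suc by blast
      have "a j / (a j / 2 * \<sigma>) ^ Suc m = (2 / \<sigma>) ^ Suc m / a j ^ m"
        using a(1)[of j] \<sigma> by (simp add: power_mult_distrib power_divide field_simps)
      also have "1 / a j ^ m = (2 ^ j) ^ m / \<rho> ^ m" by (simp add: a_def power_divide)
      then have "(2 / \<sigma>) ^ Suc m / a j ^ m = (2 / \<sigma>) ^ Suc m / \<rho> ^ m * (2 ^ j) ^ m" by (metis divide_inverse mult.assoc mult.commute mult_1)
      finally show ?thesis unfolding m by simp
    qed
    finally have "(norm ((- a j / 2) *\<^sub>R e) + \<bar>- a j / 2 * \<sigma>\<bar>) / (a j / 2 * \<sigma>) ^ ?n * J j \<le> ?C * (2 ^ j) ^ (?n - 1) * J j"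
      using J0 by (rule mult_right_mono)
    with 1 show ?thesis by (simp add: mult.assoc)
  qed
  have JJ: "ennreal (J j) = (\<integral>\<^sup>+y. indicator (cball x (R / 2 ^ j)) y * ennreal (norm (g y)) \<partial>lborel)" for j
  proof -
    have "integrable lborel (\<lambda>y. indicator (cball x (R / 2 ^ j)) y * norm (g y))"
      using integrable_mult_indicator[of "cball x (R / 2 ^ j)" lborel "\<lambda>y. norm (g y)"] g by simp
    then have "ennreal (J j) = (\<integral>\<^sup>+y. ennreal (indicator (cball x (R / 2 ^ j)) y * norm (g y)) \<partial>lborel)"
      unfolding J_def by (intro nn_integral_eq_integral[symmetric]) auto
    then show ?thesis by (simp add: ennreal_mult' ennreal_indicator)
  qed
  have Cnn: "0 \<le> ?C" using \<rho> \<sigma> by simp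
  have pn: "0 \<le> ((2::real) ^ j) ^ (?n - 1)" for j :: nat by simp
  have "F N - F 0 = (\<Sum>j<N. F (Suc j) - F j)" by (rule sum_lessThan_telescope[symmetric])
  then have "\<bar>F N - F 0\<bar> \<le> (\<Sum>j<N. \<bar>F (Suc j) - F j\<bar>)" by (simp add: sum_abs)
  also have "\<dots> \<le> (\<Sum>j<N. ?C * ((2 ^ j) ^ (?n - 1) * J j))" by (intro sum_mono step)
  finally have "ennreal \<bar>F N - F 0\<bar> \<le> ennreal (\<Sum>j<N. ?C * ((2 ^ j) ^ (?n - 1) * J j))" by (rule ennreal_leI)
  also have "\<dots> = (\<Sum>j<N. ennreal (?C * ((2 ^ j) ^ (?n - 1) * J j)))"
    using \<rho> \<sigma> by (intro sum_ennreal[symmetric] mult_nonneg_nonneg)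
      (auto simp: J_def intro!: Bochner_Integration.integral_nonneg)
  also have "\<dots> = ennreal ?C * (\<Sum>j<N. ennreal ((2 ^ j) ^ (?n - 1)) * ennreal (J j))"
    unfolding sum_distrib_left by (intro sum.cong refl) (simp only: ennreal_mult'[OF Cnn] ennreal_mult'[OF pn])
  also have "\<dots> \<le> ennreal ?C * (\<Sum>j. ennreal ((2 ^ j) ^ (?n - 1)) * ennreal (J j))"
    by (intro mult_left_mono sum_le_suminf) auto
  also have "(\<Sum>j. ennreal ((2 ^ j) ^ (?n - 1)) * ennreal (J j)) = dyadic_potential R (\<lambda>y. norm (g y)) x"
    using dyadic_potential_eq_suminf[of "\<lambda>y. norm (g y)" R x] gm by (simp add: JJ)
  finally show ?thesis by (simp add: F_def a_def)
qed

text \<open>Let N tend to infinity in the telescoping estimate at a Lebesgue point of u. The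
  direction e is quantified inside the almost-everywhere statement: the exceptional set depends on u
  only, so each x may use the axis of its own cone without a measurable selection.\<close>

lemma cone_potential_bound:
  fixes \<Omega> :: "'a::euclidean_space set"
  assumes ug: "weak_grad_pair \<Omega> u g" and \<rho>: "\<rho> > 0" and \<sigma>: "0 < \<sigma>" "\<sigma> \<le> 1/2" and R: "2 * \<rho> \<le> R"
  shows "AE x in lborel. \<forall>e. norm e = 1 \<and> (\<forall>a. 0 < a \<and> a \<le> \<rho> \<longrightarrow> cball (x + a *\<^sub>R e) (a * \<sigma>) \<subseteq> \<Omega>) \<longrightarrow>
    ennreal \<bar>bump_mass TYPE('a) * u x - ball_avg (x + \<rho> *\<^sub>R e) (\<rho> * \<sigma>) u\<bar>
    \<le> ennreal ((2 / \<sigma>) ^ DIM('a) / \<rho> ^ (DIM('a) - 1)) * dyadic_potential R (\<lambda>y. norm (g y)) x"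
proof -
  define a where "a j = \<rho> / 2 ^ j" for j :: nat
  have u: "integrable lborel u" using ug by (simp add: weak_grad_pair_def)
  have a: "0 < a j" "a j \<le> \<rho>" for j using \<rho> by (auto simp: a_def field_simps)
  have alim: "a \<longlonglongrightarrow> 0"
    unfolding a_def[abs_def] by (intro tendsto_divide_0[OF tendsto_const]) (auto intro!: filterlim_realpow_sequentially_gt1)
  obtain r :: "nat \<Rightarrow> nat" where r: "strict_mono r" and AE: "AE x in lborel.
    (\<lambda>j. (\<integral>y. \<bar>u y - u x\<bar> * indicator (ball x (2 * a (r j))) y \<partial>lborel) / a (r j) ^ DIM('a)) \<longlonglongrightarrow> 0"
    using Lebesgue_points_subseq[OF u a(1) alim, of 2] by auto
  from AE show ?thesis
  proof eventually_elim
    case (elim x)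
    show ?case
    proof (intro allI impI)
      fix e :: 'a
      assume e: "norm e = 1 \<and> (\<forall>a. 0 < a \<and> a \<le> \<rho> \<longrightarrow> cball (x + a *\<^sub>R e) (a * \<sigma>) \<subseteq> \<Omega>)"
      define F where "F j = ball_avg (x + a j *\<^sub>R e) (a j * \<sigma>) u" for j
      have bd: "\<bar>F (r j) - bump_mass TYPE('a) * u x\<bar>
          \<le> (\<integral>y. \<bar>u y - u x\<bar> * indicator (ball x (2 * a (r j))) y \<partial>lborel) / a (r j) ^ DIM('a) / \<sigma> ^ DIM('a)" for j
      proof -
        have "ball (x + a (r j) *\<^sub>R e) (a (r j) * \<sigma>) \<subseteq> ball x (2 * a (r j))"
        proof
          fix y assume "y \<in> ball (x + a (r j) *\<^sub>R e) (a (r j) * \<sigma>)"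
          then have "dist (x + a (r j) *\<^sub>R e) y < a (r j) * \<sigma>" by simp
          moreover have "a (r j) * \<sigma> \<le> a (r j) * 1" using a(1)[of "r j"] \<sigma> by (intro mult_left_mono) auto
          moreover have "dist x (x + a (r j) *\<^sub>R e) = a (r j)" using a(1)[of "r j"] e by (simp add: dist_norm)
          moreover have "dist x y \<le> dist x (x + a (r j) *\<^sub>R e) + dist (x + a (r j) *\<^sub>R e) y" by (rule dist_triangle)
          ultimately show "y \<in> ball x (2 * a (r j))" by simp
        qed
        then show ?thesis
          using ball_avg_close[OF u, of "a (r j) * \<sigma>" "x + a (r j) *\<^sub>R e" x "2 * a (r j)"] a(1)[of "r j"] \<sigma>
          by (simp add: F_def power_mult_distrib)
      qed
      have "(\<lambda>j. F (r j) - bump_mass TYPE('a) * u x) \<longlonglongrightarrow> 0"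
      proof (rule Lim_null_comparison)
        show "eventually (\<lambda>j. norm (F (r j) - bump_mass TYPE('a) * u x) \<le>
          (\<integral>y. \<bar>u y - u x\<bar> * indicator (ball x (2 * a (r j))) y \<partial>lborel) / a (r j) ^ DIM('a) / \<sigma> ^ DIM('a)) sequentially"
          using bd by simp
        show "(\<lambda>j. (\<integral>y. \<bar>u y - u x\<bar> * indicator (ball x (2 * a (r j))) y \<partial>lborel) / a (r j) ^ DIM('a) / \<sigma> ^ DIM('a)) \<longlonglongrightarrow> 0"
          using tendsto_divide[OF elim tendsto_const[of "\<sigma> ^ DIM('a)"]] \<sigma> by simp
      qed
      then have "(\<lambda>j. F (r j)) \<longlonglongrightarrow> bump_mass TYPE('a) * u x" by (simp add: LIM_zero_iff)
      then have lim: "(\<lambda>j. ennreal \<bar>F (r j) - F 0\<bar>) \<longlonglongrightarrow> ennreal \<bar>bump_mass TYPE('a) * u x - F 0\<bar>"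
        by (intro tendsto_intros)
      have "ennreal \<bar>F (r j) - F 0\<bar> \<le> ennreal ((2 / \<sigma>) ^ DIM('a) / \<rho> ^ (DIM('a) - 1)) * dyadic_potential R (\<lambda>y. norm (g y)) x" for j
        using cone_telescope[OF ug \<rho> \<sigma>(1) _ R, of e x "r j"] \<sigma> e by (simp add: F_def a_def)
      then have "ennreal \<bar>bump_mass TYPE('a) * u x - F 0\<bar> \<le> ennreal ((2 / \<sigma>) ^ DIM('a) / \<rho> ^ (DIM('a) - 1)) * dyadic_potential R (\<lambda>y. norm (g y)) x"
        by (intro LIMSEQ_le_const2[OF lim]) auto
      then show "ennreal \<bar>bump_mass TYPE('a) * u x - ball_avg (x + \<rho> *\<^sub>R e) (\<rho> * \<sigma>) u\<bar>
        \<le> ennreal ((2 / \<sigma>) ^ DIM('a) / \<rho> ^ (DIM('a) - 1)) * dyadic_potential R (\<lambda>y. norm (g y)) x"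
        by (simp add: F_def a_def)
    qed
  qed
qed

section \<open>Comparison of averages over distant balls\<close>

lemma ball_avg_near:
  fixes c c' :: "'a::euclidean_space"
  assumes ug: "weak_grad_pair \<Omega> u g" and r: "0 < r" "r \<le> t'" "t' \<le> t" "r \<le> t''" "t'' \<le> t"
    and c: "dist c c' \<le> t" and sub: "cball c (2 * t) \<subseteq> \<Omega>"
  shows "\<bar>ball_avg c' t' u - ball_avg c t'' u\<bar> \<le> 2 * t / r ^ DIM('a) * (\<integral>y. norm (g y) \<partial>lborel)"
proof -
  have "\<bar>ball_avg (c + (c' - c)) (t'' + (t' - t'')) u - ball_avg c t'' u\<bar>
      \<le> (norm (c' - c) + \<bar>t' - t''\<bar>) / r ^ DIM('a) * (\<integral>y. indicator UNIV y * norm (g y) \<partial>lborel)"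
  proof (rule ball_avg_diff_le[OF ug])
    fix s :: real assume s: "0 \<le> s" "s \<le> 1"
    have rad: "t'' + s * (t' - t'') \<le> t"
    proof -
      have "(1 - s) * t'' + s * t' \<le> (1 - s) * t + s * t" using s r by (intro add_mono mult_left_mono) auto
      then show ?thesis by (simp add: algebra_simps)
    qed
    have "norm (s *\<^sub>R (c' - c)) \<le> 1 * norm (c' - c)" using s by (simp add: mult_left_le_one_le)
    then have "dist c (c + s *\<^sub>R (c' - c)) \<le> t" using c by (simp add: dist_norm norm_minus_commute)
    then have "cball (c + s *\<^sub>R (c' - c)) (t'' + s * (t' - t'')) \<subseteq> cball c (2 * t)"
      using rad by (intro cball_subset_cball_iff[THEN iffD2]) (auto simp: dist_commute)
    then show "cball (c + s *\<^sub>R (c' - c)) (t'' + s * (t' - t'')) \<subseteq> \<Omega> \<inter> UNIV" using sub by auto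
  qed (use r in auto)
  also have "\<dots> \<le> 2 * t / r ^ DIM('a) * (\<integral>y. norm (g y) \<partial>lborel)"
    using c r by (intro mult_mono divide_right_mono) (auto simp: dist_norm norm_minus_commute)
  finally show ?thesis by simp
qed

text \<open>Nearby averages are comparable, so this property spreads along connected sets.\<close>

definition grad_L1_connected :: "'a::euclidean_space set \<Rightarrow> 'a \<Rightarrow> real \<Rightarrow> 'a \<Rightarrow> real \<Rightarrow> bool" where
  "grad_L1_connected \<Omega> z0 t0 c t \<longleftrightarrow> (\<exists>C\<ge>0. \<forall>u g. weak_grad_pair \<Omega> u g \<longrightarrow>
     \<bar>ball_avg c t u - ball_avg z0 t0 u\<bar> \<le> C * (\<integral>y. norm (g y) \<partial>lborel))"

text \<open>The straight motion can be run in either direction, so room around one of the two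
  centres is enough.\<close>

lemma grad_L1_connected_near:
  fixes c c' :: "'a::euclidean_space"
  assumes "grad_L1_connected \<Omega> z0 t0 c t''" and "0 < t'" "t' \<le> t" "0 < t''" "t'' \<le> t"
    and "dist c c' \<le> t" "cball c (2 * t) \<subseteq> \<Omega> \<or> cball c' (2 * t) \<subseteq> \<Omega>"
  shows "grad_L1_connected \<Omega> z0 t0 c' t'"
proof -
  obtain C where C: "C \<ge> 0" "\<And>u g. weak_grad_pair \<Omega> u g \<Longrightarrow>
     \<bar>ball_avg c t'' u - ball_avg z0 t0 u\<bar> \<le> C * (\<integral>y. norm (g y) \<partial>lborel)"
    using assms(1) by (auto simp: grad_L1_connected_def)
  define r where "r = min t' t''"
  have r: "0 < r" "r \<le> t'" "r \<le> t''" using assms by (auto simp: r_def)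
  show ?thesis
    unfolding grad_L1_connected_def
  proof (intro exI[of _ "2 * t / r ^ DIM('a) + C"] conjI allI impI)
    show "0 \<le> 2 * t / r ^ DIM('a) + C" using C r assms by (intro add_nonneg_nonneg divide_nonneg_nonneg) auto
    fix u g assume ug: "weak_grad_pair \<Omega> u g"
    have "\<bar>ball_avg c' t' u - ball_avg c t'' u\<bar> \<le> 2 * t / r ^ DIM('a) * (\<integral>y. norm (g y) \<partial>lborel)"
      using assms(7)
    proof
      assume "cball c (2 * t) \<subseteq> \<Omega>"
      then show ?thesis using r assms by (intro ball_avg_near[OF ug]) auto
    next
      assume "cball c' (2 * t) \<subseteq> \<Omega>"
      then have "\<bar>ball_avg c t'' u - ball_avg c' t' u\<bar> \<le> 2 * t / r ^ DIM('a) * (\<integral>y. norm (g y) \<partial>lborel)"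
        using r assms by (intro ball_avg_near[OF ug]) (auto simp: dist_commute)
      then show ?thesis by linarith
    qed
    with C(2)[OF ug] show "\<bar>ball_avg c' t' u - ball_avg z0 t0 u\<bar> \<le> (2 * t / r ^ DIM('a) + C) * (\<integral>y. norm (g y) \<partial>lborel)"
      by (simp add: ring_distribs)
  qed
qed

text \<open>Induction along the connected set \<Omega>. Near a point a, the room around a serves
  every passage: shrink the radius at x, move to a, then from a to y.\<close>

lemma grad_L1_connected_all:
  fixes \<Omega> :: "'a::euclidean_space set"
  assumes \<Omega>: "open \<Omega>" "connected \<Omega>" and z0: "z0 \<in> \<Omega>" "t0 > 0" "cball z0 (2 * t0) \<subseteq> \<Omega>" and b: "b \<in> \<Omega>"
  shows "\<exists>t>0. cball b (2 * t) \<subseteq> \<Omega> \<and> grad_L1_connected \<Omega> z0 t0 b t"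
proof (rule connected_induction_simple[OF \<Omega>(2) z0(1) b])
  show "\<exists>t>0. cball z0 (2 * t) \<subseteq> \<Omega> \<and> grad_L1_connected \<Omega> z0 t0 z0 t"
    using z0 by (intro exI[of _ t0]) (auto simp: grad_L1_connected_def)
  fix a assume "a \<in> \<Omega>"
  then obtain d where d: "d > 0" "cball a d \<subseteq> \<Omega>" using \<Omega>(1) open_contains_cball by blast
  define t where "t = d / 2"
  have t: "t > 0" "cball a (2 * t) \<subseteq> \<Omega>" using d by (auto simp: t_def)
  have sub: "ball a (t / 2) \<subseteq> \<Omega>" using t by (auto simp: subset_iff)
  show "\<exists>T. openin (top_of_set \<Omega>) T \<and> a \<in> T \<and> (\<forall>x\<in>T. \<forall>y\<in>T.
      (\<exists>t>0. cball x (2 * t) \<subseteq> \<Omega> \<and> grad_L1_connected \<Omega> z0 t0 x t) \<longrightarrow>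
      (\<exists>t>0. cball y (2 * t) \<subseteq> \<Omega> \<and> grad_L1_connected \<Omega> z0 t0 y t))"
  proof (intro exI[of _ "ball a (t / 2)"] conjI ballI impI)
    show "openin (top_of_set \<Omega>) (ball a (t / 2))" using sub by (intro open_subset) auto
    show "a \<in> ball a (t / 2)" using t by simp
    fix x y assume x: "x \<in> ball a (t / 2)" and y: "y \<in> ball a (t / 2)"
      and "\<exists>t>0. cball x (2 * t) \<subseteq> \<Omega> \<and> grad_L1_connected \<Omega> z0 t0 x t"
    then obtain tx where tx: "tx > 0" "cball x (2 * tx) \<subseteq> \<Omega>" "grad_L1_connected \<Omega> z0 t0 x tx" by blast
    \<comment> \<open>At most tx, so the radius can be shrunk within the room at x; at most t / 2,
      so that the ball of radius 2 * s about y stays in the room at a.\<close>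
    define s where "s = min tx (t / 2)"
    have s: "0 < s" "s \<le> tx" "s \<le> t / 2" using tx t by (auto simp: s_def)
    have 1: "grad_L1_connected \<Omega> z0 t0 x s"
      by (rule grad_L1_connected_near[OF tx(3), of s tx]) (use tx s in auto)
    have 2: "grad_L1_connected \<Omega> z0 t0 a s"
      by (rule grad_L1_connected_near[OF 1, of s t]) (use x t s in \<open>auto simp: dist_commute\<close>)
    have 3: "grad_L1_connected \<Omega> z0 t0 y s"
      by (rule grad_L1_connected_near[OF 2, of s t]) (use y t s in \<open>auto simp: dist_commute\<close>)
    have "cball y (2 * s) \<subseteq> cball a (2 * t)"
      using y s t by (intro cball_subset_cball_iff[THEN iffD2]) (auto simp: dist_commute)
    then show "\<exists>t>0. cball y (2 * t) \<subseteq> \<Omega> \<and> grad_L1_connected \<Omega> z0 t0 y t"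
      using 3 s t by blast
  qed
qed

text \<open>Connectedness gives a constant for each centre; compactness of the set K of admissible
  centres makes it uniform. Admissibility is stated with open balls, so that the complement of K is
  a union of open balls and K is closed.\<close>

lemma ball_avg_compare_uniform:
  fixes \<Omega> :: "'a::euclidean_space set"
  assumes \<Omega>: "open \<Omega>" "connected \<Omega>" "bounded \<Omega>" and z0: "z0 \<in> \<Omega>" "t0 > 0" "cball z0 (2 * t0) \<subseteq> \<Omega>" and r: "r > 0"
  shows "\<exists>C\<ge>0. \<forall>c u g. ball c (3 * r) \<subseteq> \<Omega> \<longrightarrow> weak_grad_pair \<Omega> u g \<longrightarrow>
    \<bar>ball_avg c r u - ball_avg z0 t0 u\<bar> \<le> C * (\<integral>y. norm (g y) \<partial>lborel)"
proof -
  define K where "K = {c. ball c (3 * r) \<subseteq> \<Omega>}"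
  have "K = - (\<Union>y\<in>-\<Omega>. ball y (3 * r))" by (auto simp: K_def subset_iff dist_commute)
  moreover have "open (\<Union>y\<in>-\<Omega>. ball y (3 * r))" by blast
  ultimately have "closed K" by (simp add: closed_def)
  moreover have K\<Omega>: "K \<subseteq> \<Omega>" using r by (auto simp: K_def subset_iff)
  ultimately have comp: "compact K" using \<Omega>(3) bounded_subset compact_eq_bounded_closed by blast
  have "\<forall>c\<in>\<Omega>. \<exists>t>0. cball c (2 * t) \<subseteq> \<Omega> \<and> grad_L1_connected \<Omega> z0 t0 c t"
    using grad_L1_connected_all[OF \<Omega>(1,2) z0] by blast
  then obtain T where T: "\<And>c. c \<in> \<Omega> \<Longrightarrow> T c > 0 \<and> cball c (2 * T c) \<subseteq> \<Omega> \<and> grad_L1_connected \<Omega> z0 t0 c (T c)"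
    by metis
  then have "\<forall>c\<in>\<Omega>. \<exists>C\<ge>0. \<forall>u g. weak_grad_pair \<Omega> u g \<longrightarrow>
     \<bar>ball_avg c (T c) u - ball_avg z0 t0 u\<bar> \<le> C * (\<integral>y. norm (g y) \<partial>lborel)"
    by (simp add: grad_L1_connected_def)
  then obtain D where D: "\<And>c. c \<in> \<Omega> \<Longrightarrow> D c \<ge> 0"
    "\<And>c u g. c \<in> \<Omega> \<Longrightarrow> weak_grad_pair \<Omega> u g \<Longrightarrow>
     \<bar>ball_avg c (T c) u - ball_avg z0 t0 u\<bar> \<le> D c * (\<integral>y. norm (g y) \<partial>lborel)"
    by metis
  obtain F where F: "F \<subseteq> K" "finite F" "K \<subseteq> (\<Union>c\<in>F. ball c (T c))"
  proof (rule compactE_image[OF comp, of K "\<lambda>c. ball c (T c)"])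
    show "K \<subseteq> (\<Union>c\<in>K. ball c (T c))" using T K\<Omega> by force
  qed auto
  \<comment> \<open>The three summands pay for changing the radius at the given centre, moving to
    the centre of the covering ball, and reaching the reference ball at z0.\<close>
  define E where "E c = 2 * r / (min r (T c)) ^ DIM('a) + 2 * T c / (min r (T c)) ^ DIM('a) + D c" for c
  have E0: "E c \<ge> 0" if "c \<in> F" for c
    using T[of c] D(1)[of c] that F K\<Omega> r unfolding E_def
    by (intro add_nonneg_nonneg divide_nonneg_nonneg) (auto intro!: zero_le_power)
  show ?thesis
  proof (intro exI[of _ "sum E F"] conjI allI impI)
    show "0 \<le> sum E F" using E0 by (rule sum_nonneg)
    fix c u g assume c: "ball c (3 * r) \<subseteq> \<Omega>" and ug: "weak_grad_pair \<Omega> u g"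
    then have "c \<in> K" by (simp add: K_def)
    then obtain k where k: "k \<in> F" "c \<in> ball k (T k)" using F by blast
    then have k\<Omega>: "k \<in> \<Omega>" using F K\<Omega> by auto
    define s where "s = min r (T k)"
    have s: "0 < s" "s \<le> r" "s \<le> T k" using r T[OF k\<Omega>] by (auto simp: s_def)
    let ?G = "\<integral>y. norm (g y) \<partial>lborel"
    have "cball c (2 * r) \<subseteq> \<Omega>" using c r by (auto simp: subset_iff)
    then have 1: "\<bar>ball_avg c r u - ball_avg c s u\<bar> \<le> 2 * r / s ^ DIM('a) * ?G"
      using s r by (intro ball_avg_near[OF ug, of s]) auto
    have 2: "\<bar>ball_avg c s u - ball_avg k (T k) u\<bar> \<le> 2 * T k / s ^ DIM('a) * ?G"
      using s k T[OF k\<Omega>] by (intro ball_avg_near[OF ug, of s]) auto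
    have "\<bar>ball_avg c r u - ball_avg z0 t0 u\<bar> \<le> E k * ?G"
      using 1 2 D(2)[OF k\<Omega> ug] by (simp add: E_def s_def[symmetric] ring_distribs)
    also have "\<dots> \<le> sum E F * ?G"
      using k F E0 by (intro mult_right_mono member_le_sum Bochner_Integration.integral_nonneg) auto
    finally show "\<bar>ball_avg c r u - ball_avg z0 t0 u\<bar> \<le> sum E F * ?G" .
  qed
qed

lemma abs_ball_avg_le:
  fixes u :: "'a::euclidean_space \<Rightarrow> real"
  assumes u: "integrable lborel u" and t: "t > 0"
  shows "\<bar>ball_avg c t u\<bar> \<le> (\<integral>y. \<bar>u y\<bar> \<partial>lborel) / t ^ DIM('a)"
proof -
  have k: "\<bar>bump c t y / t ^ DIM('a)\<bar> \<le> 1 / t ^ DIM('a)" for y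
    using t bump_nonneg[of c t y] bump_le_1[of c t y] by (simp add: divide_right_mono)
  have "\<bar>ball_avg c t u\<bar> \<le> (\<integral>y. \<bar>u y\<bar> / t ^ DIM('a) \<partial>lborel)"
    unfolding ball_avg_def
  proof (rule integral_abs_bound_integral)
    show "integrable lborel (\<lambda>y. u y * (bump c t y / t ^ DIM('a)))"
      by (rule integrable_mult_bounded[OF u _ k]) simp
    show "integrable lborel (\<lambda>y. \<bar>u y\<bar> / t ^ DIM('a))" using u by simp
    show "\<bar>u y * (bump c t y / t ^ DIM('a))\<bar> \<le> \<bar>u y\<bar> / t ^ DIM('a)" for y
      using mult_left_mono[OF k[of y], of "\<bar>u y\<bar>"] by (simp add: abs_mult)
  qed
  then show ?thesis by simp
qed

text \<open>Here m is a normalised average over one fixed ball. From u x one passes to the average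
  over the largest ball on the axis of the cone at x, at the cost of a potential, and from there to
  the fixed ball at the cost of the L^1 norm of g, which the potential absorbs since the kernel is
  at least 1 on \<Omega>. The kernel bound and the bound on |m| are exported because later u itself,
  not u - m, is estimated by a potential.\<close>

lemma pointwise_Poincare:
  fixes \<Omega> :: "'a::euclidean_space set"
  assumes \<Omega>: "open \<Omega>" "connected \<Omega>" "\<Omega> \<noteq> {}" "bounded \<Omega>" "cone_condition \<Omega>"
  shows "\<exists>R>0. \<exists>C>0. \<forall>u g. weak_grad_pair \<Omega> u g \<longrightarrow>
    (\<exists>m. \<bar>m\<bar> \<le> C * (\<integral>y. \<bar>u y\<bar> \<partial>lborel) \<and>
      (AE x in lborel. x \<in> \<Omega> \<longrightarrow>
        (\<forall>y\<in>\<Omega>. 1 \<le> dyadic_kernel R x y) \<and>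
        ennreal \<bar>u x - m\<bar> \<le> ennreal C * dyadic_potential R (\<lambda>y. norm (g y)) x))"
proof -
  let ?n = "DIM('a)" and ?b = "bump_mass TYPE('a)"
  obtain \<rho> \<sigma> where \<rho>: "\<rho> > 0" and \<sigma>: "\<sigma> > 0" "\<sigma> \<le> 1/6"
    and cone: "\<And>x. x \<in> \<Omega> \<Longrightarrow> \<exists>e. norm e = 1 \<and> (\<forall>a. 0 < a \<and> a \<le> \<rho> \<longrightarrow> cball (x + a *\<^sub>R e) (3 * a * \<sigma>) \<subseteq> \<Omega>)"
    using cone_condition_balls[OF \<Omega>(5)] by metis
  obtain z0 where z0: "z0 \<in> \<Omega>" using \<Omega>(3) by blast
  then obtain d where d: "d > 0" "cball z0 d \<subseteq> \<Omega>" using \<Omega>(1) open_contains_cball by blast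
  define t0 where "t0 = d / 2"
  have t0: "t0 > 0" "cball z0 (2 * t0) \<subseteq> \<Omega>" using d by (auto simp: t0_def)
  \<comment> \<open>The first entry serves the telescoping along the cone, the second makes the
    kernel at least 1 between any two points of \<Omega>.\<close>
  define R where "R = max (2 * \<rho>) (diameter \<Omega>)"
  have R: "2 * \<rho> \<le> R" "0 < R" using \<rho> by (auto simp: R_def)
  have dR: "dist x y \<le> R" if "x \<in> \<Omega>" "y \<in> \<Omega>" for x y
    using diameter_bounded_bound[OF \<Omega>(4) that] by (simp add: R_def)
  obtain C2 where C2: "C2 \<ge> 0" "\<And>c u g. ball c (3 * (\<rho> * \<sigma>)) \<subseteq> \<Omega> \<Longrightarrow> weak_grad_pair \<Omega> u g \<Longrightarrow>
    \<bar>ball_avg c (\<rho> * \<sigma>) u - ball_avg z0 t0 u\<bar> \<le> C2 * (\<integral>y. norm (g y) \<partial>lborel)"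
    using ball_avg_compare_uniform[OF \<Omega>(1,2,4) z0 t0, of "\<rho> * \<sigma>"] \<rho> \<sigma> by (metis mult_pos_pos)
  define C1 where "C1 = (2 / \<sigma>) ^ ?n / \<rho> ^ (?n - 1)"
  have C1: "C1 > 0" using \<rho> \<sigma> by (simp add: C1_def)
  have b: "?b > 0" by (rule bump_mass_pos)
  define C where "C = max ((C1 + C2) / ?b) (1 / t0 ^ ?n / ?b)"
  have C: "C > 0" "(C1 + C2) / ?b \<le> C" "1 / t0 ^ ?n / ?b \<le> C"
    using C1 C2(1) b by (auto simp: C_def less_max_iff_disj)
  show ?thesis
  proof (rule exI[of _ R], rule conjI[OF R(2)], rule exI[of _ C], rule conjI[OF C(1)], intro allI impI)
    fix u g assume ug: "weak_grad_pair \<Omega> u g"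
    then have u: "integrable lborel u" and g: "integrable lborel g" and g0: "\<And>x. x \<notin> \<Omega> \<Longrightarrow> g x = 0"
      by (auto simp: weak_grad_pair_def)
    define m where "m = ball_avg z0 t0 u / ?b"
    show "\<exists>m. \<bar>m\<bar> \<le> C * (\<integral>y. \<bar>u y\<bar> \<partial>lborel) \<and> (AE x in lborel. x \<in> \<Omega> \<longrightarrow>
        (\<forall>y\<in>\<Omega>. 1 \<le> dyadic_kernel R x y) \<and>
        ennreal \<bar>u x - m\<bar> \<le> ennreal C * dyadic_potential R (\<lambda>y. norm (g y)) x)"
    proof (intro exI[of _ m] conjI)
      have "\<bar>m\<bar> \<le> (\<integral>y. \<bar>u y\<bar> \<partial>lborel) / t0 ^ ?n / ?b"
        unfolding m_def using divide_right_mono[OF abs_ball_avg_le[OF u t0(1), of z0] less_imp_le[OF b]] b by simp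
      also have "\<dots> = (1 / t0 ^ ?n / ?b) * (\<integral>y. \<bar>u y\<bar> \<partial>lborel)" by simp
      also have "\<dots> \<le> C * (\<integral>y. \<bar>u y\<bar> \<partial>lborel)"
        using C(3) by (intro mult_right_mono Bochner_Integration.integral_nonneg) auto
      finally show "\<bar>m\<bar> \<le> C * (\<integral>y. \<bar>u y\<bar> \<partial>lborel)" .
      have "\<sigma> \<le> 1/2" using \<sigma> by simp
      from cone_potential_bound[OF ug \<rho> \<sigma>(1) this R(1)]
      show "AE x in lborel. x \<in> \<Omega> \<longrightarrow>
        (\<forall>y\<in>\<Omega>. 1 \<le> dyadic_kernel R x y) \<and>
        ennreal \<bar>u x - m\<bar> \<le> ennreal C * dyadic_potential R (\<lambda>y. norm (g y)) x"
      proof eventually_elim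
        case (elim x)
        show ?case
        proof (intro impI conjI ballI)
          assume x: "x \<in> \<Omega>"
          have ker: "1 \<le> dyadic_kernel R x y" if "y \<in> \<Omega>" for y
            by (rule dyadic_kernel_ge_1[OF dR[OF x that]])
          show "1 \<le> dyadic_kernel R x y" if "y \<in> \<Omega>" for y by (rule ker[OF that])
          obtain e where e: "norm e = 1" "\<And>a. 0 < a \<Longrightarrow> a \<le> \<rho> \<Longrightarrow> cball (x + a *\<^sub>R e) (3 * a * \<sigma>) \<subseteq> \<Omega>"
            using cone[OF x] by blast
          have e': "cball (x + a *\<^sub>R e) (a * \<sigma>) \<subseteq> \<Omega>" if "0 < a" "a \<le> \<rho>" for a
          proof -
            have "a * \<sigma> \<le> 3 * a * \<sigma>" using that \<sigma> by simp
            then show ?thesis using e(2)[OF that] by (meson order_trans subset_cball)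
          qed
          let ?P = "dyadic_potential R (\<lambda>y. norm (g y)) x" and ?A = "ball_avg (x + \<rho> *\<^sub>R e) (\<rho> * \<sigma>) u"
          have 1: "ennreal \<bar>?b * u x - ?A\<bar> \<le> ennreal C1 * ?P"
            using elim e(1) e' by (simp add: C1_def)
          have "ball (x + \<rho> *\<^sub>R e) (3 * (\<rho> * \<sigma>)) \<subseteq> \<Omega>" using e(2)[of \<rho>] \<rho> ball_subset_cball by (fastforce simp: mult.assoc)
          then have "\<bar>?A - ball_avg z0 t0 u\<bar> \<le> C2 * (\<integral>y. norm (g y) \<partial>lborel)" by (rule C2(2)[OF _ ug])
          then have "ennreal \<bar>?A - ball_avg z0 t0 u\<bar> \<le> ennreal C2 * ennreal (\<integral>y. norm (g y) \<partial>lborel)"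
            using C2(1) by (simp add: ennreal_mult'[symmetric] ennreal_leI)
          also have "ennreal (\<integral>y. norm (g y) \<partial>lborel) = (\<integral>\<^sup>+y. ennreal (norm (g y)) \<partial>lborel)"
            using g by (intro nn_integral_eq_integral[symmetric]) auto
          also have "ennreal C2 * (\<integral>\<^sup>+y. ennreal (norm (g y)) \<partial>lborel) \<le> ennreal C2 * ?P"
            unfolding dyadic_potential_def
          proof (intro mult_left_mono nn_integral_mono)
            fix y
            show "ennreal (norm (g y)) \<le> dyadic_kernel R x y * ennreal (norm (g y))"
              using ker[of y] g0[of y] mult_right_mono[of 1 "dyadic_kernel R x y" "ennreal (norm (g y))"]
              by (cases "y \<in> \<Omega>") auto
          qed auto
          finally have 2: "ennreal \<bar>?A - ball_avg z0 t0 u\<bar> \<le> ennreal C2 * ?P" .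
          have "\<bar>?b * (u x - m)\<bar> \<le> \<bar>?b * u x - ?A\<bar> + \<bar>?A - ball_avg z0 t0 u\<bar>"
            using b by (simp add: m_def right_diff_distrib)
          then have "ennreal \<bar>?b * (u x - m)\<bar> \<le> ennreal \<bar>?b * u x - ?A\<bar> + ennreal \<bar>?A - ball_avg z0 t0 u\<bar>"
            by (simp add: ennreal_plus[symmetric] ennreal_leI del: ennreal_plus)
          also have "\<dots> \<le> ennreal C1 * ?P + ennreal C2 * ?P" using 1 2 by (rule add_mono)
          also have "\<dots> = ennreal (C1 + C2) * ?P" using C1 C2(1) by (simp add: distrib_right)
          finally have 3: "ennreal \<bar>?b * (u x - m)\<bar> \<le> ennreal (C1 + C2) * ?P" .
          have "ennreal \<bar>u x - m\<bar> = ennreal (1 / ?b) * ennreal \<bar>?b * (u x - m)\<bar>"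
            using b by (simp add: ennreal_mult'[symmetric] abs_mult)
          also have "\<dots> \<le> ennreal (1 / ?b) * (ennreal (C1 + C2) * ?P)" using 3 by (rule mult_left_mono) simp
          also have "\<dots> = ennreal ((C1 + C2) / ?b) * ?P"
            using b by (simp add: mult.assoc[symmetric] ennreal_mult'[symmetric])
          also have "\<dots> \<le> ennreal C * ?P" using C(2) by (intro mult_right_mono ennreal_leI) auto
          finally show "ennreal \<bar>u x - m\<bar> \<le> ennreal C * ?P" .
        qed
      qed
    qed
  qed
qed

section \<open>Potential estimates\<close>

lemma dyadic_kernel_commute: "dyadic_kernel R x y = dyadic_kernel R y x"
  unfolding dyadic_kernel_def by (simp add: indicator_def dist_commute)

lemma dyadic_kernel_measurable_pair:
  "(\<lambda>p. dyadic_kernel R (fst p) (snd p)) \<in> borel_measurable ((lborel :: 'a::euclidean_space measure) \<Otimes>\<^sub>M (lborel :: 'a measure))"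
proof -
  have [measurable]: "Measurable.pred ((lborel :: 'a measure) \<Otimes>\<^sub>M (lborel :: 'a measure)) (\<lambda>p. dist (fst p) (snd p) \<le> r)" for r
    by measurable
  have "(\<lambda>p. \<Sum>j. ennreal ((2 ^ j) ^ (DIM('a) - 1)) * indicator {p. dist (fst p) (snd p) \<le> R / 2 ^ j} p)
    \<in> borel_measurable ((lborel :: 'a measure) \<Otimes>\<^sub>M (lborel :: 'a measure))"
    by measurable
  then show ?thesis unfolding dyadic_kernel_def by (simp add: indicator_def)
qed

lemma Young_real: "l > 0 \<Longrightarrow> \<bar>s * t\<bar> \<le> l / 2 * s\<^sup>2 + 1 / (2 * l) * t\<^sup>2" for s t l :: real
proof -
  assume l: "l > 0"
  have "0 \<le> (l * \<bar>s\<bar> - \<bar>t\<bar>)\<^sup>2 / (2 * l)" using l by simp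
  also have "\<dots> = l / 2 * s\<^sup>2 + 1 / (2 * l) * t\<^sup>2 - \<bar>s\<bar> * \<bar>t\<bar>"
    using l by (simp add: power2_diff power_mult_distrib field_simps power2_eq_square)
  finally show ?thesis by (simp add: abs_mult)
qed

text \<open>Schur's test: Young's inequality under the double integral separates a from b, and
  symmetry of the kernel lets the same row bound M serve both terms. The weight l stays free, which
  replaces a product of L^2 norms and allows absorption later.\<close>

lemma Schur_dyadic:
  fixes a b :: "'a::euclidean_space \<Rightarrow> real"
  assumes A: "A \<in> sets borel" and ab: "a \<in> borel_measurable borel" "b \<in> borel_measurable borel"
    and M: "M \<ge> 0" "\<And>x. (\<integral>\<^sup>+y. dyadic_kernel R x y * indicator A y \<partial>lborel) \<le> ennreal M" and l: "l > 0"
  shows "(\<integral>\<^sup>+x. ennreal (\<bar>a x\<bar> * indicator A x) * dyadic_potential R (\<lambda>y. \<bar>b y\<bar> * indicator A y) x \<partial>lborel)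
    \<le> ennreal (M / 2) * (ennreal l * (\<integral>\<^sup>+x. ennreal ((a x)\<^sup>2 * indicator A x) \<partial>lborel)
        + ennreal (1 / l) * (\<integral>\<^sup>+x. ennreal ((b x)\<^sup>2 * indicator A x) \<partial>lborel))"
proof -
  let ?L = "lborel :: 'a measure" and ?k = "dyadic_kernel R"
  note [measurable] = ab A
  have [measurable]: "(\<lambda>p. dyadic_kernel R (fst p) (snd p)) \<in> borel_measurable (?L \<Otimes>\<^sub>M ?L)"
    by (rule dyadic_kernel_measurable_pair)
  have [measurable]: "(\<lambda>p. dyadic_kernel R (snd p) (fst p)) \<in> borel_measurable (?L \<Otimes>\<^sub>M ?L)"
    using dyadic_kernel_measurable_pair[of R] by (simp add: dyadic_kernel_commute)
  let ?P = "\<lambda>x y. ?k x y * (indicator A y * ennreal (l / 2 * (a x)\<^sup>2 * indicator A x))"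
  let ?Q = "\<lambda>x y. ?k x y * (indicator A x * ennreal (1 / (2 * l) * (b y)\<^sup>2 * indicator A y))"
  have pt: "ennreal (\<bar>a x\<bar> * indicator A x) * (?k x y * ennreal (\<bar>b y\<bar> * indicator A y)) \<le> ?P x y + ?Q x y" for x y
  proof (cases "x \<in> A \<and> y \<in> A")
    case True
    have "ennreal (\<bar>a x\<bar>) * ennreal (\<bar>b y\<bar>) \<le> ennreal (l / 2 * (a x)\<^sup>2) + ennreal (1 / (2 * l) * (b y)\<^sup>2)"
      using Young_real[OF l, of "a x" "b y"] l by (simp add: abs_mult ennreal_mult'[symmetric] ennreal_plus[symmetric] ennreal_leI del: ennreal_plus)
    then have "?k x y * (ennreal (\<bar>a x\<bar>) * ennreal (\<bar>b y\<bar>)) \<le> ?k x y * (ennreal (l / 2 * (a x)\<^sup>2) + ennreal (1 / (2 * l) * (b y)\<^sup>2))"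
      by (rule mult_left_mono) simp
    then show ?thesis using True by (simp add: distrib_left mult_ac)
  next
    case False
    then show ?thesis by auto
  qed
  have "(\<integral>\<^sup>+x. ennreal (\<bar>a x\<bar> * indicator A x) * dyadic_potential R (\<lambda>y. \<bar>b y\<bar> * indicator A y) x \<partial>lborel)
     = (\<integral>\<^sup>+x. \<integral>\<^sup>+y. ennreal (\<bar>a x\<bar> * indicator A x) * (?k x y * ennreal (\<bar>b y\<bar> * indicator A y)) \<partial>lborel \<partial>lborel)"
    unfolding dyadic_potential_def by (simp add: nn_integral_cmult)
  also have "\<dots> \<le> (\<integral>\<^sup>+x. \<integral>\<^sup>+y. ?P x y + ?Q x y \<partial>lborel \<partial>lborel)"
    by (intro nn_integral_mono pt)
  also have "\<dots> = (\<integral>\<^sup>+x. \<integral>\<^sup>+y. ?P x y \<partial>lborel \<partial>lborel) + (\<integral>\<^sup>+x. \<integral>\<^sup>+y. ?Q x y \<partial>lborel \<partial>lborel)"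
    by (simp add: nn_integral_add)
  also have "(\<integral>\<^sup>+x. \<integral>\<^sup>+y. ?Q x y \<partial>lborel \<partial>lborel) = (\<integral>\<^sup>+y. \<integral>\<^sup>+x. ?Q x y \<partial>lborel \<partial>lborel)"
    by (rule lborel_pair.Fubini') measurable
  also have "(\<integral>\<^sup>+y. \<integral>\<^sup>+x. ?Q x y \<partial>lborel \<partial>lborel) \<le> (\<integral>\<^sup>+y. ennreal M * ennreal (1 / (2 * l) * (b y)\<^sup>2 * indicator A y) \<partial>lborel)"
  proof (intro nn_integral_mono)
    fix y
    have "(\<integral>\<^sup>+x. ?Q x y \<partial>lborel) = (\<integral>\<^sup>+x. (?k y x * indicator A x) * ennreal (1 / (2 * l) * (b y)\<^sup>2 * indicator A y) \<partial>lborel)"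
      by (simp add: dyadic_kernel_commute[of R y] mult.assoc)
    also have "\<dots> = (\<integral>\<^sup>+x. ?k y x * indicator A x \<partial>lborel) * ennreal (1 / (2 * l) * (b y)\<^sup>2 * indicator A y)"
      by (rule nn_integral_multc) measurable
    also have "\<dots> \<le> ennreal M * ennreal (1 / (2 * l) * (b y)\<^sup>2 * indicator A y)"
      by (intro mult_right_mono M) simp
    finally show "(\<integral>\<^sup>+x. ?Q x y \<partial>lborel) \<le> ennreal M * ennreal (1 / (2 * l) * (b y)\<^sup>2 * indicator A y)" .
  qed
  also have "(\<integral>\<^sup>+x. \<integral>\<^sup>+y. ?P x y \<partial>lborel \<partial>lborel) \<le> (\<integral>\<^sup>+x. ennreal M * ennreal (l / 2 * (a x)\<^sup>2 * indicator A x) \<partial>lborel)"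
  proof (intro nn_integral_mono)
    fix x
    have "(\<integral>\<^sup>+y. ?P x y \<partial>lborel) = (\<integral>\<^sup>+y. (?k x y * indicator A y) * ennreal (l / 2 * (a x)\<^sup>2 * indicator A x) \<partial>lborel)"
      by (simp add: mult.assoc)
    also have "\<dots> = (\<integral>\<^sup>+y. ?k x y * indicator A y \<partial>lborel) * ennreal (l / 2 * (a x)\<^sup>2 * indicator A x)"
      by (rule nn_integral_multc) measurable
    also have "\<dots> \<le> ennreal M * ennreal (l / 2 * (a x)\<^sup>2 * indicator A x)"
      by (intro mult_right_mono M) simp
    finally show "(\<integral>\<^sup>+y. ?P x y \<partial>lborel) \<le> ennreal M * ennreal (l / 2 * (a x)\<^sup>2 * indicator A x)" .
  qed
  finally have *: "(\<integral>\<^sup>+x. ennreal (\<bar>a x\<bar> * indicator A x) * dyadic_potential R (\<lambda>y. \<bar>b y\<bar> * indicator A y) x \<partial>lborel)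
    \<le> (\<integral>\<^sup>+x. ennreal M * ennreal (l / 2 * (a x)\<^sup>2 * indicator A x) \<partial>lborel)
      + (\<integral>\<^sup>+y. ennreal M * ennreal (1 / (2 * l) * (b y)\<^sup>2 * indicator A y) \<partial>lborel)"
    by (meson add_mono order_trans order_refl)
  have e1: "ennreal M * ennreal (l / 2 * (a x)\<^sup>2 * indicator A x) = ennreal (M / 2) * (ennreal l * ennreal ((a x)\<^sup>2 * indicator A x))" for x
    using M(1) l by (simp add: ennreal_mult'[symmetric] mult_ac)
  have e2: "ennreal M * ennreal (1 / (2 * l) * (b x)\<^sup>2 * indicator A x) = ennreal (M / 2) * (ennreal (1 / l) * ennreal ((b x)\<^sup>2 * indicator A x))" for x
    using M(1) l by (simp add: ennreal_mult'[symmetric] mult_ac)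
  show ?thesis
    using * unfolding e1 e2 by (simp add: nn_integral_cmult distrib_left)
qed

text \<open>The ball of radius \<open>R / 2 ^ j\<close> meets \<open>A\<close> in measure at most a geometric mean of the measures of
  both; the sharp exponent \<open>1 / n\<close> is given up to make the sum over \<open>j\<close> geometric.\<close>

lemma dyadic_kernel_integral_le:
  fixes \<theta> R :: real
  assumes \<theta>: "0 < \<theta>" "\<theta> < 1 / real DIM('a::euclidean_space)" and R: "R > 0"
  shows "\<exists>C\<ge>0. \<forall>A (x::'a). A \<in> sets borel \<longrightarrow> emeasure lborel A < \<infinity> \<longrightarrow>
    (\<integral>\<^sup>+y. dyadic_kernel R x y * indicator A y \<partial>lborel) \<le> ennreal (C * measure lborel A powr \<theta>)"
proof -
  let ?n = "DIM('a)" and ?v = "measure lborel (ball (0::'a) 1)"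
  have n: "real ?n > 0" by simp
  have \<theta>n: "\<theta> * real ?n < 1" using \<theta>(2) n by (simp add: field_simps)
  have "1 / real ?n \<le> 1" by (simp add: DIM_positive Suc_leI divide_le_eq)
  then have \<theta>1: "\<theta> < 1" using \<theta> by linarith
  \<comment> \<open>The ratio of the geometric series: (2^j)^(n - 1) from the kernel times (2^(-j *
    n)) powr (1 - \<theta>) from the ball is q^j, and q < 1 exactly because \<theta> * n <
    1.\<close>
  define q where "q = 2 powr (\<theta> * real ?n - 1)"
  have q: "0 < q" "q < 1"
  proof -
    show "0 < q" by (simp add: q_def)
    have "2 powr (\<theta> * real ?n - 1) < 2 powr 0" using \<theta>n by (intro powr_less_mono) auto
    then show "q < 1" by (simp add: q_def)
  qed
  define K where "K = (?v * R ^ ?n) powr (1 - \<theta>)"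
  have K: "K \<ge> 0" by (simp add: K_def)
  show ?thesis
  proof (intro exI[of _ "K / (1 - q)"] conjI allI impI)
    show "0 \<le> K / (1 - q)" using K q by simp
    fix A :: "'a set" and x :: 'a assume A [measurable]: "A \<in> sets borel" and fin: "emeasure lborel A < \<infinity>"
    let ?m = "measure lborel A"
    have jth: "ennreal ((2 ^ j) ^ (?n - 1)) * (\<integral>\<^sup>+y. indicator (cball x (R / 2 ^ j)) y * ennreal (indicator A y) \<partial>lborel)
        \<le> ennreal (?m powr \<theta> * K * q ^ j)" for j
    proof -
      define B where "B = A \<inter> cball x (R / 2 ^ j)"
      have B: "B \<in> sets lborel" by (auto simp: B_def)
      have BA: "measure lborel B \<le> ?m"
        using fin by (intro measure_mono_fmeasurable) (auto simp: B_def fmeasurable_def)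
      have "measure lborel B \<le> measure lborel (cball x (R / 2 ^ j))"
        by (intro measure_mono_fmeasurable fmeasurableI B emeasure_bounded_finite) (simp_all add: B_def)
      also have "\<dots> = (R / 2 ^ j) ^ ?n * ?v"
        using content_cball_conv_ball[of x "R / 2 ^ j"] content_ball_conv_unit_ball[of "R / 2 ^ j" x] R by simp
      finally have Bb: "measure lborel B \<le> (R / 2 ^ j) ^ ?n * ?v" .
      have "measure lborel B = measure lborel B powr \<theta> * measure lborel B powr (1 - \<theta>)"
        by (simp add: powr_add[symmetric])
      also have "\<dots> \<le> ?m powr \<theta> * ((R / 2 ^ j) ^ ?n * ?v) powr (1 - \<theta>)"
        using BA Bb \<theta> \<theta>1 by (intro mult_mono powr_mono2) auto
      also have "((R / 2 ^ j) ^ ?n * ?v) powr (1 - \<theta>) = K * (1 / 2 ^ (j * ?n)) powr (1 - \<theta>)"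
      proof -
        have "(R / 2 ^ j) ^ ?n * ?v = (?v * R ^ ?n) * (1 / 2 ^ (j * ?n))"
          by (simp add: power_divide power_mult)
        then show ?thesis unfolding K_def by (simp only: powr_mult)
      qed
      finally have mB: "measure lborel B \<le> ?m powr \<theta> * (K * (1 / 2 ^ (j * ?n)) powr (1 - \<theta>))" .
      have "(2 ^ j) ^ (?n - 1) * (1 / 2 ^ (j * ?n)) powr (1 - \<theta>) = q ^ j"
      proof -
        have "((2::real) ^ j) ^ (?n - 1) = 2 powr real (j * (?n - 1))"
          by (simp only: power_mult[symmetric] powr_realpow zero_less_numeral)
        then have 1: "((2::real) ^ j) ^ (?n - 1) = 2 powr (real j * (real ?n - 1))"
          by (simp add: of_nat_diff Suc_leI)
        have "(1 / 2 ^ (j * ?n)) = (2::real) powr (- real (j * ?n))"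
          by (simp only: powr_minus powr_realpow zero_less_numeral inverse_eq_divide)
        then have "(1 / 2 ^ (j * ?n)) = (2::real) powr (- (real j * real ?n))" by simp
        then have 2: "(1 / 2 ^ (j * ?n)) powr (1 - \<theta>) = (2::real) powr (- (real j * real ?n) * (1 - \<theta>))"
          by (simp add: powr_powr)
        have 3: "q ^ j = 2 powr ((\<theta> * real ?n - 1) * real j)"
          unfolding q_def by (simp add: powr_realpow[symmetric] powr_powr)
        show ?thesis unfolding 1 2 3 powr_add[symmetric] by (simp add: algebra_simps)
      qed
      then have eq: "?m powr \<theta> * K * q ^ j = (2 ^ j) ^ (?n - 1) * (?m powr \<theta> * (K * (1 / 2 ^ (j * ?n)) powr (1 - \<theta>)))"
        by (simp add: mult_ac)
      have "(\<integral>\<^sup>+y. indicator (cball x (R / 2 ^ j)) y * ennreal (indicator A y) \<partial>lborel) = (\<integral>\<^sup>+y. indicator B y \<partial>lborel)"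
        by (intro nn_integral_cong) (auto simp: B_def indicator_def)
      also have "\<dots> = emeasure lborel B" using B by (rule nn_integral_indicator)
      also have "\<dots> = ennreal (measure lborel B)"
      proof (rule emeasure_eq_ennreal_measure)
        have "emeasure lborel B \<le> emeasure lborel A" by (rule emeasure_mono) (auto simp: B_def)
        then show "emeasure lborel B \<noteq> top" using fin by (auto simp: top_unique)
      qed
      finally show ?thesis
        unfolding eq using mult_left_mono[OF mB, of "(2 ^ j) ^ (?n - 1)"] by (simp add: ennreal_mult'[symmetric] ennreal_leI)
    qed
    have "(\<integral>\<^sup>+y. dyadic_kernel R x y * indicator A y \<partial>lborel) = dyadic_potential R (indicator A) x"
      unfolding dyadic_potential_def by (simp add: ennreal_indicator)
    also have "\<dots> = (\<Sum>j. ennreal ((2 ^ j) ^ (?n - 1)) * (\<integral>\<^sup>+y. indicator (cball x (R / 2 ^ j)) y * ennreal (indicator A y) \<partial>lborel))"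
      by (rule dyadic_potential_eq_suminf) simp
    also have "\<dots> \<le> (\<Sum>j. ennreal (?m powr \<theta> * K * q ^ j))"
      by (intro suminf_le jth) auto
    also have "\<dots> = ennreal (\<Sum>j. ?m powr \<theta> * K * q ^ j)"
      using K q by (intro suminf_ennreal2 summable_mult summable_geometric) auto
    also have "(\<Sum>j. ?m powr \<theta> * K * q ^ j) = ?m powr \<theta> * K * (1 / (1 - q))"
      using q by (subst suminf_mult) (auto simp: suminf_geometric summable_geometric)
    also have "\<dots> = K / (1 - q) * ?m powr \<theta>" by simp
    finally show "(\<integral>\<^sup>+y. dyadic_kernel R x y * indicator A y \<partial>lborel) \<le> ennreal (K / (1 - q) * ?m powr \<theta>)" .
  qed
qed

section \<open>The chain rule for weak gradients\<close>

text \<open>By translation invariance every difference quotient integrates to 0; the mean value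
  theorem bounds the quotients by B on a fixed ball, so the limit passes through the
  integral.\<close>

lemma integral_directional_derivative_eq_0:
  fixes f f' :: "'a::euclidean_space \<Rightarrow> real" and i :: 'a
  assumes f: "integrable lborel f" and supp: "\<And>y. y \<notin> cball 0 \<rho> \<Longrightarrow> f y = 0"
    and der: "\<And>y. ((\<lambda>s. f (y + s *\<^sub>R i)) has_real_derivative f' y) (at 0)"
    and B: "\<And>y. \<bar>f' y\<bar> \<le> B"
  shows "(\<integral>y. f' y \<partial>lborel) = 0"
proof -
  have fm [measurable]: "f \<in> borel_measurable borel" using f by (rule lborel_integrable_borel)
  have B0: "0 \<le> B" using B[of 0] by linarith
  \<comment> \<open>Steps of length at most 1 keep all difference quotients supported in the common
    ball S.\<close>
  define h where "h k = 1 / real (Suc k)" for k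
  have h: "0 < h k" "h k \<le> 1" for k by (auto simp: h_def)
  have hne: "h k \<noteq> 0" for k using h(1)[of k] by simp
  have hlim: "h \<longlonglongrightarrow> 0"
    unfolding h_def[abs_def] using LIMSEQ_inverse_real_of_nat by (simp add: inverse_eq_divide)
  define q where "q k y = (f (h k *\<^sub>R i + y) - f y) / h k" for k y
  have der': "((\<lambda>s. f (y + s *\<^sub>R i)) has_real_derivative f' (y + s *\<^sub>R i)) (at s)" for y s
  proof -
    have "((\<lambda>z. f (y + (z + s) *\<^sub>R i)) has_real_derivative f' (y + s *\<^sub>R i)) (at 0)"
      using der[of "y + s *\<^sub>R i"] by (simp add: algebra_simps)
    then show ?thesis using DERIV_shift[of "\<lambda>s. f (y + s *\<^sub>R i)" _ 0 s] by simp
  qed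
  have qb: "\<bar>q k y\<bar> \<le> B" for k y
  proof -
    obtain z where "0 < z" "z < h k" "f (y + h k *\<^sub>R i) - f (y + 0 *\<^sub>R i) = (h k - 0) * f' (y + z *\<^sub>R i)"
      using MVT2[OF h(1)[of k], of "\<lambda>s. f (y + s *\<^sub>R i)" "\<lambda>s. f' (y + s *\<^sub>R i)"] der' by blast
    then have "q k y = f' (y + z *\<^sub>R i)" using h(1)[of k] by (simp add: q_def add.commute)
    then show ?thesis using B by simp
  qed
  define S where "S = cball (0::'a) (\<rho> + norm i)"
  have q0: "q k y = 0" if "y \<notin> S" for k y
  proof -
    have n: "norm y > \<rho> + norm i" using that by (simp add: S_def)
    have "norm y \<le> norm (h k *\<^sub>R i + y) + norm (h k *\<^sub>R i)"
      using norm_triangle_ineq4[of "h k *\<^sub>R i + y" "h k *\<^sub>R i"] by simp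
    moreover have "norm (h k *\<^sub>R i) \<le> 1 * norm i" using h[of k] by (simp add: mult_left_le_one_le)
    ultimately have "norm (h k *\<^sub>R i + y) > \<rho>" "norm y > \<rho>" using n norm_ge_zero[of i] by linarith+
    then show ?thesis using supp by (simp add: q_def)
  qed
  have qlim: "(\<lambda>k. q k y) \<longlonglongrightarrow> f' y" for y
  proof -
    have "((\<lambda>s. (f (y + s *\<^sub>R i) - f y) / s) \<longlongrightarrow> f' y) (at 0)"
      using der[of y] by (simp add: has_field_derivative_iff)
    then have "(\<lambda>k. (f (y + h k *\<^sub>R i) - f y) / h k) \<longlonglongrightarrow> f' y"
      by (rule filterlim_compose) (use hne hlim in \<open>auto simp: filterlim_at intro!: always_eventually\<close>)
    then show ?thesis by (simp add: q_def add.commute)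
  qed
  have f'm: "f' \<in> borel_measurable borel"
    by (rule borel_measurable_LIMSEQ_real[OF qlim]) (simp add: q_def)
  have "(\<lambda>k. \<integral>y. q k y \<partial>lborel) \<longlonglongrightarrow> (\<integral>y. f' y \<partial>lborel)"
  proof (rule integral_dominated_convergence[where w = "\<lambda>y. B * indicator S y"])
    show "integrable lborel (\<lambda>y. B * indicator S y :: real)"
      unfolding S_def by (intro integrable_mult_right integrable_real_indicator emeasure_bounded_finite) auto
    show "AE y in lborel. (\<lambda>k. q k y) \<longlonglongrightarrow> f' y" using qlim by simp
    show "AE y in lborel. norm (q k y) \<le> B * indicator S y" for k
    proof (intro always_eventually allI)
      show "norm (q k y) \<le> B * indicator S y" for y
        using qb[of k y] q0[of y k] by (cases "y \<in> S") auto
    qed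
  qed (use f'm in \<open>simp_all add: q_def\<close>)
  moreover have "(\<integral>y. q k y \<partial>lborel) = 0" for k
    using Bochner_Integration.integral_diff[OF integrable_translate[OF f, of "h k *\<^sub>R i"] f] integral_translate[OF fm, of "h k *\<^sub>R i"]
    by (simp add: q_def)
  ultimately have "(\<lambda>k::nat. 0) \<longlonglongrightarrow> (\<integral>y. f' y \<partial>lborel)" by simp
  then show ?thesis by (simp add: LIMSEQ_const_iff)
qed

lemma bump_commute: "bump c t y = bump y t c"
proof -
  have "(y - c) \<bullet> (y - c) = (c - y) \<bullet> (c - y)" by (metis inner_minus_left inner_minus_right minus_diff_eq minus_minus)
  then show ?thesis by (simp add: bump_def)
qed

lemma bump_measurable_pair:
  "(\<lambda>p. bump (fst p) t (snd p)) \<in> borel_measurable ((lborel :: 'a::euclidean_space measure) \<Otimes>\<^sub>M (lborel :: 'a measure))"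
proof -
  have [measurable]: "flat_exp 0 \<in> borel_measurable borel"
    by (rule borel_measurable_continuous_onI[OF continuous_on_flat_exp])
  show ?thesis unfolding bump_def by measurable
qed

lemma ball_avg_measurable:
  assumes "u \<in> borel_measurable borel"
  shows "(\<lambda>c::'a::euclidean_space. ball_avg c t u) \<in> borel_measurable borel"
proof -
  note [measurable] = assms bump_measurable_pair
  have "(\<lambda>c::'a. \<integral>y. u y * (bump c t y / t ^ DIM('a)) \<partial>lborel) \<in> borel_measurable lborel"
  proof (rule lborel.borel_measurable_lebesgue_integral)
    have "(\<lambda>p. u (snd p) * (bump (fst p) t (snd p) / t ^ DIM('a))) \<in> borel_measurable ((lborel :: 'a measure) \<Otimes>\<^sub>M (lborel :: 'a measure))"
      by measurable
    then show "(\<lambda>(x, y). u y * (bump x t y / t ^ DIM('a))) \<in> borel_measurable (lborel \<Otimes>\<^sub>M lborel)"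
      by (simp add: split_beta')
  qed
  then show ?thesis by (simp add: ball_avg_def)
qed

lemma ball_avg_near_const:
  fixes z :: "'a::euclidean_space"
  assumes h: "h \<in> borel_measurable borel" "\<And>y. \<bar>h y\<bar> \<le> B" and t: "t > 0"
    and close: "\<And>y. dist z y < t \<Longrightarrow> \<bar>h y - c\<bar> \<le> \<eta>"
  shows "\<bar>ball_avg z t h - c * bump_mass TYPE('a)\<bar> \<le> \<eta> * bump_mass TYPE('a)"
proof -
  let ?k = "\<lambda>y. bump z t y / t ^ DIM('a)"
  have k0: "0 \<le> ?k y" for y using bump_nonneg[of z t y] t by simp
  have ik: "integrable lborel ?k" using integrable_bump[OF t] by auto
  have i1: "integrable lborel (\<lambda>y. h y * ?k y)"
    using integrable_mult_bounded[OF ik h] by (simp add: mult.commute)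
  have "ball_avg z t h - c * bump_mass TYPE('a) = (\<integral>y. h y * ?k y \<partial>lborel) - (\<integral>y. c * ?k y \<partial>lborel)"
    unfolding ball_avg_def integral_bump[OF t, of z, symmetric] by simp
  also have "\<dots> = (\<integral>y. h y * ?k y - c * ?k y \<partial>lborel)"
    using i1 ik by (intro Bochner_Integration.integral_diff[symmetric] integrable_mult_right) auto
  finally have eq: "ball_avg z t h - c * bump_mass TYPE('a) = (\<integral>y. h y * ?k y - c * ?k y \<partial>lborel)" .
  have "\<bar>\<integral>y. h y * ?k y - c * ?k y \<partial>lborel\<bar> \<le> (\<integral>y. \<eta> * ?k y \<partial>lborel)"
  proof (rule integral_abs_bound_integral)
    show "integrable lborel (\<lambda>y. h y * ?k y - c * ?k y)"
      using i1 ik by (intro Bochner_Integration.integrable_diff integrable_mult_right)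
    show "integrable lborel (\<lambda>y. \<eta> * ?k y)" using ik by (rule integrable_mult_right)
    fix y
    show "\<bar>h y * ?k y - c * ?k y\<bar> \<le> \<eta> * ?k y"
    proof (cases "dist z y < t")
      case True
      have "\<bar>h y * ?k y - c * ?k y\<bar> = \<bar>h y - c\<bar> * ?k y"
        using k0[of y] by (metis abs_mult abs_of_nonneg left_diff_distrib)
      also have "\<dots> \<le> \<eta> * ?k y" using close[OF True] k0 by (rule mult_right_mono)
      finally show ?thesis .
    next
      case False
      then show ?thesis using bump_eq_0[OF t, of z y] by simp
    qed
  qed
  also have "(\<integral>y. \<eta> * ?k y \<partial>lborel) = \<eta> * bump_mass TYPE('a)"
    by (simp only: integral_mult_right_zero integral_bump[OF t])
  finally show ?thesis unfolding eq .
qed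

lemma test_function_facts:
  fixes \<psi> :: "'a::euclidean_space \<Rightarrow> real"
  assumes "\<psi> \<in> test_functions \<Omega>" "i \<in> Basis"
  defines "\<psi>' \<equiv> \<lambda>x. frechet_derivative \<psi> (at x) i" and "K \<equiv> closure {x. \<psi> x \<noteq> 0}"
  shows "compact K" "K \<subseteq> \<Omega>" "continuous_on UNIV \<psi>" "continuous_on UNIV \<psi>'"
    "\<And>y. ((\<lambda>s. \<psi> (y + s *\<^sub>R i)) has_real_derivative \<psi>' y) (at 0)"
    "\<And>y. y \<notin> K \<Longrightarrow> \<psi> y = 0" "\<And>y. y \<notin> K \<Longrightarrow> \<psi>' y = 0"
    "\<exists>B. \<forall>y. \<bar>\<psi> y\<bar> \<le> B \<and> \<bar>\<psi>' y\<bar> \<le> B"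
proof -
  show K: "compact K" "K \<subseteq> \<Omega>" using assms by (auto simp: test_functions_def)
  have C: "Ck k \<psi>" for k using assms by (auto simp: test_functions_def)
  show c: "continuous_on UNIV \<psi>" using C[of 0] by simp
  show c': "continuous_on UNIV \<psi>'" using C[of "Suc 0"] assms(2) by (simp add: \<psi>'_def)
  show d: "((\<lambda>s. \<psi> (y + s *\<^sub>R i)) has_real_derivative \<psi>' y) (at 0)" for y
  proof -
    have "(\<psi> has_derivative frechet_derivative \<psi> (at y)) (at (y + 0 *\<^sub>R i))" using Ck_SucD(1)[OF C[of "Suc 0"]] by simp
    moreover have "((\<lambda>s. y + s *\<^sub>R i) has_derivative (\<lambda>s. s *\<^sub>R i)) (at 0)" by (auto intro!: derivative_eq_intros)
    ultimately have "((\<lambda>s. \<psi> (y + s *\<^sub>R i)) has_derivative (\<lambda>s. frechet_derivative \<psi> (at y) (s *\<^sub>R i))) (at 0)"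
      by (rule has_derivative_compose[rotated])
    moreover have "frechet_derivative \<psi> (at y) (s *\<^sub>R i) = \<psi>' y * s" for s
      using Ck_SucD(1)[OF C[of "Suc 0"], of y] by (simp add: \<psi>'_def has_derivative_linear linear_scale mult.commute)
    ultimately show ?thesis by (simp add: has_field_derivative_def mult_commute_abs)
  qed
  show z: "\<psi> y = 0" if "y \<notin> K" for y using that closure_subset[of "{x. \<psi> x \<noteq> 0}"] unfolding K_def by blast
  show z': "\<psi>' y = 0" if "y \<notin> K" for y
  proof -
    have "open (- K)" using K(1) by (simp add: compact_imp_closed open_Compl)
    then have "(\<psi> has_derivative (\<lambda>h. 0)) (at y)"
      by (rule has_derivative_transform_within_open[OF has_derivative_const[of 0]]) (use that z in auto)
    then have "frechet_derivative \<psi> (at y) = (\<lambda>h. 0)" by (rule frechet_derivative_at[symmetric])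
    then show ?thesis by (simp add: \<psi>'_def)
  qed
  have "bounded (\<psi> ` K)"
    by (intro compact_imp_bounded compact_continuous_image K(1) continuous_on_subset[OF c]) simp
  then obtain b1 where b1: "\<And>x. x \<in> \<psi> ` K \<Longrightarrow> norm x \<le> b1" unfolding bounded_iff by blast
  have "bounded (\<psi>' ` K)"
    by (intro compact_imp_bounded compact_continuous_image K(1) continuous_on_subset[OF c']) simp
  then obtain b2 where b2: "\<And>x. x \<in> \<psi>' ` K \<Longrightarrow> norm x \<le> b2" unfolding bounded_iff by blast
  have "\<bar>\<psi> y\<bar> \<le> b1 \<and> \<bar>\<psi>' y\<bar> \<le> b2" if "y \<in> K" for y
    using b1[OF imageI[OF that]] b2[OF imageI[OF that]] by simp
  then have "\<bar>\<psi> y\<bar> \<le> max 0 (max b1 b2) \<and> \<bar>\<psi>' y\<bar> \<le> max 0 (max b1 b2)" for y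
    using z[of y] z'[of y] by (cases "y \<in> K") (simp_all add: le_max_iff_disj)
  then show "\<exists>B. \<forall>y. \<bar>\<psi> y\<bar> \<le> B \<and> \<bar>\<psi>' y\<bar> \<le> B" by blast
qed

text \<open>Mollify \<open>u\<close> with \<open>bump\<close>, apply the classical chain rule, and pass to the limit. Only Lebesgue
  points of \<open>u\<close> are needed: by symmetry of the mollifier, the mollification of \<open>g\<close> can be moved
  to the bounded factor.\<close>

lemma weak_grad_pair_compose:
  fixes \<Omega> :: "'a::euclidean_space set" and F F' :: "real \<Rightarrow> real"
  assumes ug: "weak_grad_pair \<Omega> u g" and \<Omega>: "open \<Omega>"
    and F: "\<And>t. (F has_real_derivative F' t) (at t)" "F 0 = 0" "\<And>t. \<bar>F t\<bar> \<le> B"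
    and F': "\<And>t. \<bar>F' t\<bar> \<le> 1" "\<And>s t. \<bar>F' s - F' t\<bar> \<le> L * \<bar>s - t\<bar>"
  shows "weak_grad_pair \<Omega> (\<lambda>x. F (u x)) (\<lambda>x. F' (u x) *\<^sub>R g x)"
proof -
  let ?n = "DIM('a)" and ?b = "bump_mass TYPE('a)"
  have b: "?b > 0" by (rule bump_mass_pos)
  have u: "integrable lborel u" and g: "integrable lborel g" and out: "\<And>x. x \<notin> \<Omega> \<Longrightarrow> u x = 0 \<and> g x = 0"
    using ug by (auto simp: weak_grad_pair_def)
  have um [measurable]: "u \<in> borel_measurable borel" using u by (rule lborel_integrable_borel)
  have gm [measurable]: "g \<in> borel_measurable borel" using borel_measurable_integrable[OF g] by simp
  have contF: "continuous_on UNIV F" using F(1) by (intro continuous_at_imp_continuous_on ballI DERIV_isCont)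
  have L0: "L \<ge> 0" using F'(2)[of 1 0] by (simp add: abs_le_iff)
  have contF': "continuous_on UNIV F'"
  proof (rule continuous_at_imp_continuous_on, rule ballI)
    fix t
    have "((\<lambda>s. F' s - F' t) \<longlongrightarrow> 0) (at t)"
    proof (rule Lim_null_comparison)
      show "eventually (\<lambda>s. norm (F' s - F' t) \<le> L * \<bar>s - t\<bar>) (at t)" using F'(2) by simp
      show "((\<lambda>s. L * \<bar>s - t\<bar>) \<longlongrightarrow> 0) (at t)"
        by (rule tendsto_eq_intros refl | simp)+
    qed
    then show "isCont F' t" by (simp add: isCont_def LIM_zero_iff)
  qed
  have Fm [measurable]: "F \<in> borel_measurable borel" and F'm [measurable]: "F' \<in> borel_measurable borel"
    using contF contF' by (auto intro: borel_measurable_continuous_onI)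
  have Flip: "\<bar>F s\<bar> \<le> \<bar>s\<bar>" for s
  proof -
    have "norm (F s - F 0) \<le> 1 * norm (s - 0)"
      by (rule field_differentiable_bound[of UNIV F F'])
         (use F F' in \<open>auto intro: has_field_derivative_at_within\<close>)
    then show ?thesis using F(2) by simp
  qed
  have iFu: "integrable lborel (\<lambda>x. F (u x))"
    by (rule Bochner_Integration.integrable_bound[OF u]) (use Flip in auto)
  have iFg: "integrable lborel (\<lambda>x. F' (u x) *\<^sub>R g x)"
  proof (rule Bochner_Integration.integrable_bound[OF g])
    show "AE x in lborel. norm (F' (u x) *\<^sub>R g x) \<le> norm (g x)"
      using F'(1) by (intro always_eventually allI) (simp add: mult_left_le_one_le)
  qed simp
  have main: "(\<integral>x. F (u x) * frechet_derivative \<psi> (at x) i \<partial>lborel) = - (\<integral>x. ((F' (u x) *\<^sub>R g x) \<bullet> i) * \<psi> x \<partial>lborel)"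
    if \<psi>: "\<psi> \<in> test_functions \<Omega>" and i: "i \<in> Basis" for \<psi> i
  proof -
    define \<psi>' where "\<psi>' x = frechet_derivative \<psi> (at x) i" for x
    define K where "K = closure {x. \<psi> x \<noteq> 0}"
    note tf = test_function_facts[OF \<psi> i, folded \<psi>'_def K_def]
    have [measurable]: "\<psi> \<in> borel_measurable borel" "\<psi>' \<in> borel_measurable borel"
      using tf(3,4) by (auto intro: borel_measurable_continuous_onI)
    obtain P where P: "\<And>y. \<bar>\<psi> y\<bar> \<le> P" "\<And>y. \<bar>\<psi>' y\<bar> \<le> P" using tf(8) by blast
    have P0: "P \<ge> 0" using P(1)[of 0] by linarith
    have B0: "B \<ge> 0" using F(3)[of 0] by linarith
    obtain \<rho> where \<rho>: "K \<subseteq> cball 0 \<rho>"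
      using compact_imp_bounded[OF tf(1)] by (auto simp: bounded_iff subset_iff)
    have i\<psi>: "integrable lborel \<psi>" and i\<psi>': "integrable lborel \<psi>'"
    proof -
      have ind: "integrable lborel (indicator (cball 0 \<rho>) :: 'a \<Rightarrow> real)"
        by (intro integrable_real_indicator emeasure_bounded_finite) auto
      have z: "\<psi> y = 0" "\<psi>' y = 0" if "y \<notin> cball 0 \<rho>" for y using that tf(6,7) \<rho> by blast+
      have e1: "\<psi> = (\<lambda>y. indicator (cball 0 \<rho>) y * \<psi> y)" and e2: "\<psi>' = (\<lambda>y. indicator (cball 0 \<rho>) y * \<psi>' y)"
        using z by (auto simp: fun_eq_iff indicator_def simp del: mem_cball mem_cball_0)
      show "integrable lborel \<psi>" using integrable_mult_bounded[OF ind _ P(1)] by (subst e1) simp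
      show "integrable lborel \<psi>'" using integrable_mult_bounded[OF ind _ P(2)] by (subst e2) simp
    qed
    \<comment> \<open>Mollification radii will be at most \<delta>, so around points of the support
      K the averaging balls stay in \<Omega>, where the weak gradient is available.\<close>
    obtain \<delta> where \<delta>: "\<delta> > 0" "(\<Union>x\<in>K. cball x \<delta>) \<subseteq> \<Omega>"
      using compact_subset_open_imp_cball_epsilon_subset[OF tf(1) \<Omega> tf(2)] by blast
    define a where "a j = \<delta> / real (Suc j)" for j
    have a: "0 < a j" "a j \<le> \<delta>" for j using \<delta>(1) by (auto simp: a_def divide_le_eq)
    have alim: "a \<longlonglongrightarrow> 0"
      unfolding a_def[abs_def] using tendsto_mult[OF tendsto_const[of \<delta>] LIMSEQ_inverse_real_of_nat] by (simp add: divide_inverse)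
    obtain r :: "nat \<Rightarrow> nat" where r: "strict_mono r" and AE: "AE x in lborel.
      (\<lambda>j. (\<integral>y. \<bar>u y - u x\<bar> * indicator (ball x (2 * a (r j))) y \<partial>lborel) / a (r j) ^ ?n) \<longlonglongrightarrow> 0"
      using Lebesgue_points_subseq[OF u a(1) alim, of 2] by auto
    define t where "t j = a (r j)" for j
    have t: "0 < t j" "t j \<le> \<delta>" for j using a by (auto simp: t_def)
    have tlim: "t \<longlonglongrightarrow> 0" unfolding t_def[abs_def] using LIMSEQ_subseq_LIMSEQ[OF alim r] by (simp add: comp_def)
    define osc where "osc j x = (\<integral>y. \<bar>u y - u x\<bar> * indicator (ball x (2 * t j)) y \<partial>lborel) / t j ^ ?n" for j x
    have AE': "AE x in lborel. (\<lambda>j. osc j x) \<longlonglongrightarrow> 0" using AE by (simp add: osc_def t_def)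
    have osc0: "osc j x \<ge> 0" for j x
      unfolding osc_def using t[of j] by (intro divide_nonneg_nonneg Bochner_Integration.integral_nonneg) auto
    define U where "U j y = ball_avg y (t j) u / ?b" for j y
    have Um [measurable]: "U j \<in> borel_measurable borel" for j
      unfolding U_def[abs_def] using ball_avg_measurable[OF um] by simp
    \<comment> \<open>Stated for all y near z, with the oscillation measured at z: \<Phi> at z
      averages F' (U j y) over such y, so only z has to be a Lebesgue point.\<close>
    have Uclose: "\<bar>U j y - u z\<bar> \<le> osc j z / ?b" if "dist z y < t j" for j y z
    proof -
      have "ball y (t j) \<subseteq> ball z (2 * t j)"
      proof
        fix w assume "w \<in> ball y (t j)"
        then show "w \<in> ball z (2 * t j)" using that dist_triangle[of z w y] by simp
      qed
      then have "\<bar>ball_avg y (t j) u - ?b * u z\<bar> \<le> osc j z"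
        unfolding osc_def by (intro ball_avg_close u t)
      moreover have "U j y - u z = (ball_avg y (t j) u - ?b * u z) / ?b" using b by (simp add: U_def diff_divide_distrib)
      ultimately show ?thesis using b by (simp add: divide_right_mono)
    qed
    define gi where "gi x = g x \<bullet> i" for x
    have gi: "integrable lborel gi" unfolding gi_def[abs_def] using g by (rule integrable_inner_left)
    have gim [measurable]: "gi \<in> borel_measurable borel" using gi by (rule lborel_integrable_borel)
    define G where "G j y = ball_avg y (t j) gi / ?b" for j y
    have Gm [measurable]: "G j \<in> borel_measurable borel" for j
      unfolding G_def[abs_def] using ball_avg_measurable[OF gim] by simp
    have Gb: "\<exists>c. \<forall>y. \<bar>G j y\<bar> \<le> c" for j
    proof (intro exI allI)
      show "\<bar>G j y\<bar> \<le> (\<integral>y. \<bar>gi y\<bar> \<partial>lborel) / t j ^ ?n / ?b" for y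
        using divide_right_mono[OF abs_ball_avg_le[OF gi t(1)[of j], of y] less_imp_le[OF b]] b
        by (simp add: G_def)
    qed
    define f where "f j y = F (U j y) * \<psi> y" for j y
    define f' where "f' j y = F' (U j y) * G j y * \<psi> y + F (U j y) * \<psi>' y" for j y
    \<comment> \<open>On K the mollified u is differentiable with derivative the mollified gradient,
      by \<open>ball_avg_deriv_0\<close> with fixed radius. Off K the product vanishes in a
      neighbourhood, so nothing is asked of balls that leave \<Omega>.\<close>
    have der: "((\<lambda>s. f j (y + s *\<^sub>R i)) has_real_derivative f' j y) (at 0)" for j y
    proof (cases "y \<in> K")
      case True
      then have "cball y (t j) \<subseteq> \<Omega>" using \<delta>(2) t[of j] by (fastforce simp: subset_iff)
      from ball_avg_deriv_0[OF ug t(1)[of j] this, of i 0]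
      have "((\<lambda>s. ball_avg (y + s *\<^sub>R i) (t j) u) has_real_derivative ball_avg y (t j) gi) (at 0)"
        by (simp add: ball_avg_def gi_def)
      then have "((\<lambda>s. U j (y + s *\<^sub>R i)) has_real_derivative G j y) (at 0)"
        unfolding U_def G_def by (rule DERIV_cdivide)
      then have "((\<lambda>s. F (U j (y + s *\<^sub>R i))) has_real_derivative F' (U j (y + 0 *\<^sub>R i)) * G j y) (at 0)"
        by (rule DERIV_chain2[OF F(1)])
      from DERIV_mult[OF this tf(5)[of y]] show ?thesis
        by (simp add: f_def f'_def mult_ac add.commute)
    next
      case False
      have "open (- K)" using tf(1) by (simp add: compact_imp_closed open_Compl)
      then obtain d where d: "d > 0" "ball y d \<subseteq> - K" using False open_contains_ball by (metis ComplI)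
      have "((\<lambda>s. 0 :: real) has_real_derivative 0) (at 0)" by simp
      then have "((\<lambda>s. f j (y + s *\<^sub>R i)) has_real_derivative 0) (at 0)"
      proof (rule has_field_derivative_transform_within_open[where S = "ball 0 d"])
        fix s :: real assume "s \<in> ball 0 d"
        then have "y + s *\<^sub>R i \<in> ball y d" using i by (simp add: dist_norm)
        then show "0 = f j (y + s *\<^sub>R i)" using d(2) tf(6) by (auto simp: f_def)
      qed (use d in auto)
      then show ?thesis using False tf(6,7) by (simp add: f'_def)
    qed
    have if1: "integrable lborel (\<lambda>y. F' (U j y) * G j y * \<psi> y)" for j
    proof -
      obtain c where c: "\<And>y. \<bar>G j y\<bar> \<le> c" using Gb[of j] by blast
      have "\<bar>F' (U j y) * G j y\<bar> \<le> c" for y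
        using mult_mono[OF F'(1)[of "U j y"] c[of y]] by (simp add: abs_mult)
      from integrable_mult_bounded[OF i\<psi> _ this] show ?thesis by (simp add: mult.commute)
    qed
    have if2: "integrable lborel (\<lambda>y. F (U j y) * \<psi>' y)" for j
      using integrable_mult_bounded[OF i\<psi>', of "\<lambda>y. F (U j y)" B] F(3) by (simp add: mult.commute)
    have zero: "(\<integral>y. f' j y \<partial>lborel) = 0" for j
    proof -
      obtain c where c: "\<And>y. \<bar>G j y\<bar> \<le> c" using Gb[of j] by blast
      show ?thesis
      proof (rule integral_directional_derivative_eq_0[OF _ _ der])
        show "integrable lborel (f j)"
          unfolding f_def[abs_def] using integrable_mult_bounded[OF i\<psi>, of "\<lambda>y. F (U j y)" B] F(3) by (simp add: mult.commute)
        show "f j y = 0" if "y \<notin> cball 0 \<rho>" for y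
        proof -
          have "y \<notin> K" using that \<rho> by blast
          then show ?thesis by (simp add: f_def tf(6))
        qed
        show "\<bar>f' j y\<bar> \<le> c * P + B * P" for y
        proof -
          have "\<bar>F' (U j y) * G j y\<bar> \<le> c"
            using mult_mono[OF F'(1)[of "U j y"] c[of y]] by (simp add: abs_mult)
          then have "\<bar>F' (U j y) * G j y * \<psi> y\<bar> \<le> c * P"
            unfolding abs_mult[of _ "\<psi> y"] using P(1)[of y] by (intro mult_mono) auto
          moreover have "\<bar>F (U j y) * \<psi>' y\<bar> \<le> B * P"
            unfolding abs_mult using F(3) P(2)[of y] B0 by (intro mult_mono) auto
          ultimately show ?thesis unfolding f'_def by linarith
        qed
      qed
    qed
    have lim1: "(\<lambda>j. \<integral>y. F (U j y) * \<psi>' y \<partial>lborel) \<longlonglongrightarrow> (\<integral>y. F (u y) * \<psi>' y \<partial>lborel)"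
    proof (rule integral_dominated_convergence[where w = "\<lambda>y. B * \<bar>\<psi>' y\<bar>"])
      show "AE y in lborel. (\<lambda>j. F (U j y) * \<psi>' y) \<longlonglongrightarrow> F (u y) * \<psi>' y"
        using AE'
      proof eventually_elim
        case (elim y)
        have "(\<lambda>j. U j y - u y) \<longlonglongrightarrow> 0"
        proof (rule Lim_null_comparison)
          show "eventually (\<lambda>j. norm (U j y - u y) \<le> osc j y / ?b) sequentially"
            using Uclose[of y y] t by simp
          show "(\<lambda>j. osc j y / ?b) \<longlonglongrightarrow> 0" using tendsto_divide[OF elim tendsto_const[of ?b]] b by simp
        qed
        then have "(\<lambda>j. U j y) \<longlonglongrightarrow> u y" by (simp add: LIM_zero_iff)
        then have "(\<lambda>j. F (U j y)) \<longlonglongrightarrow> F (u y)"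
          using F(1) DERIV_isCont isCont_tendsto_compose by blast
        then show ?case by (intro tendsto_mult tendsto_const)
      qed
      show "AE y in lborel. norm (F (U j y) * \<psi>' y) \<le> B * \<bar>\<psi>' y\<bar>" for j
        using F(3) by (intro always_eventually allI) (simp add: abs_mult mult_right_mono)
    qed (use i\<psi>' in auto)
    define \<Phi> where "\<Phi> j z = ball_avg z (t j) (\<lambda>y. F' (U j y) * \<psi> y) / ?b" for j z
    \<comment> \<open>Fubini and the symmetry of the bump in centre and argument move the mollifier
      from g to the bounded factor F' (U j) * \<psi>. Then g stays fixed and dominated convergence
      applies.\<close>
    have swap: "(\<integral>y. F' (U j y) * G j y * \<psi> y \<partial>lborel) = (\<integral>z. gi z * \<Phi> j z \<partial>lborel)" for j
    proof -
      let ?k = "\<lambda>y z. bump y (t j) z / t j ^ ?n"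
      let ?f = "\<lambda>y z. (F' (U j y) * \<psi> y) * (gi z * ?k y z)"
      note bump_measurable_pair[of "t j", measurable]
      have meas: "(\<lambda>p. ?f (fst p) (snd p)) \<in> borel_measurable ((lborel :: 'a measure) \<Otimes>\<^sub>M (lborel :: 'a measure))"
        by measurable
      have k: "\<bar>?k y z\<bar> \<le> 1 / t j ^ ?n" for y z
        using t(1)[of j] bump_nonneg[of y "t j" z] bump_le_1[of y "t j" z] by (simp add: divide_right_mono)
      have iz: "integrable lborel (\<lambda>z. gi z * ?k y z)" for y
        by (rule integrable_mult_bounded[OF gi _ k]) simp
      have inz: "(\<integral>z. norm (?f y z) \<partial>lborel) = \<bar>F' (U j y) * \<psi> y\<bar> * ball_avg y (t j) (\<lambda>z. \<bar>gi z\<bar>)" for y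
      proof -
        have "\<bar>?f y z\<bar> = \<bar>F' (U j y) * \<psi> y\<bar> * (\<bar>gi z\<bar> * ?k y z)" for z
          using bump_nonneg[of y "t j" z] t(1)[of j] by (simp add: abs_mult)
        then show ?thesis by (simp only: real_norm_def integral_mult_right_zero ball_avg_def)
      qed
      have int: "integrable (lborel \<Otimes>\<^sub>M lborel) (case_prod ?f)"
      proof (rule lborel_pair.Fubini_integrable)
        show "case_prod ?f \<in> borel_measurable (lborel \<Otimes>\<^sub>M lborel)" using meas by (simp add: split_beta')
        have "\<bar>F' (U j y) * ball_avg y (t j) (\<lambda>z. \<bar>gi z\<bar>)\<bar> \<le> (\<integral>z. \<bar>gi z\<bar> \<partial>lborel) / t j ^ ?n" for y
          using mult_mono[OF F'(1)[of "U j y"] abs_ball_avg_le[OF integrable_abs[OF gi] t(1)[of j], of y]] by (simp add: abs_mult)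
        moreover have "(\<lambda>y. F' (U j y) * ball_avg y (t j) (\<lambda>z. \<bar>gi z\<bar>)) \<in> borel_measurable borel"
          using ball_avg_measurable[of "\<lambda>z. \<bar>gi z\<bar>" "t j"] by simp
        ultimately have "integrable lborel (\<lambda>y. \<psi> y * (F' (U j y) * ball_avg y (t j) (\<lambda>z. \<bar>gi z\<bar>)))"
          by (intro integrable_mult_bounded[OF i\<psi>])
        then have "integrable lborel (\<lambda>y. \<bar>\<psi> y * (F' (U j y) * ball_avg y (t j) (\<lambda>z. \<bar>gi z\<bar>))\<bar>)" by (rule integrable_abs)
        moreover have "ball_avg y (t j) (\<lambda>z. \<bar>gi z\<bar>) \<ge> 0" for y
          unfolding ball_avg_def using t(1)[of j]
          by (intro Bochner_Integration.integral_nonneg mult_nonneg_nonneg divide_nonneg_nonneg bump_nonneg) auto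
        ultimately have "integrable lborel (\<lambda>y. \<bar>F' (U j y) * \<psi> y\<bar> * ball_avg y (t j) (\<lambda>z. \<bar>gi z\<bar>))"
          by (simp add: abs_mult mult_ac)
        then show "integrable lborel (\<lambda>y. \<integral>z. norm (case (y, z) of (y, z) \<Rightarrow> ?f y z) \<partial>lborel)"
          unfolding prod.case inz .
        show "AE y in lborel. integrable lborel (\<lambda>z. case (y, z) of (y, z) \<Rightarrow> ?f y z)"
          unfolding prod.case using iz by (intro always_eventually allI integrable_mult_right)
      qed
      have "(\<integral>y. (\<integral>z. ?f y z \<partial>lborel) \<partial>lborel) = (\<integral>z. (\<integral>y. ?f y z \<partial>lborel) \<partial>lborel)"
        using lborel_pair.integral_snd[OF int] lborel_pair.integral_fst[OF int] by simp
      moreover have "(\<integral>z. ?f y z \<partial>lborel) = ?b * (F' (U j y) * G j y * \<psi> y)" for y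
        using b by (simp only: integral_mult_right_zero) (simp add: G_def ball_avg_def)
      moreover have "(\<integral>y. ?f y z \<partial>lborel) = ?b * (gi z * \<Phi> j z)" for z
      proof -
        have "?f y z = gi z * ((F' (U j y) * \<psi> y) * ?k z y)" for y
          by (simp add: bump_commute[of y] mult_ac)
        then show ?thesis using b by (simp only: integral_mult_right_zero) (simp add: \<Phi>_def ball_avg_def)
      qed
      ultimately have "(\<integral>y. ?b * (F' (U j y) * G j y * \<psi> y) \<partial>lborel) = (\<integral>z. ?b * (gi z * \<Phi> j z) \<partial>lborel)"
        by (simp only:)
      then show ?thesis unfolding integral_mult_right_zero using b by simp
    qed
    have \<Phi>m: "\<Phi> j \<in> borel_measurable borel" for j
      unfolding \<Phi>_def[abs_def] using ball_avg_measurable[of "\<lambda>y. F' (U j y) * \<psi> y" "t j"] by simp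
    have F\<psi>b: "\<bar>F' (U j y) * \<psi> y\<bar> \<le> P" for j y
      using mult_mono[OF F'(1)[of "U j y"] P(1)[of y]] by (simp add: abs_mult)
    have \<Phi>close: "\<bar>\<Phi> j z - c\<bar> \<le> \<eta>" if "\<And>y. dist z y < t j \<Longrightarrow> \<bar>F' (U j y) * \<psi> y - c\<bar> \<le> \<eta>" for j z c \<eta>
    proof -
      have "\<bar>ball_avg z (t j) (\<lambda>y. F' (U j y) * \<psi> y) - c * ?b\<bar> \<le> \<eta> * ?b"
        by (rule ball_avg_near_const[OF _ F\<psi>b t(1) that]) measurable
      then have "\<bar>ball_avg z (t j) (\<lambda>y. F' (U j y) * \<psi> y) - c * ?b\<bar> / ?b \<le> \<eta>" using b by (simp add: divide_le_eq)
      moreover have "\<Phi> j z - c = (ball_avg z (t j) (\<lambda>y. F' (U j y) * \<psi> y) - c * ?b) / ?b"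
        using b by (simp add: \<Phi>_def diff_divide_distrib)
      ultimately show ?thesis using b by simp
    qed
    have \<Phi>b: "\<bar>\<Phi> j z\<bar> \<le> P" for j z using \<Phi>close[of z j 0 P] F\<psi>b by simp
    have lim2: "(\<lambda>j. \<integral>z. gi z * \<Phi> j z \<partial>lborel) \<longlonglongrightarrow> (\<integral>z. gi z * (F' (u z) * \<psi> z) \<partial>lborel)"
    proof (rule integral_dominated_convergence[where w = "\<lambda>z. \<bar>gi z\<bar> * P"])
      show "AE z in lborel. (\<lambda>j. gi z * \<Phi> j z) \<longlonglongrightarrow> gi z * (F' (u z) * \<psi> z)"
        using AE'
      proof eventually_elim
        case (elim z)
        have "(\<lambda>j. \<Phi> j z) \<longlonglongrightarrow> F' (u z) * \<psi> z"
        proof (rule tendstoI)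
          fix e :: real assume e: "e > 0"
          have "isCont \<psi> z" using tf(3) by (simp add: continuous_on_eq_continuous_at)
          then obtain d where d: "d > 0" "\<And>y. dist y z < d \<Longrightarrow> dist (\<psi> y) (\<psi> z) < e / 4"
            using e unfolding continuous_at_eps_delta by (metis divide_pos_pos zero_less_numeral)
          have "(\<lambda>j. L * (osc j z / ?b) * P) \<longlonglongrightarrow> L * (0 / ?b) * P" using b by (intro tendsto_intros elim) simp
          then have "eventually (\<lambda>j. L * (osc j z / ?b) * P < e / 4) sequentially"
            using e by (intro order_tendstoD(2)) auto
          moreover have "eventually (\<lambda>j. t j < d) sequentially" using order_tendstoD(2)[OF tlim d(1)] .
          ultimately show "eventually (\<lambda>j. dist (\<Phi> j z) (F' (u z) * \<psi> z) < e) sequentially"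
          proof eventually_elim
            case (elim j)
            have "\<bar>\<Phi> j z - F' (u z) * \<psi> z\<bar> \<le> e / 2"
            proof (rule \<Phi>close)
              fix y assume y: "dist z y < t j"
              have "\<bar>F' (U j y) - F' (u z)\<bar> \<le> L * \<bar>U j y - u z\<bar>" by (rule F'(2))
              also have "\<dots> \<le> L * (osc j z / ?b)" using Uclose[OF y] L0 by (rule mult_left_mono)
              finally have 1: "\<bar>(F' (U j y) - F' (u z)) * \<psi> y\<bar> \<le> L * (osc j z / ?b) * P"
                unfolding abs_mult using P(1)[of y] L0 osc0 b by (intro mult_mono) auto
              have "\<bar>\<psi> y - \<psi> z\<bar> \<le> e / 4" using d(2)[of y] y elim by (simp add: dist_commute dist_real_def)
              then have 2: "\<bar>F' (u z) * (\<psi> y - \<psi> z)\<bar> \<le> 1 * (e / 4)"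
                unfolding abs_mult using F'(1) by (intro mult_mono) auto
              have "F' (U j y) * \<psi> y - F' (u z) * \<psi> z = (F' (U j y) - F' (u z)) * \<psi> y + F' (u z) * (\<psi> y - \<psi> z)"
                by (simp add: algebra_simps)
              then show "\<bar>F' (U j y) * \<psi> y - F' (u z) * \<psi> z\<bar> \<le> e / 2" using 1 2 elim(1) by linarith
            qed
            then show ?case using e by (simp add: dist_real_def)
          qed
        qed
        then show ?case by (intro tendsto_mult tendsto_const)
      qed
      show "AE z in lborel. norm (gi z * \<Phi> j z) \<le> \<bar>gi z\<bar> * P" for j
        using \<Phi>b by (intro always_eventually allI) (simp add: abs_mult mult_left_mono)
    qed (use gi \<Phi>m in auto)
    have "(\<integral>y. F (U j y) * \<psi>' y \<partial>lborel) = - (\<integral>z. gi z * \<Phi> j z \<partial>lborel)" for j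
      using zero[of j] Bochner_Integration.integral_add[OF if1[of j] if2[of j]] swap[of j] by (simp add: f'_def)
    then have "(\<lambda>j. - (\<integral>z. gi z * \<Phi> j z \<partial>lborel)) \<longlonglongrightarrow> (\<integral>y. F (u y) * \<psi>' y \<partial>lborel)" using lim1 by simp
    then have "(\<integral>y. F (u y) * \<psi>' y \<partial>lborel) = - (\<integral>z. gi z * (F' (u z) * \<psi> z) \<partial>lborel)"
      using tendsto_minus[OF lim2] LIMSEQ_unique by blast
    then show ?thesis by (simp add: \<psi>'_def gi_def mult_ac)
  qed
  show ?thesis
    unfolding weak_grad_pair_def using iFu iFg out F(2) main by auto
qed

section \<open>Borel representatives\<close>

text \<open>The bridge between the spaces over \<open>lebesgue_on\<close> \<Omega>, whose elements
  are only Lebesgue measurable, and Borel functions on the whole space extended by zero.\<close>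

definition borel_rep :: "'a::euclidean_space set \<Rightarrow> ('a \<Rightarrow> 'b::euclidean_space) \<Rightarrow> ('a \<Rightarrow> 'b) \<Rightarrow> bool" where
  "borel_rep \<Omega> u v \<longleftrightarrow> v \<in> borel_measurable borel \<and> (\<forall>x. x \<notin> \<Omega> \<longrightarrow> v x = 0) \<and>
     (AE x in lborel. x \<in> \<Omega> \<longrightarrow> v x = u x)"

lemma borel_rep_self:
  "v \<in> borel_measurable borel \<Longrightarrow> (\<And>x. x \<notin> \<Omega> \<Longrightarrow> v x = 0) \<Longrightarrow> borel_rep \<Omega> v v"
  by (simp add: borel_rep_def)

lemma borel_rep_exists_real:
  fixes u :: "'a::euclidean_space \<Rightarrow> real"
  assumes \<Omega>: "open \<Omega>" and u: "u \<in> borel_measurable (lebesgue_on \<Omega>)"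
  shows "\<exists>v. borel_rep \<Omega> u v"
proof -
  have "\<Omega> \<in> sets lebesgue" using \<Omega> sets_completionI_sets[of \<Omega> lborel] by simp
  then have "(\<lambda>x. if x \<in> \<Omega> then u x else 0) \<in> borel_measurable lebesgue"
    using borel_measurable_if u by blast
  then obtain w where w: "w \<in> borel_measurable lborel" "AE x in lborel. (if x \<in> \<Omega> then u x else 0) = w x"
    using completion_ex_borel_measurable_real by blast
  have [measurable]: "w \<in> borel_measurable borel" "\<Omega> \<in> sets borel" using w(1) \<Omega> by auto
  have "borel_rep \<Omega> u (\<lambda>x. indicator \<Omega> x * w x)"
    unfolding borel_rep_def
  proof (intro conjI)
    show "AE x in lborel. x \<in> \<Omega> \<longrightarrow> indicator \<Omega> x * w x = u x"
      using w(2) by eventually_elim auto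
  qed auto
  then show ?thesis by blast
qed

lemma borel_rep_exists:
  fixes u :: "'a::euclidean_space \<Rightarrow> 'b::euclidean_space"
  assumes \<Omega>: "open \<Omega>" and u: "u \<in> borel_measurable (lebesgue_on \<Omega>)"
  shows "\<exists>v. borel_rep \<Omega> u v"
proof -
  have "\<exists>v. borel_rep \<Omega> (\<lambda>x. u x \<bullet> i) v" for i
    using u by (intro borel_rep_exists_real \<Omega>) simp
  then obtain v where v: "\<And>i. borel_rep \<Omega> (\<lambda>x. u x \<bullet> i) (v i)" by metis
  have [measurable]: "v i \<in> borel_measurable borel" for i using v by (simp add: borel_rep_def)
  have "borel_rep \<Omega> u (\<lambda>x. \<Sum>i\<in>Basis. v i x *\<^sub>R i)"
    unfolding borel_rep_def
  proof (intro conjI)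
    have "AE x in lborel. \<forall>i\<in>Basis. x \<in> \<Omega> \<longrightarrow> v i x = u x \<bullet> i"
      using v by (intro AE_finite_allI) (auto simp: borel_rep_def)
    then show "AE x in lborel. x \<in> \<Omega> \<longrightarrow> (\<Sum>i\<in>Basis. v i x *\<^sub>R i) = u x"
      by eventually_elim (simp add: euclidean_representation)
  qed (use v in \<open>auto simp: borel_rep_def\<close>)
  then show ?thesis by blast
qed

lemma borel_rep_integral:
  fixes u v :: "'a::euclidean_space \<Rightarrow> 'b::euclidean_space"
  assumes \<Omega>: "open \<Omega>" and u: "u \<in> borel_measurable (lebesgue_on \<Omega>)" and rep: "borel_rep \<Omega> u v"
  shows "integrable (lebesgue_on \<Omega>) u \<longleftrightarrow> integrable lborel v"
    and "(\<integral>x. u x \<partial>lebesgue_on \<Omega>) = (\<integral>x. v x \<partial>lborel)"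
proof -
  have \<Omega>s: "\<Omega> \<in> sets lebesgue" using \<Omega> sets_completionI_sets[of \<Omega> lborel] by simp
  have v: "v \<in> borel_measurable borel" and v0: "\<And>x. x \<notin> \<Omega> \<Longrightarrow> v x = 0" using rep by (auto simp: borel_rep_def)
  have vl: "v \<in> borel_measurable lebesgue" using v by (intro measurable_completion) simp
  have vr: "v \<in> borel_measurable (lebesgue_on \<Omega>)" using vl by (rule measurable_restrict_space1)
  have "AE x in lebesgue. x \<in> \<Omega> \<longrightarrow> v x = u x" using rep AE_completion by (auto simp: borel_rep_def)
  then have AE: "AE x in lebesgue_on \<Omega>. u x = v x" using \<Omega>s by (simp add: AE_restrict_space_iff eq_commute)
  have ind: "(\<lambda>x. indicator \<Omega> x *\<^sub>R v x) = v" using v0 by (auto simp: indicator_def fun_eq_iff)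
  have "integrable (lebesgue_on \<Omega>) u \<longleftrightarrow> integrable (lebesgue_on \<Omega>) v" by (rule integrable_cong_AE[OF u vr AE])
  also have "\<dots> \<longleftrightarrow> integrable lebesgue v" using \<Omega>s by (subst integrable_restrict_space) (auto simp: ind)
  also have "\<dots> \<longleftrightarrow> integrable lborel v" using v by (intro integrable_completion) simp
  finally show "integrable (lebesgue_on \<Omega>) u \<longleftrightarrow> integrable lborel v" .
  have "(\<integral>x. u x \<partial>lebesgue_on \<Omega>) = (\<integral>x. v x \<partial>lebesgue_on \<Omega>)" by (rule integral_cong_AE[OF u vr AE])
  also have "\<dots> = (\<integral>x. v x \<partial>lebesgue)" using \<Omega>s by (subst integral_restrict_space) (auto simp: ind)
  also have "\<dots> = (\<integral>x. v x \<partial>lborel)" using v by (intro integral_completion) simp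
  finally show "(\<integral>x. u x \<partial>lebesgue_on \<Omega>) = (\<integral>x. v x \<partial>lborel)" .
qed

lemma borel_rep_inner:
  "borel_rep \<Omega> u u' \<Longrightarrow> borel_rep \<Omega> v v' \<Longrightarrow> borel_rep \<Omega> (\<lambda>x. u x \<bullet> v x) (\<lambda>x. u' x \<bullet> v' x)"
  unfolding borel_rep_def by (auto elim: eventually_elim2)

lemma borel_rep_compose:
  fixes h :: "'b::euclidean_space \<Rightarrow> real"
  assumes "borel_rep \<Omega> u v" "h \<in> borel_measurable borel" "h 0 = 0"
  shows "borel_rep \<Omega> (\<lambda>x. h (u x)) (\<lambda>x. h (v x))"
  using assms unfolding borel_rep_def by (auto elim!: eventually_mono)

lemma borel_rep_mult_borel:
  fixes u v f :: "'a::euclidean_space \<Rightarrow> real"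
  assumes "borel_rep \<Omega> u v" "f \<in> borel_measurable borel"
  shows "borel_rep \<Omega> (\<lambda>x. u x * f x) (\<lambda>x. v x * f x)"
  using assms unfolding borel_rep_def by (auto elim!: eventually_mono)

lemma L2_inner_borel_rep:
  fixes u v u' v' :: "'a::euclidean_space \<Rightarrow> 'b::euclidean_space"
  assumes "open \<Omega>" and m: "u \<in> borel_measurable (lebesgue_on \<Omega>)" "v \<in> borel_measurable (lebesgue_on \<Omega>)"
    and r: "borel_rep \<Omega> u u'" "borel_rep \<Omega> v v'"
  shows "L2_inner \<Omega> u v = (\<integral>x. u' x \<bullet> v' x \<partial>lborel)"
  unfolding L2_inner_def
  by (rule borel_rep_integral(2)[OF assms(1) _ borel_rep_inner[OF r]]) (use m in simp)

lemma integrable_if_square_integrable: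
  fixes v :: "'a::euclidean_space \<Rightarrow> 'b::euclidean_space"
  assumes "open \<Omega>" "bounded \<Omega>" and v: "v \<in> borel_measurable borel" "\<And>x. x \<notin> \<Omega> \<Longrightarrow> v x = 0"
    and sq: "integrable lborel (\<lambda>x. (norm (v x))\<^sup>2)"
  shows "integrable lborel v"
proof (rule Bochner_Integration.integrable_bound[where f = "\<lambda>x. indicator \<Omega> x + (norm (v x))\<^sup>2"])
  have "integrable lborel (indicator \<Omega> :: 'a \<Rightarrow> real)"
    using assms by (intro integrable_real_indicator emeasure_bounded_finite) auto
  then show "integrable lborel (\<lambda>x. indicator \<Omega> x + (norm (v x))\<^sup>2)" using sq by simp
  show "AE x in lborel. norm (v x) \<le> norm (indicator \<Omega> x + (norm (v x))\<^sup>2)"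
  proof (intro always_eventually allI)
    fix x
    have "t \<le> 1 + t\<^sup>2" for t :: real
    proof -
      have "0 \<le> (t - 1)\<^sup>2" by simp
      then have "2 * t \<le> 1 + t\<^sup>2" by (simp add: power2_diff)
      then show ?thesis using zero_le_power2[of t] by linarith
    qed
    then show "norm (v x) \<le> norm (indicator \<Omega> x + (norm (v x))\<^sup>2)"
      using v(2)[of x] by (cases "x \<in> \<Omega>") (auto simp: abs_of_nonneg)
  qed
qed (use v in simp)

text \<open>The gradient is carried along explicitly, so the choice made inside
  \<open>weak_grad\<close> does not enter the estimates.\<close>

definition H1_pair :: "'a::euclidean_space set \<Rightarrow> ('a \<Rightarrow> real) \<Rightarrow> ('a \<Rightarrow> 'a) \<Rightarrow> bool" where
  "H1_pair \<Omega> u g \<longleftrightarrow> weak_grad_pair \<Omega> u g \<and> integrable lborel (\<lambda>x. (u x)\<^sup>2) \<and>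
     integrable lborel (\<lambda>x. (norm (g x))\<^sup>2)"

lemma H1_pairD:
  assumes "H1_pair \<Omega> u g"
  shows "weak_grad_pair \<Omega> u g" "integrable lborel u" "integrable lborel g"
    "u \<in> borel_measurable borel" "g \<in> borel_measurable borel"
    "integrable lborel (\<lambda>x. (u x)\<^sup>2)" "integrable lborel (\<lambda>x. (norm (g x))\<^sup>2)"
    "\<And>x. x \<notin> \<Omega> \<Longrightarrow> u x = 0" "\<And>x. x \<notin> \<Omega> \<Longrightarrow> g x = 0"
  using assms borel_measurable_integrable[of lborel u] borel_measurable_integrable[of lborel g]
  by (auto simp: H1_pair_def weak_grad_pair_def)

lemma test_function_measurable:
  fixes \<psi> :: "'a::euclidean_space \<Rightarrow> real"
  assumes "\<psi> \<in> test_functions \<Omega>"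
  shows "\<psi> \<in> borel_measurable borel" "i \<in> Basis \<Longrightarrow> (\<lambda>x. frechet_derivative \<psi> (at x) i) \<in> borel_measurable borel"
proof -
  have C: "Ck k \<psi>" for k using assms by (auto simp: test_functions_def)
  show "\<psi> \<in> borel_measurable borel" using C[of 0] by (intro borel_measurable_continuous_onI) simp
  show "(\<lambda>x. frechet_derivative \<psi> (at x) i) \<in> borel_measurable borel" if "i \<in> Basis"
    using C[of "Suc 0"] that by (intro borel_measurable_continuous_onI) simp
qed

lemma borel_rep_weak_grad:
  fixes \<Omega> :: "'a::euclidean_space set"
  assumes \<Omega>: "open \<Omega>" "bounded \<Omega>" and u: "u \<in> L2_space \<Omega>" and wg: "is_weak_grad \<Omega> u g"
    and ru: "borel_rep \<Omega> u u'" and rg: "borel_rep \<Omega> g g'"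
  shows "H1_pair \<Omega> u' g'"
proof -
  have um: "u \<in> borel_measurable (lebesgue_on \<Omega>)" and u2: "integrable (lebesgue_on \<Omega>) (\<lambda>x. (norm (u x))\<^sup>2)"
    using u by (auto simp: L2_space_def)
  have gm: "g \<in> borel_measurable (lebesgue_on \<Omega>)" and g2: "integrable (lebesgue_on \<Omega>) (\<lambda>x. (norm (g x))\<^sup>2)"
    using wg by (auto simp: L2_space_def is_weak_grad_def)
  have u': "u' \<in> borel_measurable borel" "\<And>x. x \<notin> \<Omega> \<Longrightarrow> u' x = 0" using ru by (auto simp: borel_rep_def)
  have g': "g' \<in> borel_measurable borel" "\<And>x. x \<notin> \<Omega> \<Longrightarrow> g' x = 0" using rg by (auto simp: borel_rep_def)
  have iu2: "integrable lborel (\<lambda>x. (norm (u' x))\<^sup>2)"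
    using borel_rep_integral(1)[OF \<Omega>(1) _ borel_rep_compose[OF ru, of "\<lambda>t. (norm t)\<^sup>2"]] u2 um by simp
  have ig2: "integrable lborel (\<lambda>x. (norm (g' x))\<^sup>2)"
    using borel_rep_integral(1)[OF \<Omega>(1) _ borel_rep_compose[OF rg, of "\<lambda>t. (norm t)\<^sup>2"]] g2 gm by simp
  have iu: "integrable lborel u'" by (rule integrable_if_square_integrable[OF \<Omega> u' iu2])
  have ig: "integrable lborel g'" by (rule integrable_if_square_integrable[OF \<Omega> g' ig2])
  have id: "(\<integral>x. u' x * frechet_derivative \<psi> (at x) i \<partial>lborel) = - (\<integral>x. (g' x \<bullet> i) * \<psi> x \<partial>lborel)"
    if \<psi>: "\<psi> \<in> test_functions \<Omega>" and i: "i \<in> Basis" for \<psi> i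
  proof -
    note m = test_function_measurable[OF \<psi>]
    have ml: "f \<in> borel_measurable (lebesgue_on \<Omega>)" if "f \<in> borel_measurable borel" for f :: "'a \<Rightarrow> real"
      using that by (intro measurable_restrict_space1 measurable_completion) simp
    have "(\<integral>x. u x * frechet_derivative \<psi> (at x) i \<partial>lebesgue_on \<Omega>) = (\<integral>x. u' x * frechet_derivative \<psi> (at x) i \<partial>lborel)"
      by (rule borel_rep_integral(2)[OF \<Omega>(1) _ borel_rep_mult_borel[OF ru m(2)[OF i]]])
         (intro borel_measurable_times um ml m i)
    moreover have "(\<integral>x. (g x \<bullet> i) * \<psi> x \<partial>lebesgue_on \<Omega>) = (\<integral>x. (g' x \<bullet> i) * \<psi> x \<partial>lborel)"
    proof (rule borel_rep_integral(2)[OF \<Omega>(1) _ borel_rep_mult_borel[OF borel_rep_compose[OF rg] m(1)]])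
      show "(\<lambda>x. (g x \<bullet> i) * \<psi> x) \<in> borel_measurable (lebesgue_on \<Omega>)"
        by (intro borel_measurable_times borel_measurable_inner gm ml m) simp
    qed auto
    ultimately show ?thesis using wg \<psi> i by (simp add: is_weak_grad_def)
  qed
  show ?thesis
    unfolding H1_pair_def weak_grad_pair_def using iu ig u'(2) g'(2) id iu2 ig2 by auto
qed

lemma H1_space_borel_rep:
  fixes \<Omega> :: "'a::euclidean_space set"
  assumes \<Omega>: "open \<Omega>" "bounded \<Omega>" and u: "u \<in> H1_space \<Omega>"
  obtains v g where "H1_pair \<Omega> v g" "borel_rep \<Omega> u v" "borel_rep \<Omega> (weak_grad \<Omega> u) g"
    "u \<in> borel_measurable (lebesgue_on \<Omega>)" "weak_grad \<Omega> u \<in> borel_measurable (lebesgue_on \<Omega>)"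
proof -
  have uL: "u \<in> L2_space \<Omega>" and "\<exists>g. is_weak_grad \<Omega> u g" using u by (auto simp: H1_space_def)
  then have wg: "is_weak_grad \<Omega> u (weak_grad \<Omega> u)" unfolding weak_grad_def by (metis someI_ex)
  have um: "u \<in> borel_measurable (lebesgue_on \<Omega>)" using uL by (simp add: L2_space_def)
  have gm: "weak_grad \<Omega> u \<in> borel_measurable (lebesgue_on \<Omega>)" using wg by (simp add: is_weak_grad_def L2_space_def)
  obtain v where v: "borel_rep \<Omega> u v" using borel_rep_exists[OF \<Omega>(1) um] by blast
  obtain g where g: "borel_rep \<Omega> (weak_grad \<Omega> u) g" using borel_rep_exists[OF \<Omega>(1) gm] by blast
  show ?thesis using that[OF borel_rep_weak_grad[OF \<Omega> uL wg v g] v g um gm] .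
qed

text \<open>The components of g - h are orthogonal to all test functions. This identifies the
  arbitrary choice \<open>weak_grad\<close> with a gradient that has been computed.\<close>

lemma weak_grad_pair_unique:
  fixes \<Omega> :: "'a::euclidean_space set"
  assumes \<Omega>: "open \<Omega>" and ug: "weak_grad_pair \<Omega> u g" and uh: "weak_grad_pair \<Omega> u h"
  shows "AE x in lborel. g x = h x"
proof -
  have ig: "integrable lborel g" and ih: "integrable lborel h" using ug uh by (auto simp: weak_grad_pair_def)
  have "AE x in lborel. \<forall>i\<in>Basis. x \<in> \<Omega> \<longrightarrow> (g x - h x) \<bullet> i = 0"
  proof (rule AE_finite_allI)
    fix i :: 'a assume i: "i \<in> Basis"
    show "AE x in lborel. x \<in> \<Omega> \<longrightarrow> (g x - h x) \<bullet> i = 0"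
    proof (rule AE_eq_0_if_orthogonal_test_functions[OF _ \<Omega>])
      show "integrable lborel (\<lambda>x. (g x - h x) \<bullet> i)" using ig ih by simp
      fix \<psi> assume \<psi>: "\<psi> \<in> test_functions \<Omega>"
      obtain B where B: "\<And>y. \<bar>\<psi> y\<bar> \<le> B" using test_function_facts(8)[OF \<psi> i] by blast
      note m = test_function_measurable(1)[OF \<psi>]
      have i1: "integrable lborel (\<lambda>x. (g x \<bullet> i) * \<psi> x)" and i2: "integrable lborel (\<lambda>x. (h x \<bullet> i) * \<psi> x)"
        using ig ih by (auto intro!: integrable_mult_bounded[OF _ m B])
      have "(\<integral>x. ((g x - h x) \<bullet> i) * \<psi> x \<partial>lborel) = (\<integral>x. (g x \<bullet> i) * \<psi> x \<partial>lborel) - (\<integral>x. (h x \<bullet> i) * \<psi> x \<partial>lborel)"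
        unfolding inner_diff_left left_diff_distrib by (rule Bochner_Integration.integral_diff[OF i1 i2])
      also have "\<dots> = 0"
      proof -
        have "(\<integral>x. u x * frechet_derivative \<psi> (at x) i \<partial>lborel) = - (\<integral>x. (g x \<bullet> i) * \<psi> x \<partial>lborel)"
          using ug \<psi> i by (simp add: weak_grad_pair_def)
        moreover have "(\<integral>x. u x * frechet_derivative \<psi> (at x) i \<partial>lborel) = - (\<integral>x. (h x \<bullet> i) * \<psi> x \<partial>lborel)"
          using uh \<psi> i by (simp add: weak_grad_pair_def)
        ultimately show ?thesis by linarith
      qed
      finally show "(\<integral>x. ((g x - h x) \<bullet> i) * \<psi> x \<partial>lborel) = 0" .
    qed
  qed simp
  then show ?thesis
  proof eventually_elim
    case (elim x)
    show ?case
    proof (cases "x \<in> \<Omega>")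
      case True
      then have "g x - h x = 0" using elim by (intro euclidean_eqI[of "g x - h x" 0]) auto
      then show ?thesis by simp
    next
      case False
      then show ?thesis using ug uh by (simp add: weak_grad_pair_def)
    qed
  qed
qed

text \<open>What makes a constructed pair usable as a test function: not only is u in the Sobolev
  space, but the chosen \<open>weak_grad\<close> in the weak formulation is represented by the given
  g.\<close>

lemma H1_pair_imp_H1_space:
  fixes \<Omega> :: "'a::euclidean_space set"
  assumes \<Omega>: "open \<Omega>" "bounded \<Omega>" and ug: "H1_pair \<Omega> u g"
  shows "u \<in> H1_space \<Omega>" "borel_rep \<Omega> u u" "borel_rep \<Omega> (weak_grad \<Omega> u) g"
    "u \<in> borel_measurable (lebesgue_on \<Omega>)" "weak_grad \<Omega> u \<in> borel_measurable (lebesgue_on \<Omega>)"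
proof -
  note D = H1_pairD[OF ug]
  show ru: "borel_rep \<Omega> u u" using D by (intro borel_rep_self)
  have rg: "borel_rep \<Omega> g g" using D by (intro borel_rep_self)
  have ml: "f \<in> borel_measurable (lebesgue_on \<Omega>)" if "f \<in> borel_measurable borel" for f :: "'a \<Rightarrow> 'b::euclidean_space"
    using that by (intro measurable_restrict_space1 measurable_completion) simp
  show um: "u \<in> borel_measurable (lebesgue_on \<Omega>)" using ml[OF D(4)] .
  have gm: "g \<in> borel_measurable (lebesgue_on \<Omega>)" using ml[OF D(5)] .
  have u2: "integrable (lebesgue_on \<Omega>) (\<lambda>x. (norm (u x))\<^sup>2)"
    using borel_rep_integral(1)[OF \<Omega>(1) _ borel_rep_compose[OF ru, of "\<lambda>t. (norm t)\<^sup>2"]] D(6) um by simp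
  have g2: "integrable (lebesgue_on \<Omega>) (\<lambda>x. (norm (g x))\<^sup>2)"
    using borel_rep_integral(1)[OF \<Omega>(1) _ borel_rep_compose[OF rg, of "\<lambda>t. (norm t)\<^sup>2"]] D(7) gm by simp
  have uL: "u \<in> L2_space \<Omega>" using um u2 by (simp add: L2_space_def)
  have "is_weak_grad \<Omega> u g"
    unfolding is_weak_grad_def
  proof (intro conjI ballI)
    show "g \<in> L2_space \<Omega>" using gm g2 by (simp add: L2_space_def)
    fix \<psi> and i :: 'a assume \<psi>: "\<psi> \<in> test_functions \<Omega>" and i: "i \<in> Basis"
    note m = test_function_measurable[OF \<psi>]
    have "(\<integral>x. u x * frechet_derivative \<psi> (at x) i \<partial>lebesgue_on \<Omega>) = (\<integral>x. u x * frechet_derivative \<psi> (at x) i \<partial>lborel)"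
      by (rule borel_rep_integral(2)[OF \<Omega>(1) _ borel_rep_mult_borel[OF ru m(2)[OF i]]])
         (intro borel_measurable_times um ml m i)
    moreover have "(\<integral>x. (g x \<bullet> i) * \<psi> x \<partial>lebesgue_on \<Omega>) = (\<integral>x. (g x \<bullet> i) * \<psi> x \<partial>lborel)"
    proof (rule borel_rep_integral(2)[OF \<Omega>(1) _ borel_rep_mult_borel[OF borel_rep_compose[OF rg] m(1)]])
      show "(\<lambda>x. (g x \<bullet> i) * \<psi> x) \<in> borel_measurable (lebesgue_on \<Omega>)"
        by (intro borel_measurable_times borel_measurable_inner gm ml m) simp
    qed auto
    ultimately show "(\<integral>x. u x * frechet_derivative \<psi> (at x) i \<partial>lebesgue_on \<Omega>) = - (\<integral>x. (g x \<bullet> i) * \<psi> x \<partial>lebesgue_on \<Omega>)"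
      using D(1) \<psi> i by (simp add: weak_grad_pair_def)
  qed
  then show H: "u \<in> H1_space \<Omega>" using uL by (auto simp: H1_space_def)
  \<comment> \<open>Here h represents the chosen gradient. Since v = u almost everywhere, h is also
    a weak gradient of u, and uniqueness identifies it with g.\<close>
  obtain v h where vh: "H1_pair \<Omega> v h" "borel_rep \<Omega> u v" "borel_rep \<Omega> (weak_grad \<Omega> u) h"
    "weak_grad \<Omega> u \<in> borel_measurable (lebesgue_on \<Omega>)"
    using H1_space_borel_rep[OF \<Omega> H] by metis
  then show "weak_grad \<Omega> u \<in> borel_measurable (lebesgue_on \<Omega>)" by simp
  have vu: "AE x in lborel. v x = u x"
    using vh(2) D(8) unfolding borel_rep_def by (auto elim!: eventually_mono)
  have eq: "(\<integral>x. u x * f x \<partial>lborel) = (\<integral>x. v x * f x \<partial>lborel)" if "f \<in> borel_measurable borel" for f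
    using vu that D(4) H1_pairD(4)[OF vh(1)] by (intro integral_cong_AE) (auto elim: eventually_mono)
  have "weak_grad_pair \<Omega> u h"
    unfolding weak_grad_pair_def
  proof (intro conjI ballI allI impI)
    fix \<psi> and i :: 'a assume \<psi>: "\<psi> \<in> test_functions \<Omega>" and i: "i \<in> Basis"
    show "(\<integral>x. u x * frechet_derivative \<psi> (at x) i \<partial>lborel) = - (\<integral>x. (h x \<bullet> i) * \<psi> x \<partial>lborel)"
      using H1_pairD(1)[OF vh(1)] \<psi> i eq[OF test_function_measurable(2)[OF \<psi> i]] by (simp add: weak_grad_pair_def)
  qed (use D(2,8) H1_pairD(3,9)[OF vh(1)] in auto)
  from weak_grad_pair_unique[OF \<Omega>(1) D(1) this]
  have "AE x in lborel. g x = h x" .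
  then have "AE x in lborel. x \<in> \<Omega> \<longrightarrow> g x = weak_grad \<Omega> u x"
    using vh(3) unfolding borel_rep_def by (auto elim: eventually_elim2)
  then show "borel_rep \<Omega> (weak_grad \<Omega> u) g" using D by (simp add: borel_rep_def)
qed

section \<open>Sobolev functions and potentials\<close>

lemma integrable_mult_L2:
  fixes f g :: "'a::euclidean_space \<Rightarrow> real"
  assumes [measurable]: "f \<in> borel_measurable borel" "g \<in> borel_measurable borel"
    and sq: "integrable lborel (\<lambda>x. (f x)\<^sup>2)" "integrable lborel (\<lambda>x. (g x)\<^sup>2)"
  shows "integrable lborel (\<lambda>x. f x * g x)"
proof (rule Bochner_Integration.integrable_bound[where f = "\<lambda>x. (f x)\<^sup>2 + (g x)\<^sup>2"])
  show "AE x in lborel. norm (f x * g x) \<le> norm ((f x)\<^sup>2 + (g x)\<^sup>2)"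
  proof (intro always_eventually allI)
    fix x
    have "0 \<le> (\<bar>f x\<bar> - \<bar>g x\<bar>)\<^sup>2" by simp
    then have "2 * (\<bar>f x\<bar> * \<bar>g x\<bar>) \<le> (f x)\<^sup>2 + (g x)\<^sup>2" by (simp add: power2_diff)
    moreover have "0 \<le> \<bar>f x\<bar> * \<bar>g x\<bar>" by simp
    ultimately have "\<bar>f x\<bar> * \<bar>g x\<bar> \<le> (f x)\<^sup>2 + (g x)\<^sup>2" by linarith
    then show "norm (f x * g x) \<le> norm ((f x)\<^sup>2 + (g x)\<^sup>2)" by (simp add: abs_mult)
  qed
qed (use sq in auto)

lemma integral_Young:
  fixes f g :: "'a::euclidean_space \<Rightarrow> real"
  assumes m: "f \<in> borel_measurable borel" "g \<in> borel_measurable borel"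
    and sq: "integrable lborel (\<lambda>x. (f x)\<^sup>2)" "integrable lborel (\<lambda>x. (g x)\<^sup>2)" and l: "l > 0"
  shows "\<bar>\<integral>x. f x * g x \<partial>lborel\<bar> \<le> l / 2 * (\<integral>x. (f x)\<^sup>2 \<partial>lborel) + 1 / (2 * l) * (\<integral>x. (g x)\<^sup>2 \<partial>lborel)"
proof -
  have "\<bar>\<integral>x. f x * g x \<partial>lborel\<bar> \<le> (\<integral>x. l / 2 * (f x)\<^sup>2 + 1 / (2 * l) * (g x)\<^sup>2 \<partial>lborel)"
  proof (rule integral_abs_bound_integral[OF integrable_mult_L2[OF m sq]])
    show "integrable lborel (\<lambda>x. l / 2 * (f x)\<^sup>2 + 1 / (2 * l) * (g x)\<^sup>2)" using sq by simp
  qed (rule Young_real[OF l])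
  also have "\<dots> = l / 2 * (\<integral>x. (f x)\<^sup>2 \<partial>lborel) + 1 / (2 * l) * (\<integral>x. (g x)\<^sup>2 \<partial>lborel)"
    using Bochner_Integration.integral_add[OF integrable_mult_right[OF sq(1), of "l / 2"] integrable_mult_right[OF sq(2), of "1 / (2 * l)"]]
    by (simp only: integral_mult_right_zero)
  finally show ?thesis .
qed

lemma integrable_power2_add:
  fixes f g :: "'a::euclidean_space \<Rightarrow> 'b::euclidean_space"
  assumes [measurable]: "f \<in> borel_measurable borel" "g \<in> borel_measurable borel"
    and sq: "integrable lborel (\<lambda>x. (norm (f x))\<^sup>2)" "integrable lborel (\<lambda>x. (norm (g x))\<^sup>2)"
  shows "integrable lborel (\<lambda>x. (norm (f x + g x))\<^sup>2)"
proof (rule Bochner_Integration.integrable_bound[where f = "\<lambda>x. 2 * (norm (f x))\<^sup>2 + 2 * (norm (g x))\<^sup>2"])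
  show "AE x in lborel. norm ((norm (f x + g x))\<^sup>2) \<le> norm (2 * (norm (f x))\<^sup>2 + 2 * (norm (g x))\<^sup>2)"
  proof (intro always_eventually allI)
    fix x
    have "(norm (f x + g x))\<^sup>2 \<le> (norm (f x) + norm (g x))\<^sup>2"
      by (intro power_mono norm_triangle_ineq) auto
    also have "\<dots> \<le> 2 * (norm (f x))\<^sup>2 + 2 * (norm (g x))\<^sup>2"
      using zero_le_power2[of "norm (f x) - norm (g x)"] by (simp add: power2_sum power2_diff)
    finally show "norm ((norm (f x + g x))\<^sup>2) \<le> norm (2 * (norm (f x))\<^sup>2 + 2 * (norm (g x))\<^sup>2)" by simp
  qed
qed (use sq in auto)

lemma H1_pair_add_cmult:
  assumes u: "H1_pair \<Omega> u g" and v: "H1_pair \<Omega> v h"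
  shows "H1_pair \<Omega> (\<lambda>x. u x + c * v x) (\<lambda>x. g x + c *\<^sub>R h x)"
proof -
  note U = H1_pairD[OF u] and V = H1_pairD[OF v]
  note [measurable] = U(4,5) V(4,5)
  have "(\<integral>x. (u x + c * v x) * frechet_derivative \<psi> (at x) i \<partial>lborel) = - (\<integral>x. ((g x + c *\<^sub>R h x) \<bullet> i) * \<psi> x \<partial>lborel)"
    if \<psi>: "\<psi> \<in> test_functions \<Omega>" and i: "i \<in> Basis" for \<psi> i
  proof -
    obtain B where B: "\<And>y. \<bar>\<psi> y\<bar> \<le> B" "\<And>y. \<bar>frechet_derivative \<psi> (at y) i\<bar> \<le> B"
      using test_function_facts(8)[OF \<psi> i] by blast
    note m = test_function_measurable[OF \<psi>]
    have i1: "integrable lborel (\<lambda>x. u x * frechet_derivative \<psi> (at x) i)" "integrable lborel (\<lambda>x. v x * frechet_derivative \<psi> (at x) i)"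
      using U(2) V(2) by (auto intro!: integrable_mult_bounded[OF _ m(2)[OF i] B(2)])
    have i2: "integrable lborel (\<lambda>x. (g x \<bullet> i) * \<psi> x)" "integrable lborel (\<lambda>x. (h x \<bullet> i) * \<psi> x)"
      using U(3) V(3) by (auto intro!: integrable_mult_bounded[OF _ m(1) B(1)])
    have "(\<integral>x. (u x + c * v x) * frechet_derivative \<psi> (at x) i \<partial>lborel)
      = (\<integral>x. u x * frechet_derivative \<psi> (at x) i + c * (v x * frechet_derivative \<psi> (at x) i) \<partial>lborel)"
      by (simp add: algebra_simps)
    also have "\<dots> = (\<integral>x. u x * frechet_derivative \<psi> (at x) i \<partial>lborel) + c * (\<integral>x. v x * frechet_derivative \<psi> (at x) i \<partial>lborel)"
      using i1 by simp
    also have "\<dots> = - ((\<integral>x. (g x \<bullet> i) * \<psi> x \<partial>lborel) + c * (\<integral>x. (h x \<bullet> i) * \<psi> x \<partial>lborel))"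
      using U(1) V(1) \<psi> i by (simp add: weak_grad_pair_def)
    also have "(\<integral>x. (g x \<bullet> i) * \<psi> x \<partial>lborel) + c * (\<integral>x. (h x \<bullet> i) * \<psi> x \<partial>lborel)
      = (\<integral>x. (g x \<bullet> i) * \<psi> x + c * ((h x \<bullet> i) * \<psi> x) \<partial>lborel)" using i2 by simp
    also have "\<dots> = (\<integral>x. ((g x + c *\<^sub>R h x) \<bullet> i) * \<psi> x \<partial>lborel)" by (simp add: inner_add_left algebra_simps)
    finally show ?thesis .
  qed
  moreover have "integrable lborel (\<lambda>x. (norm (u x + c * v x))\<^sup>2)"
    using U(6) V(6) by (intro integrable_power2_add) (auto simp: power_mult_distrib)
  moreover have "integrable lborel (\<lambda>x. (norm (g x + c *\<^sub>R h x))\<^sup>2)"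
    using U(7) V(7) by (intro integrable_power2_add) (auto simp: power_mult_distrib)
  ultimately show ?thesis
    unfolding H1_pair_def weak_grad_pair_def using U V by auto
qed

text \<open>The constant 1 under the convention of vanishing off \<Omega>. Its weak gradient is 0
  because partial derivatives of test functions integrate to 0. Testing with it gives the balance of
  means.\<close>

lemma H1_pair_indicator:
  fixes \<Omega> :: "'a::euclidean_space set"
  assumes \<Omega>: "open \<Omega>" "bounded \<Omega>"
  shows "H1_pair \<Omega> (indicator \<Omega>) (\<lambda>x. 0)"
proof -
  have [measurable]: "\<Omega> \<in> sets borel" using \<Omega> by simp
  have i1: "integrable lborel (indicator \<Omega> :: 'a \<Rightarrow> real)"
    using \<Omega> by (intro integrable_real_indicator emeasure_bounded_finite) auto
  have sq: "(indicator \<Omega> x)\<^sup>2 = (indicator \<Omega> x :: real)" for x by (simp add: indicator_def)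
  have "(\<integral>x. indicator \<Omega> x * frechet_derivative \<psi> (at x) i \<partial>lborel) = 0"
    if \<psi>: "\<psi> \<in> test_functions \<Omega>" and i: "i \<in> Basis" for \<psi> i
  proof -
    note tf = test_function_facts[OF \<psi> i]
    obtain B where B: "\<And>y. \<bar>\<psi> y\<bar> \<le> B" "\<And>y. \<bar>frechet_derivative \<psi> (at y) i\<bar> \<le> B"
      using tf(8) by blast
    obtain \<rho> where \<rho>: "closure {x. \<psi> x \<noteq> 0} \<subseteq> cball 0 \<rho>"
      using compact_imp_bounded[OF tf(1)] by (auto simp: bounded_iff subset_iff)
    have z: "\<psi> y = 0" if "y \<notin> \<Omega>" for y using that tf(2,6) by blast
    have z': "\<psi> y = 0" if "y \<notin> cball 0 \<rho>" for y using that tf(6) \<rho> by blast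
    have "(\<lambda>y. indicator \<Omega> y * \<psi> y) = \<psi>" using z by (auto simp: fun_eq_iff indicator_def)
    then have i\<psi>: "integrable lborel \<psi>"
      using integrable_mult_bounded[OF i1 test_function_measurable(1)[OF \<psi>] B(1)] by simp
    have "(\<integral>x. frechet_derivative \<psi> (at x) i \<partial>lborel) = 0"
      by (rule integral_directional_derivative_eq_0[OF i\<psi> z' tf(5) B(2)])
    moreover have "(\<lambda>y. indicator \<Omega> y * frechet_derivative \<psi> (at y) i) = (\<lambda>y. frechet_derivative \<psi> (at y) i)"
    proof
      fix y show "indicator \<Omega> y * frechet_derivative \<psi> (at y) i = frechet_derivative \<psi> (at y) i"
        using tf(2) tf(7)[of y] by (cases "y \<in> \<Omega>") auto
    qed
    ultimately show ?thesis by simp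
  qed
  then show ?thesis
    unfolding H1_pair_def weak_grad_pair_def using i1 by (auto simp: sq)
qed

text \<open>The two sides differ by (d - c)^2 times the measure of \<Omega>. It permits replacing
  the constant m of \<open>pointwise_Poincare\<close> by the mean.\<close>

lemma L2_mean_minimal:
  fixes u :: "'a::euclidean_space \<Rightarrow> real"
  assumes \<Omega>: "\<Omega> \<in> sets borel" "emeasure lborel \<Omega> < \<infinity>" "measure lborel \<Omega> > 0"
    and u: "integrable lborel u" "integrable lborel (\<lambda>x. (u x)\<^sup>2)" "\<And>x. x \<notin> \<Omega> \<Longrightarrow> u x = 0"
  defines "c \<equiv> (\<integral>x. u x \<partial>lborel) / measure lborel \<Omega>"
  shows "(\<integral>x. (u x - c * indicator \<Omega> x)\<^sup>2 \<partial>lborel) \<le> (\<integral>x. (u x - d * indicator \<Omega> x)\<^sup>2 \<partial>lborel)"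
proof -
  have i: "integrable lborel (indicator \<Omega> :: 'a \<Rightarrow> real)" using \<Omega> by (intro integrable_real_indicator) auto
  have eq: "(\<integral>x. (u x - d * indicator \<Omega> x)\<^sup>2 \<partial>lborel)
    = (\<integral>x. (u x)\<^sup>2 \<partial>lborel) - 2 * d * (\<integral>x. u x \<partial>lborel) + d\<^sup>2 * measure lborel \<Omega>" for d
  proof -
    have "(u x - d * indicator \<Omega> x)\<^sup>2 = (u x)\<^sup>2 - 2 * d * u x + d\<^sup>2 * indicator \<Omega> x" for x
      using u(3)[of x] by (cases "x \<in> \<Omega>") (auto simp: power2_diff)
    then show ?thesis using u(1,2) i \<Omega> by simp
  qed
  have m: "(\<integral>x. u x \<partial>lborel) = c * measure lborel \<Omega>" using \<Omega>(3) by (simp add: c_def)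
  have "0 \<le> (d - c)\<^sup>2 * measure lborel \<Omega>" by simp
  also have "(d - c)\<^sup>2 * measure lborel \<Omega> = d\<^sup>2 * measure lborel \<Omega> - 2 * d * (c * measure lborel \<Omega>) + c\<^sup>2 * measure lborel \<Omega>"
    by (simp add: power2_diff algebra_simps)
  finally show ?thesis unfolding eq m by (simp add: power2_eq_square algebra_simps)
qed

lemma dyadic_potential_measurable:
  fixes h :: "'a::euclidean_space \<Rightarrow> real"
  assumes [measurable]: "h \<in> borel_measurable borel"
  shows "dyadic_potential R h \<in> borel_measurable borel"
proof -
  note [measurable] = dyadic_kernel_measurable_pair
  have "(\<lambda>p. dyadic_kernel R (fst p) (snd p) * ennreal (h (snd p))) \<in> borel_measurable ((lborel :: 'a measure) \<Otimes>\<^sub>M (lborel :: 'a measure))"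
    by measurable
  then have "(\<lambda>x. \<integral>\<^sup>+y. dyadic_kernel R x y * ennreal (h y) \<partial>lborel) \<in> borel_measurable lborel"
    by (intro lborel.borel_measurable_nn_integral) (simp add: split_beta')
  then show ?thesis by (simp add: dyadic_potential_def[abs_def])
qed

lemma dyadic_potential_add:
  assumes "f \<in> borel_measurable borel" "g \<in> borel_measurable borel" "\<And>y. 0 \<le> f y" "\<And>y. 0 \<le> g y"
  shows "dyadic_potential R (\<lambda>y. f y + g y) x = dyadic_potential R f x + dyadic_potential R g x"
proof -
  note [measurable] = assms(1,2)
  show ?thesis
    unfolding dyadic_potential_def using assms(3,4)
    by (subst nn_integral_add[symmetric]) (auto simp: distrib_left)
qed

text \<open>Schur's test for a function v dominated by a potential of b, brought back from
  \<open>ennreal\<close> to real integrals; square integrability makes all the integrals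
  finite.\<close>

lemma integral_le_Schur:
  fixes a b v :: "'a::euclidean_space \<Rightarrow> real"
  assumes A: "A \<in> sets borel"
    and m: "a \<in> borel_measurable borel" "b \<in> borel_measurable borel" "v \<in> borel_measurable borel"
    and sq: "integrable lborel (\<lambda>x. (a x)\<^sup>2)" "integrable lborel (\<lambda>x. (b x)\<^sup>2)" "integrable lborel (\<lambda>x. (v x)\<^sup>2)"
    and M: "M \<ge> 0" "\<And>x. (\<integral>\<^sup>+y. dyadic_kernel R x y * indicator A y \<partial>lborel) \<le> ennreal M"
    and l: "l > 0" and C: "C \<ge> 0"
    and v: "\<And>x. x \<notin> A \<Longrightarrow> v x = 0"
      "AE x in lborel. x \<in> A \<longrightarrow> ennreal \<bar>v x\<bar> \<le> ennreal C * dyadic_potential R (\<lambda>y. \<bar>b y\<bar> * indicator A y) x"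
  shows "(\<integral>x. \<bar>a x\<bar> * \<bar>v x\<bar> \<partial>lborel) \<le> C * (M / 2) * (l * (\<integral>x. (a x)\<^sup>2 \<partial>lborel) + 1 / l * (\<integral>x. (b x)\<^sup>2 \<partial>lborel))"
proof -
  note [measurable] = A m
  let ?pot = "dyadic_potential R (\<lambda>y. \<bar>b y\<bar> * indicator A y)"
  have [measurable]: "?pot \<in> borel_measurable borel" by (rule dyadic_potential_measurable) measurable
  have iav: "integrable lborel (\<lambda>x. \<bar>a x\<bar> * \<bar>v x\<bar>)"
    using integrable_abs[OF integrable_mult_L2[OF m(1,3) sq(1,3)]] by (simp add: abs_mult)
  have le: "(\<integral>\<^sup>+x. ennreal ((w x)\<^sup>2 * indicator A x) \<partial>lborel) \<le> ennreal (\<integral>x. (w x)\<^sup>2 \<partial>lborel)"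
    if "integrable lborel (\<lambda>x. (w x)\<^sup>2)" for w :: "'a \<Rightarrow> real"
  proof -
    have "(\<integral>\<^sup>+x. ennreal ((w x)\<^sup>2 * indicator A x) \<partial>lborel) \<le> (\<integral>\<^sup>+x. ennreal ((w x)\<^sup>2) \<partial>lborel)"
      by (intro nn_integral_mono ennreal_leI) (auto simp: indicator_def)
    then show ?thesis using nn_integral_eq_integral[OF that] by simp
  qed
  have "ennreal (\<integral>x. \<bar>a x\<bar> * \<bar>v x\<bar> \<partial>lborel) = (\<integral>\<^sup>+x. ennreal (\<bar>a x\<bar> * \<bar>v x\<bar>) \<partial>lborel)"
    using iav by (intro nn_integral_eq_integral[symmetric]) auto
  also have "\<dots> \<le> (\<integral>\<^sup>+x. ennreal C * (ennreal (\<bar>a x\<bar> * indicator A x) * ?pot x) \<partial>lborel)"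
  proof (rule nn_integral_mono_AE)
    show "AE x in lborel. ennreal (\<bar>a x\<bar> * \<bar>v x\<bar>) \<le> ennreal C * (ennreal (\<bar>a x\<bar> * indicator A x) * ?pot x)"
      using v(2)
    proof eventually_elim
      case (elim x)
      show ?case
      proof (cases "x \<in> A")
        case True
        then have "ennreal \<bar>a x\<bar> * ennreal \<bar>v x\<bar> \<le> ennreal \<bar>a x\<bar> * (ennreal C * ?pot x)"
          using elim by (intro mult_left_mono) auto
        then show ?thesis using True by (simp add: ennreal_mult' mult_ac)
      qed (use v(1) in simp)
    qed
  qed
  also have "\<dots> = ennreal C * (\<integral>\<^sup>+x. ennreal (\<bar>a x\<bar> * indicator A x) * ?pot x \<partial>lborel)"
    by (rule nn_integral_cmult) measurable
  also have "\<dots> \<le> ennreal C * (ennreal (M / 2) * (ennreal l * (\<integral>\<^sup>+x. ennreal ((a x)\<^sup>2 * indicator A x) \<partial>lborel)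
        + ennreal (1 / l) * (\<integral>\<^sup>+x. ennreal ((b x)\<^sup>2 * indicator A x) \<partial>lborel)))"
    by (intro mult_left_mono Schur_dyadic A m M l) auto
  also have "\<dots> \<le> ennreal C * (ennreal (M / 2) * (ennreal l * ennreal (\<integral>x. (a x)\<^sup>2 \<partial>lborel)
        + ennreal (1 / l) * ennreal (\<integral>x. (b x)\<^sup>2 \<partial>lborel)))"
    by (intro mult_left_mono add_mono le sq) auto
  also have "\<dots> = ennreal (C * (M / 2) * (l * (\<integral>x. (a x)\<^sup>2 \<partial>lborel) + 1 / l * (\<integral>x. (b x)\<^sup>2 \<partial>lborel)))"
  proof -
    have "0 \<le> (\<integral>x. (a x)\<^sup>2 \<partial>lborel)" "0 \<le> (\<integral>x. (b x)\<^sup>2 \<partial>lborel)" by (auto intro: Bochner_Integration.integral_nonneg)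
    moreover have "ennreal c * (ennreal k * (ennreal l * ennreal p + ennreal q * ennreal t)) = ennreal (c * k * (l * p + q * t))"
      if "0 \<le> c" "0 \<le> k" "0 \<le> l" "0 \<le> p" "0 \<le> q" "0 \<le> t" for c k l p q t :: real
      using that by (simp add: ennreal_mult'[symmetric] ennreal_plus[symmetric] mult.assoc del: ennreal_plus)
    ultimately show ?thesis using C M(1) l by simp
  qed
  finally show ?thesis
    using C M(1) l by (subst (asm) ennreal_le_iff)
      (auto intro!: mult_nonneg_nonneg add_nonneg_nonneg Bochner_Integration.integral_nonneg)
qed

text \<open>For u living on A, |u| is bounded by a potential of b = |u| + |g|: the gradient pays for
  u - m, and |u| pays for m since the kernel is at least 1 on \<Omega>. As b also lives on A,
  Schur's test runs over A alone and its row integrals bring the factor |A| powr \<theta>. The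
  constant does not depend on A, a or l.\<close>

lemma H1_Schur_bound:
  fixes \<Omega> :: "'a::euclidean_space set"
  assumes \<Omega>: "open \<Omega>" "connected \<Omega>" "\<Omega> \<noteq> {}" "bounded \<Omega>" "cone_condition \<Omega>"
    and \<theta>: "0 < \<theta>" "\<theta> < 1 / real DIM('a)"
  shows "\<exists>C>0. \<forall>u g a A l. H1_pair \<Omega> u g \<longrightarrow> A \<in> sets borel \<longrightarrow> A \<subseteq> \<Omega> \<longrightarrow>
    (\<forall>x. x \<notin> A \<longrightarrow> u x = 0 \<and> g x = 0) \<longrightarrow> a \<in> borel_measurable borel \<longrightarrow>
    integrable lborel (\<lambda>x. (a x)\<^sup>2) \<longrightarrow> l > 0 \<longrightarrow>
    (\<integral>x. \<bar>a x\<bar> * \<bar>u x\<bar> \<partial>lborel) \<le> C * measure lborel A powr \<theta> * (l * (\<integral>x. (a x)\<^sup>2 \<partial>lborel)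
      + 1 / l * ((\<integral>x. (u x)\<^sup>2 \<partial>lborel) + (\<integral>x. (norm (g x))\<^sup>2 \<partial>lborel)))"
proof -
  obtain R C0 where R: "R > 0" and C0: "C0 > 0" and PP: "\<And>u g. weak_grad_pair \<Omega> u g \<Longrightarrow>
    (\<exists>m. \<bar>m\<bar> \<le> C0 * (\<integral>y. \<bar>u y\<bar> \<partial>lborel) \<and>
      (AE x in lborel. x \<in> \<Omega> \<longrightarrow>
        (\<forall>y\<in>\<Omega>. 1 \<le> dyadic_kernel R x y) \<and>
        ennreal \<bar>u x - m\<bar> \<le> ennreal C0 * dyadic_potential R (\<lambda>y. norm (g y)) x))"
    using pointwise_Poincare[OF \<Omega>] by blast
  obtain Ck where Ck: "Ck \<ge> 0" "\<And>A (x::'a). A \<in> sets borel \<Longrightarrow> emeasure lborel A < \<infinity> \<Longrightarrow>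
    (\<integral>\<^sup>+y. dyadic_kernel R x y * indicator A y \<partial>lborel) \<le> ennreal (Ck * measure lborel A powr \<theta>)"
    using dyadic_kernel_integral_le[OF \<theta> R] by blast
  show ?thesis
  \<comment> \<open>The summand 1 only makes the constant positive when Ck = 0.\<close>
  proof (intro exI[of _ "C0 * (Ck + 1)"] conjI allI impI)
    show "0 < C0 * (Ck + 1)" using C0 Ck(1) by simp
    fix u a :: "'a \<Rightarrow> real" and g :: "'a \<Rightarrow> 'a" and A :: "'a set" and l :: real
    assume ug: "H1_pair \<Omega> u g" and A: "A \<in> sets borel" "A \<subseteq> \<Omega>" and out: "\<forall>x. x \<notin> A \<longrightarrow> u x = 0 \<and> g x = 0"
      and a: "a \<in> borel_measurable borel" "integrable lborel (\<lambda>x. (a x)\<^sup>2)" and l: "l > 0"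
    note D = H1_pairD[OF ug]
    note [measurable] = D(4,5) A(1)
    define b where "b x = \<bar>u x\<bar> + norm (g x)" for x
    have bm [measurable]: "b \<in> borel_measurable borel" by (simp add: b_def[abs_def])
    have b0: "b x \<ge> 0" for x by (simp add: b_def)
    have bA: "\<bar>b y\<bar> * indicator A y = \<bar>u y\<bar> + norm (g y)" for y
      using out by (cases "y \<in> A") (auto simp: b_def)
    have finA: "emeasure lborel A < \<infinity>" using A \<Omega>(4) emeasure_bounded_finite bounded_subset by metis
    have b2le: "(b x)\<^sup>2 \<le> 2 * ((u x)\<^sup>2 + (norm (g x))\<^sup>2)" for x
      using zero_le_power2[of "\<bar>u x\<bar> - norm (g x)"] by (simp add: b_def power2_sum power2_diff)
    have isum: "integrable lborel (\<lambda>x. 2 * ((u x)\<^sup>2 + (norm (g x))\<^sup>2))" using D(6,7) by simp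
    have ib2: "integrable lborel (\<lambda>x. (b x)\<^sup>2)"
      by (rule Bochner_Integration.integrable_bound[OF isum]) (use b2le in auto)
    have Ib2: "(\<integral>x. (b x)\<^sup>2 \<partial>lborel) \<le> 2 * ((\<integral>x. (u x)\<^sup>2 \<partial>lborel) + (\<integral>x. (norm (g x))\<^sup>2 \<partial>lborel))"
      using integral_mono[OF ib2 isum b2le] D(6,7) by simp
    obtain m where m: "\<bar>m\<bar> \<le> C0 * (\<integral>y. \<bar>u y\<bar> \<partial>lborel)" and AE: "AE x in lborel. x \<in> \<Omega> \<longrightarrow>
        (\<forall>y\<in>\<Omega>. 1 \<le> dyadic_kernel R x y) \<and>
        ennreal \<bar>u x - m\<bar> \<le> ennreal C0 * dyadic_potential R (\<lambda>y. norm (g y)) x"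
      using PP[OF D(1)] by blast
    have AE': "AE x in lborel. x \<in> A \<longrightarrow> ennreal \<bar>u x\<bar> \<le> ennreal C0 * dyadic_potential R (\<lambda>y. \<bar>b y\<bar> * indicator A y) x"
      using AE
    proof eventually_elim
      case (elim x)
      show ?case
      proof
        assume "x \<in> A"
        then have x: "x \<in> \<Omega>" using A by blast
        have "ennreal (\<integral>y. \<bar>u y\<bar> \<partial>lborel) = (\<integral>\<^sup>+y. ennreal \<bar>u y\<bar> \<partial>lborel)"
          using D(2) by (intro nn_integral_eq_integral[symmetric]) auto
        also have "\<dots> \<le> dyadic_potential R (\<lambda>y. \<bar>u y\<bar>) x"
          unfolding dyadic_potential_def
        proof (intro nn_integral_mono)
          fix y
          show "ennreal \<bar>u y\<bar> \<le> dyadic_kernel R x y * ennreal \<bar>u y\<bar>"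
            using elim x D(8)[of y] mult_right_mono[of 1 "dyadic_kernel R x y" "ennreal \<bar>u y\<bar>"]
            by (cases "y \<in> \<Omega>") auto
        qed
        finally have 1: "ennreal (\<integral>y. \<bar>u y\<bar> \<partial>lborel) \<le> dyadic_potential R (\<lambda>y. \<bar>u y\<bar>) x" .
        have "ennreal \<bar>m\<bar> \<le> ennreal C0 * ennreal (\<integral>y. \<bar>u y\<bar> \<partial>lborel)"
          using m C0 by (simp add: ennreal_mult'[symmetric] ennreal_leI)
        also have "\<dots> \<le> ennreal C0 * dyadic_potential R (\<lambda>y. \<bar>u y\<bar>) x" using 1 by (rule mult_left_mono) simp
        finally have 2: "ennreal \<bar>m\<bar> \<le> ennreal C0 * dyadic_potential R (\<lambda>y. \<bar>u y\<bar>) x" .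
        have "ennreal \<bar>u x\<bar> \<le> ennreal \<bar>m\<bar> + ennreal \<bar>u x - m\<bar>"
          by (simp add: ennreal_plus[symmetric] ennreal_leI del: ennreal_plus)
        also have "\<dots> \<le> ennreal C0 * dyadic_potential R (\<lambda>y. \<bar>u y\<bar>) x + ennreal C0 * dyadic_potential R (\<lambda>y. norm (g y)) x"
          using 2 elim x by (intro add_mono) auto
        also have "\<dots> = ennreal C0 * dyadic_potential R (\<lambda>y. \<bar>u y\<bar> + norm (g y)) x"
          by (subst dyadic_potential_add) (auto simp: distrib_left)
        finally show "ennreal \<bar>u x\<bar> \<le> ennreal C0 * dyadic_potential R (\<lambda>y. \<bar>b y\<bar> * indicator A y) x"
          by (simp add: bA)
      qed
    qed
    define M where "M = Ck * measure lborel A powr \<theta>"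
    have M: "M \<ge> 0" using Ck(1) by (simp add: M_def)
    have "(\<integral>x. \<bar>a x\<bar> * \<bar>u x\<bar> \<partial>lborel) \<le> C0 * (M / 2) * (l * (\<integral>x. (a x)\<^sup>2 \<partial>lborel) + 1 / l * (\<integral>x. (b x)\<^sup>2 \<partial>lborel))"
      using C0 l out Ck(2)[OF A(1) finA]
      by (intro integral_le_Schur[OF A(1) a(1) bm D(4) a(2) ib2 D(6) M _ l _ _ AE']) (auto simp: M_def)
    also have "\<dots> \<le> C0 * (M / 2) * (2 * (l * (\<integral>x. (a x)\<^sup>2 \<partial>lborel)
      + 1 / l * ((\<integral>x. (u x)\<^sup>2 \<partial>lborel) + (\<integral>x. (norm (g x))\<^sup>2 \<partial>lborel))))"
    proof (rule mult_left_mono)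
      have "0 \<le> l * (\<integral>x. (a x)\<^sup>2 \<partial>lborel)" using l by (intro mult_nonneg_nonneg Bochner_Integration.integral_nonneg) auto
      moreover have "1 / l * (\<integral>x. (b x)\<^sup>2 \<partial>lborel) \<le> 1 / l * (2 * ((\<integral>x. (u x)\<^sup>2 \<partial>lborel) + (\<integral>x. (norm (g x))\<^sup>2 \<partial>lborel)))"
        using Ib2 l by (intro mult_left_mono) auto
      moreover have "x + q * b \<le> 2 * (x + q * s)" if "0 \<le> x" "q * b \<le> q * (2 * s)" for x q b s :: real
        using that by (simp add: algebra_simps)
      ultimately show "l * (\<integral>x. (a x)\<^sup>2 \<partial>lborel) + 1 / l * (\<integral>x. (b x)\<^sup>2 \<partial>lborel) \<le> 2 * (l * (\<integral>x. (a x)\<^sup>2 \<partial>lborel)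
      + 1 / l * ((\<integral>x. (u x)\<^sup>2 \<partial>lborel) + (\<integral>x. (norm (g x))\<^sup>2 \<partial>lborel)))"
        by blast
    qed (use C0 M in simp)
    also have "\<dots> = C0 * Ck * measure lborel A powr \<theta> * (l * (\<integral>x. (a x)\<^sup>2 \<partial>lborel)
      + 1 / l * ((\<integral>x. (u x)\<^sup>2 \<partial>lborel) + (\<integral>x. (norm (g x))\<^sup>2 \<partial>lborel)))"
      by (simp add: M_def)
    also have "\<dots> \<le> C0 * (Ck + 1) * measure lborel A powr \<theta> * (l * (\<integral>x. (a x)\<^sup>2 \<partial>lborel)
      + 1 / l * ((\<integral>x. (u x)\<^sup>2 \<partial>lborel) + (\<integral>x. (norm (g x))\<^sup>2 \<partial>lborel)))"
      using C0 l by (intro mult_right_mono add_nonneg_nonneg mult_nonneg_nonneg Bochner_Integration.integral_nonneg) auto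
    finally show "(\<integral>x. \<bar>a x\<bar> * \<bar>u x\<bar> \<partial>lborel) \<le> C0 * (Ck + 1) * measure lborel A powr \<theta> * (l * (\<integral>x. (a x)\<^sup>2 \<partial>lborel)
      + 1 / l * ((\<integral>x. (u x)\<^sup>2 \<partial>lborel) + (\<integral>x. (norm (g x))\<^sup>2 \<partial>lborel)))" .
  qed
qed

lemma measure_open_pos:
  fixes \<Omega> :: "'a::euclidean_space set"
  assumes "open \<Omega>" "bounded \<Omega>" "\<Omega> \<noteq> {}"
  shows "measure lborel \<Omega> > 0"
proof -
  obtain z d where d: "d > 0" "ball z d \<subseteq> \<Omega>" using assms(1,3) by (meson ex_in_conv open_contains_ball)
  then have "measure lborel (ball z d) \<le> measure lborel \<Omega>"
    using emeasure_bounded_finite[OF assms(2)] assms(1) by (intro measure_mono_fmeasurable) (auto simp: fmeasurable_def)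
  moreover have "measure lborel (ball z d) > 0" using d(1) by (rule content_ball_pos)
  ultimately show ?thesis by linarith
qed

text \<open>Schur's test over all of \<Omega> with both left-hand factors equal to w = u - m and the
  potential of |g| on the right; half of \<integral>w^2 is absorbed. Passing from m to the mean only
  decreases the left side.\<close>

lemma L2_Poincare:
  fixes \<Omega> :: "'a::euclidean_space set"
  assumes \<Omega>: "open \<Omega>" "connected \<Omega>" "\<Omega> \<noteq> {}" "bounded \<Omega>" "cone_condition \<Omega>"
  shows "\<exists>P>0. \<forall>u g. H1_pair \<Omega> u g \<longrightarrow>
    (\<integral>x. (u x - (\<integral>x. u x \<partial>lborel) / measure lborel \<Omega> * indicator \<Omega> x)\<^sup>2 \<partial>lborel)
      \<le> P * (\<integral>x. (norm (g x))\<^sup>2 \<partial>lborel)"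
proof -
  \<comment> \<open>Any admissible exponent would do here; only finiteness of the row integrals over
    \<Omega> matters.\<close>
  define \<theta> where "\<theta> = 1 / (2 * real DIM('a))"
  have \<theta>: "0 < \<theta>" "\<theta> < 1 / real DIM('a)" by (auto simp: \<theta>_def field_simps)
  obtain R C0 where R: "R > 0" and C0: "C0 > 0" and PP: "\<And>u g. weak_grad_pair \<Omega> u g \<Longrightarrow>
    (\<exists>m. \<bar>m\<bar> \<le> C0 * (\<integral>y. \<bar>u y\<bar> \<partial>lborel) \<and>
      (AE x in lborel. x \<in> \<Omega> \<longrightarrow>
        (\<forall>y\<in>\<Omega>. 1 \<le> dyadic_kernel R x y) \<and>
        ennreal \<bar>u x - m\<bar> \<le> ennreal C0 * dyadic_potential R (\<lambda>y. norm (g y)) x))"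
    using pointwise_Poincare[OF \<Omega>] by blast
  obtain Ck where Ck: "Ck \<ge> 0" "\<And>A (x::'a). A \<in> sets borel \<Longrightarrow> emeasure lborel A < \<infinity> \<Longrightarrow>
    (\<integral>\<^sup>+y. dyadic_kernel R x y * indicator A y \<partial>lborel) \<le> ennreal (Ck * measure lborel A powr \<theta>)"
    using dyadic_kernel_integral_le[OF \<theta> R] by blast
  have \<Omega>s [measurable]: "\<Omega> \<in> sets borel" using \<Omega>(1) by simp
  have fin: "emeasure lborel \<Omega> < \<infinity>" using \<Omega>(4) by (rule emeasure_bounded_finite)
  have pos: "measure lborel \<Omega> > 0" by (rule measure_open_pos[OF \<Omega>(1,4,3)])
  define M where "M = Ck * measure lborel \<Omega> powr \<theta> + 1"
  have M: "M > 0" using Ck(1) by (simp add: M_def add_nonneg_pos)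
  have ker: "(\<integral>\<^sup>+y. dyadic_kernel R x y * indicator \<Omega> y \<partial>lborel) \<le> ennreal M" for x :: 'a
    using Ck(2)[OF \<Omega>s fin, of x] by (rule order_trans) (simp add: M_def ennreal_leI)
  show ?thesis
  proof (intro exI[of _ "(C0 * M)\<^sup>2"] conjI allI impI)
    show "0 < (C0 * M)\<^sup>2" using C0 M by simp
    fix u :: "'a \<Rightarrow> real" and g assume ug: "H1_pair \<Omega> u g"
    note D = H1_pairD[OF ug]
    note [measurable] = D(4,5)
    obtain m where AE: "AE x in lborel. x \<in> \<Omega> \<longrightarrow>
        ennreal \<bar>u x - m\<bar> \<le> ennreal C0 * dyadic_potential R (\<lambda>y. norm (g y)) x"
      using PP[OF D(1)] by (fastforce elim: eventually_mono)
    define w where "w x = u x + (- m) * indicator \<Omega> x" for x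
    have wp: "H1_pair \<Omega> w (\<lambda>x. g x + (- m) *\<^sub>R 0)"
      unfolding w_def[abs_def] by (rule H1_pair_add_cmult[OF ug H1_pair_indicator[OF \<Omega>(1,4)]])
    note W = H1_pairD[OF wp]
    have gi: "\<bar>norm (g y)\<bar> * indicator \<Omega> y = norm (g y)" for y using D(9)[of y] by (cases "y \<in> \<Omega>") auto
    let ?W = "\<integral>x. (w x)\<^sup>2 \<partial>lborel" and ?G = "\<integral>x. (norm (g x))\<^sup>2 \<partial>lborel"
    have AE': "AE x in lborel. x \<in> \<Omega> \<longrightarrow> ennreal \<bar>w x\<bar> \<le> ennreal C0 * dyadic_potential R (\<lambda>y. \<bar>norm (g y)\<bar> * indicator \<Omega> y) x"
      using AE unfolding gi by eventually_elim (simp add: w_def)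
    \<comment> \<open>The weight 1 / (C0 * M) gives \<integral>w^2 on the right the coefficient
      1/2.\<close>
    have "(\<integral>x. \<bar>w x\<bar> * \<bar>w x\<bar> \<partial>lborel) \<le> C0 * (M / 2) * (1 / (C0 * M) * ?W + 1 / (1 / (C0 * M)) * ?G)"
      using C0 M W(8)
      by (intro integral_le_Schur[OF \<Omega>s W(4) _ W(4) W(6) _ W(6) _ ker _ _ _ AE']) (auto simp: D(7))
    also have "(\<integral>x. \<bar>w x\<bar> * \<bar>w x\<bar> \<partial>lborel) = ?W" by (simp add: power2_eq_square)
    also have "C0 * (M / 2) * (1 / (C0 * M) * ?W + 1 / (1 / (C0 * M)) * ?G) = ?W / 2 + (C0 * M)\<^sup>2 / 2 * ?G"
      using C0 M by (simp add: power2_eq_square field_simps)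
    finally have "?W \<le> (C0 * M)\<^sup>2 * ?G" by simp
    moreover have "(\<integral>x. (u x - (\<integral>x. u x \<partial>lborel) / measure lborel \<Omega> * indicator \<Omega> x)\<^sup>2 \<partial>lborel) \<le> ?W"
      using L2_mean_minimal[OF \<Omega>s fin pos D(2,6,8), of m] by (simp add: w_def)
    ultimately show "(\<integral>x. (u x - (\<integral>x. u x \<partial>lborel) / measure lborel \<Omega> * indicator \<Omega> x)\<^sup>2 \<partial>lborel) \<le> (C0 * M)\<^sup>2 * ?G"
      by linarith
  qed
qed

section \<open>Decay of the level sets\<close>

lemma max_square_deriv: "((\<lambda>x. (max 0 x)\<^sup>2) has_real_derivative 2 * max 0 x) (at (x::real))"
proof -
  consider "x < 0" | "x = 0" | "x > 0" by linarith
  then show ?thesis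
  proof cases
    case 1
    have "((\<lambda>x. 0) has_real_derivative 0) (at x)" by simp
    then have "((\<lambda>x. (max 0 x)\<^sup>2) has_real_derivative 0) (at x)"
      by (rule has_field_derivative_transform_within_open[where S = "{..<0}"]) (use 1 in auto)
    then show ?thesis using 1 by simp
  next
    case 2
    have "((\<lambda>h. (max 0 h)\<^sup>2 / h) \<longlongrightarrow> 0) (at (0::real))"
    proof (rule Lim_null_comparison)
      show "eventually (\<lambda>h::real. norm ((max 0 h)\<^sup>2 / h) \<le> \<bar>h\<bar>) (at 0)"
        by (intro always_eventually allI) (auto simp: max_def power2_eq_square)
      show "((\<lambda>h::real. \<bar>h\<bar>) \<longlongrightarrow> 0) (at 0)" by (rule tendsto_eq_intros refl | simp)+
    qed
    then show ?thesis unfolding 2 by (simp add: has_field_derivative_iff)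
  next
    case 3
    have "((\<lambda>x. x\<^sup>2) has_real_derivative 2 * x) (at x)" by (auto intro!: derivative_eq_intros)
    then have "((\<lambda>x. (max 0 x)\<^sup>2) has_real_derivative 2 * x) (at x)"
      by (rule has_field_derivative_transform_within_open[where S = "{0<..}"]) (use 3 in auto)
    then show ?thesis using 3 by simp
  qed
qed

text \<open>A bounded \<open>C\<^sup>1\<close> replacement for \<open>max 0\<close>, whose derivative is the hat function on \<open>[0, 1]\<close>.\<close>

definition soft_step :: "real \<Rightarrow> real" where
  "soft_step x = (max 0 x)\<^sup>2 / 2 - (max 0 (x - 1/2))\<^sup>2 + (max 0 (x - 1))\<^sup>2 / 2"

definition hat :: "real \<Rightarrow> real" where
  "hat x = max 0 x - 2 * max 0 (x - 1/2) + max 0 (x - 1)"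

lemma soft_step_deriv: "(soft_step has_real_derivative hat x) (at x)"
proof -
  have sh: "((\<lambda>x. (max 0 (x - c))\<^sup>2) has_real_derivative 2 * max 0 (x - c)) (at x)" for c :: real
    using DERIV_shift[of "\<lambda>x. (max 0 x)\<^sup>2" "2 * max 0 (x - c)" x "- c"] max_square_deriv[of "x - c"] by simp
  have "((\<lambda>x. (max 0 x)\<^sup>2 / 2 - (max 0 (x - 1/2))\<^sup>2 + (max 0 (x - 1))\<^sup>2 / 2) has_real_derivative
      2 * max 0 x / 2 - 2 * max 0 (x - 1/2) + 2 * max 0 (x - 1) / 2) (at x)"
    by (intro DERIV_add DERIV_diff DERIV_cdivide sh max_square_deriv)
  then show ?thesis by (simp add: soft_step_def[abs_def] hat_def)
qed

lemma hat_bounds: "0 \<le> hat x" "hat x \<le> 1" "\<bar>hat x - hat y\<bar> \<le> 4 * \<bar>x - y\<bar>" "x \<le> 0 \<Longrightarrow> hat x = 0"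
  by (auto simp: hat_def max_def abs_if)

text \<open>The plateau value 1/4 is the area under the hat, a triangle of base 1 and height
  1/2.\<close>

lemma soft_step_bounds:
  "x \<le> 0 \<Longrightarrow> soft_step x = 0" "x \<ge> 1 \<Longrightarrow> soft_step x = 1/4" "0 \<le> soft_step x" "soft_step x \<le> 1/4" "x \<ge> 0 \<Longrightarrow> soft_step x \<le> x"
proof -
  show 1: "x \<le> 0 \<Longrightarrow> soft_step x = 0" by (simp add: soft_step_def)
  show 2: "x \<ge> 1 \<Longrightarrow> soft_step x = 1/4"
    by (simp add: soft_step_def power2_eq_square algebra_simps add_divide_distrib diff_divide_distrib)
  have 3: "soft_step x = x\<^sup>2 / 2" if "0 \<le> x" "x \<le> 1/2" using that by (simp add: soft_step_def)
  have 4: "soft_step x = 1/4 - (1 - x)\<^sup>2 / 2" if "1/2 \<le> x" "x \<le> 1"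
    using that by (simp add: soft_step_def power2_eq_square algebra_simps add_divide_distrib diff_divide_distrib)
  have sq: "y\<^sup>2 \<le> 1/4" if "0 \<le> y" "y \<le> 1/2" for y :: real
    using power_mono[OF that(2,1), of 2] by (simp add: power2_eq_square)
  have sq': "y\<^sup>2 \<le> y" if "0 \<le> y" "y \<le> 1" for y :: real
    using that mult_left_le_one_le[of y y] by (simp add: power2_eq_square)
  have "0 \<le> soft_step x \<and> soft_step x \<le> 1/4 \<and> (x \<ge> 0 \<longrightarrow> soft_step x \<le> x)"
  proof -
    consider "x \<le> 0" | "0 \<le> x" "x \<le> 1/2" | "1/2 \<le> x" "x \<le> 1" | "1 \<le> x" by linarith
    then show ?thesis
    proof cases
      case 2
      then have "soft_step x = x\<^sup>2 / 2" "x\<^sup>2 \<le> 1/4" "x\<^sup>2 \<le> x" using 3 sq[of x] sq'[of x] by auto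
      then show ?thesis using zero_le_power2[of x] 2(1) by (intro conjI impI) linarith+
    next
      case 3
      then have "soft_step x = 1/4 - (1 - x)\<^sup>2 / 2" "(1 - x)\<^sup>2 \<le> 1/4" using 4 sq[of "1 - x"] by auto
      then show ?thesis using zero_le_power2[of "1 - x"] 3(1) by (intro conjI impI) linarith+
    qed (use 1 2 in auto)
  qed
  then show "0 \<le> soft_step x" "soft_step x \<le> 1/4" "x \<ge> 0 \<Longrightarrow> soft_step x \<le> x" by auto
qed

lemma obstacle_violation_bounds:
  "\<bar>obstacle_violation t\<bar> \<le> \<bar>t\<bar>" "obstacle_violation (- t) = - obstacle_violation t"
  "obstacle_violation 0 = 0" "t \<ge> 1 \<Longrightarrow> obstacle_violation t = t - 1" "t \<le> -1 \<Longrightarrow> obstacle_violation t = t + 1"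
  "s \<le> t \<Longrightarrow> obstacle_violation s \<le> obstacle_violation t"
  by (auto simp: obstacle_violation_def max_def min_def)

lemma obstacle_violation_measurable [measurable]: "obstacle_violation \<in> borel_measurable borel"
  unfolding obstacle_violation_def[abs_def] by measurable

lemma integrable_obstacle_violation_square:
  fixes p :: "'a::euclidean_space \<Rightarrow> real"
  assumes "p \<in> borel_measurable borel" "integrable lborel (\<lambda>x. (p x)\<^sup>2)"
  shows "integrable lborel (\<lambda>x. (obstacle_violation (p x))\<^sup>2)"
proof (rule Bochner_Integration.integrable_bound[OF assms(2)])
  show "AE x in lborel. norm ((obstacle_violation (p x))\<^sup>2) \<le> norm ((p x)\<^sup>2)"
    using obstacle_violation_bounds(1) by (intro always_eventually allI) (simp add: abs_le_square_iff[symmetric])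
qed (use assms(1) in simp)

text \<open>The equation is tested with a truncation v of p that vanishes below 1 + k and equals (h
  - k) / 4 above 1 + h. The resulting energy E is bounded by Schur's inequality against f - c, and
  \<integral>v by the same inequality against the indicator of A; comparing \<integral>v with its
  part above 1 + h gives the decay. \<open>Schur\<close> is a hypothesis so that C is fixed before
  s, p and the level.\<close>

lemma level_set_decay:
  fixes \<Omega> :: "'a::euclidean_space set" and p f :: "'a \<Rightarrow> real"
  assumes \<Omega>: "open \<Omega>" "bounded \<Omega>" and C: "C > 0"
    and Schur: "\<And>u g a A l. H1_pair \<Omega> u g \<Longrightarrow> A \<in> sets borel \<Longrightarrow> A \<subseteq> \<Omega> \<Longrightarrow>
      (\<And>x. x \<notin> A \<Longrightarrow> u x = 0 \<and> g x = 0) \<Longrightarrow> a \<in> borel_measurable borel \<Longrightarrow>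
      integrable lborel (\<lambda>x. (a x)\<^sup>2) \<Longrightarrow> l > 0 \<Longrightarrow>
      (\<integral>x. \<bar>a x\<bar> * \<bar>u x\<bar> \<partial>lborel) \<le> C * measure lborel A powr \<theta> * (l * (\<integral>x. (a x)\<^sup>2 \<partial>lborel)
        + 1 / l * ((\<integral>x. (u x)\<^sup>2 \<partial>lborel) + (\<integral>x. (norm (g x))\<^sup>2 \<partial>lborel)))"
    and p: "H1_pair \<Omega> p gp"
    and f: "f \<in> borel_measurable borel" "integrable lborel (\<lambda>x. (f x)\<^sup>2)"
    and \<epsilon>: "\<epsilon> > 0" "\<epsilon>\<^sup>2 \<le> s"
    and eq: "\<And>v gv. H1_pair \<Omega> v gv \<Longrightarrow> \<epsilon> * (\<integral>x. gp x \<bullet> gv x \<partial>lborel)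
      + s / \<epsilon> * (\<integral>x. obstacle_violation (p x) * v x \<partial>lborel) = (\<integral>x. f x * v x \<partial>lborel)"
    and k: "0 \<le> k" "\<epsilon> / s * c \<le> k" "k < h"
    and D: "(\<integral>x. (f x - c * indicator \<Omega> x)\<^sup>2 \<partial>lborel) \<le> D"
  shows "(h - k) * measure lborel {x. p x > 1 + h}
    \<le> 4 * C * (1 + 4 * C\<^sup>2 * D / \<epsilon>\<^sup>2) * measure lborel {x. p x > 1 + k} powr (2 * \<theta> + 1/2)"
proof -
  note P = H1_pairD[OF p]
  note [measurable] = P(4,5) f(1)
  have [measurable]: "\<Omega> \<in> sets borel" using \<Omega> by simp
  have fin\<Omega>: "emeasure lborel \<Omega> < \<infinity>" using \<Omega>(2) by (rule emeasure_bounded_finite)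
  have s0: "s > 0" using \<epsilon> by (meson less_le_trans zero_less_power)
  define w where "w = h - k"
  have w: "w > 0" using k by (simp add: w_def)
  \<comment> \<open>Rescaling by w keeps the slope between 0 and 1, and spreads the transition over
    the levels from 1 + k to 1 + h.\<close>
  define F where "F t = w * soft_step ((t - 1 - k) / w)" for t
  define F' where "F' t = hat ((t - 1 - k) / w)" for t
  have Fder: "(F has_real_derivative F' t) (at t)" for t
  proof -
    have "((\<lambda>t. (t - 1 - k) / w) has_real_derivative 1 / w) (at t)"
      using w by (auto intro!: derivative_eq_intros)
    from DERIV_cmult[OF DERIV_chain2[OF soft_step_deriv this], of w] show ?thesis
      using w by (simp add: F_def[abs_def] F'_def)
  qed
  have F0: "F 0 = 0" using k w by (simp add: F_def soft_step_bounds(1) divide_nonpos_pos)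
  have Fb: "\<bar>F t\<bar> \<le> w / 4" for t
    using w soft_step_bounds(3,4)[of "(t - 1 - k) / w"] by (simp add: F_def abs_mult)
  have F'b: "\<bar>F' t\<bar> \<le> 1" for t using hat_bounds(1,2) by (simp add: F'_def)
  have F'lip: "\<bar>F' a - F' b\<bar> \<le> 4 / w * \<bar>a - b\<bar>" for a b
  proof -
    have "\<bar>F' a - F' b\<bar> \<le> 4 * \<bar>(a - 1 - k) / w - (b - 1 - k) / w\<bar>" unfolding F'_def by (rule hat_bounds(3))
    also have "(a - 1 - k) / w - (b - 1 - k) / w = (a - b) / w" by (simp add: diff_divide_distrib[symmetric])
    finally show ?thesis using w by simp
  qed
  define v where "v x = F (p x)" for x
  define gv where "gv x = F' (p x) *\<^sub>R gp x" for x
  have wv: "weak_grad_pair \<Omega> v gv"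
    unfolding v_def[abs_def] gv_def[abs_def]
    by (rule weak_grad_pair_compose[OF P(1) \<Omega>(1) Fder F0 Fb F'b F'lip])
  define A where "A = {x. p x > 1 + k}"
  have Am [measurable]: "A \<in> sets borel" unfolding A_def by measurable
  have A\<Omega>: "A \<subseteq> \<Omega>" using P(8) k by (force simp: A_def)
  have Fneg: "F t = 0" "F' t = 0" if "t \<le> 1 + k" for t
    using that w by (auto simp: F_def F'_def soft_step_bounds(1) hat_bounds(4) divide_nonpos_pos)
  have vA: "v x = 0 \<and> gv x = 0" if "x \<notin> A" for x using that Fneg by (simp add: v_def gv_def A_def)
  have v0: "v x \<ge> 0" for x using w soft_step_bounds(3) by (simp add: v_def F_def)
  have vle: "v x \<le> p x - 1 - k" if "x \<in> A" for x
  proof -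
    have "soft_step ((p x - 1 - k) / w) \<le> (p x - 1 - k) / w" using that w by (intro soft_step_bounds(5)) (simp add: A_def)
    then have "w * soft_step ((p x - 1 - k) / w) \<le> w * ((p x - 1 - k) / w)" using w by (intro mult_left_mono) auto
    then show ?thesis using w by (simp add: v_def F_def)
  qed
  have iv: "integrable lborel v" and igv: "integrable lborel gv" using wv by (auto simp: weak_grad_pair_def)
  have [measurable]: "v \<in> borel_measurable borel" "gv \<in> borel_measurable borel"
    using borel_measurable_integrable[OF iv] borel_measurable_integrable[OF igv] by auto
  have vp: "\<bar>v x\<bar> \<le> \<bar>p x\<bar>" for x
    using vle[of x] v0[of x] vA[of x] k by (cases "x \<in> A") auto
  have iv2: "integrable lborel (\<lambda>x. (v x)\<^sup>2)"
  proof (rule Bochner_Integration.integrable_bound[OF P(6)])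
    show "AE x in lborel. norm ((v x)\<^sup>2) \<le> norm ((p x)\<^sup>2)"
      using vp by (intro always_eventually allI) (simp add: abs_le_square_iff[symmetric])
  qed simp
  have F'0: "0 \<le> F' t" "F' t \<le> 1" for t using hat_bounds(1,2) by (auto simp: F'_def)
  \<comment> \<open>Since 0 \<le> F' \<le> 1, multiplying by F' once instead of twice can only
    enlarge |gp|^2.\<close>
  have gvn: "(norm (gv x))\<^sup>2 \<le> gp x \<bullet> gv x" "gp x \<bullet> gv x \<le> (norm (gp x))\<^sup>2" for x
  proof -
    have "(F' (p x))\<^sup>2 \<le> F' (p x)" using F'0[of "p x"] by (simp add: power2_eq_square mult_left_le_one_le)
    then have "(F' (p x))\<^sup>2 * (norm (gp x))\<^sup>2 \<le> F' (p x) * (norm (gp x))\<^sup>2" by (rule mult_right_mono) simp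
    moreover have "(norm (gv x))\<^sup>2 = (F' (p x))\<^sup>2 * (norm (gp x))\<^sup>2" by (simp add: gv_def power_mult_distrib)
    moreover have gg: "gp x \<bullet> gv x = F' (p x) * (norm (gp x))\<^sup>2" by (simp add: gv_def power2_norm_eq_inner)
    ultimately show "(norm (gv x))\<^sup>2 \<le> gp x \<bullet> gv x" by simp
    show "gp x \<bullet> gv x \<le> (norm (gp x))\<^sup>2" unfolding gg using F'0[of "p x"] by (intro mult_left_le_one_le) auto
  qed
  have ig2: "integrable lborel (\<lambda>x. (norm (gv x))\<^sup>2)"
  proof (rule Bochner_Integration.integrable_bound[OF P(7)])
    show "AE x in lborel. norm ((norm (gv x))\<^sup>2) \<le> norm ((norm (gp x))\<^sup>2)"
      using order_trans[OF gvn] by (intro always_eventually allI) simp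
  qed simp
  have igg: "integrable lborel (\<lambda>x. gp x \<bullet> gv x)"
  proof (rule Bochner_Integration.integrable_bound[OF P(7)])
    show "AE x in lborel. norm (gp x \<bullet> gv x) \<le> norm ((norm (gp x))\<^sup>2)"
    proof (intro always_eventually allI)
      fix x
      have "0 \<le> gp x \<bullet> gv x" using gvn(1)[of x] zero_le_power2[of "norm (gv x)"] by linarith
      then show "norm (gp x \<bullet> gv x) \<le> norm ((norm (gp x))\<^sup>2)" using gvn(2)[of x] by simp
    qed
  qed simp
  have Hv: "H1_pair \<Omega> v gv" using wv iv2 ig2 by (simp add: H1_pair_def)
  \<comment> \<open>Only the part of f orthogonal to constants is estimated; the constant c is
    handled by the level k.\<close>
  define a where "a x = f x - c * indicator \<Omega> x" for x
  have am [measurable]: "a \<in> borel_measurable borel" by (simp add: a_def[abs_def])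
  have i\<Omega>: "integrable lborel (\<lambda>x. (- c * indicator \<Omega> x)\<^sup>2 :: real)"
  proof -
    have "(- c * indicator \<Omega> x)\<^sup>2 = c\<^sup>2 * (indicator \<Omega> x :: real)" for x by (simp add: indicator_def)
    then show ?thesis using fin\<Omega> by simp
  qed
  have ia2: "integrable lborel (\<lambda>x. (a x)\<^sup>2)"
    using integrable_power2_add[of f "\<lambda>x. - c * indicator \<Omega> x"] f i\<Omega> by (simp add: a_def)
  have Da: "(\<integral>x. (a x)\<^sup>2 \<partial>lborel) \<le> D" using D by (simp add: a_def)
  have iav: "integrable lborel (\<lambda>x. a x * v x)" by (rule integrable_mult_L2[OF am _ ia2 iv2]) simp
  note il2 = integrable_obstacle_violation_square[OF P(4,6)]
  have ilv: "integrable lborel (\<lambda>x. obstacle_violation (p x) * v x)" by (rule integrable_mult_L2[OF _ _ il2 iv2]) simp_all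
  let ?V = "\<integral>x. v x \<partial>lborel" and ?V2 = "\<integral>x. (v x)\<^sup>2 \<partial>lborel" and ?G2 = "\<integral>x. (norm (gv x))\<^sup>2 \<partial>lborel"
  have V0: "?V \<ge> 0" using v0 by (intro Bochner_Integration.integral_nonneg)
  have 1: "?G2 \<le> (\<integral>x. gp x \<bullet> gv x \<partial>lborel)" using gvn(1) by (intro integral_mono ig2 igg)
  \<comment> \<open>On A the violation is p - 1 \<ge> k + v. The part with k will absorb c; the part
    with v gives a square.\<close>
  have 2: "k * ?V + ?V2 \<le> (\<integral>x. obstacle_violation (p x) * v x \<partial>lborel)"
  proof -
    have "k * ?V + ?V2 = (\<integral>x. k * v x + (v x)\<^sup>2 \<partial>lborel)" using iv iv2 by simp
    also have "\<dots> \<le> (\<integral>x. obstacle_violation (p x) * v x \<partial>lborel)"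
    proof (rule integral_mono[OF _ ilv])
      show "integrable lborel (\<lambda>x. k * v x + (v x)\<^sup>2)" using iv iv2 by simp
      fix x
      show "k * v x + (v x)\<^sup>2 \<le> obstacle_violation (p x) * v x"
      proof (cases "x \<in> A")
        case True
        then have "obstacle_violation (p x) = p x - 1" using k by (intro obstacle_violation_bounds(4)) (simp add: A_def)
        then have "(k + v x) * v x \<le> obstacle_violation (p x) * v x"
          using vle[OF True] v0[of x] by (intro mult_right_mono) auto
        then show ?thesis by (simp add: algebra_simps power2_eq_square)
      qed (use vA in simp)
    qed
    finally show ?thesis .
  qed
  have 3: "(\<integral>x. f x * v x \<partial>lborel) = (\<integral>x. a x * v x \<partial>lborel) + c * ?V"
  proof -
    have "f x * v x = a x * v x + c * v x" for x
      using vA[of x] A\<Omega> by (cases "x \<in> \<Omega>") (auto simp: a_def algebra_simps)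
    then show ?thesis using iav iv by simp
  qed
  \<comment> \<open>This is where the level must lie above \<epsilon> / s * c: the penalty then
    dominates the mean of f, however large it is.\<close>
  have 4: "c * ?V \<le> s / \<epsilon> * k * ?V"
  proof (rule mult_right_mono[OF _ V0])
    have "s / \<epsilon> * (\<epsilon> / s * c) \<le> s / \<epsilon> * k" using k(2) s0 \<epsilon>(1) by (intro mult_left_mono) auto
    then show "c \<le> s / \<epsilon> * k" using s0 \<epsilon>(1) by simp
  qed
  have 5: "(\<integral>x. a x * v x \<partial>lborel) \<le> (\<integral>x. \<bar>a x\<bar> * \<bar>v x\<bar> \<partial>lborel)"
    using integrable_abs[OF iav] by (intro integral_mono iav) (auto simp: abs_mult[symmetric])
  \<comment> \<open>The use of \<epsilon>^2 \<le> s: the penalty supplies the L^2 part of the energy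
    with the same coefficient \<epsilon> as the gradient part.\<close>
  have 6: "\<epsilon> * ?V2 \<le> s / \<epsilon> * ?V2"
    using \<epsilon> by (intro mult_right_mono) (auto simp: power2_eq_square field_simps)
  define E where "E = ?V2 + ?G2"
  have E0: "E \<ge> 0" unfolding E_def by (intro add_nonneg_nonneg Bochner_Integration.integral_nonneg) auto
  have 7: "\<epsilon> * E \<le> (\<integral>x. \<bar>a x\<bar> * \<bar>v x\<bar> \<partial>lborel)"
  proof -
    have "\<epsilon> * ?G2 \<le> \<epsilon> * (\<integral>x. gp x \<bullet> gv x \<partial>lborel)" using 1 \<epsilon>(1) by (intro mult_left_mono) auto
    moreover have "s / \<epsilon> * (k * ?V + ?V2) \<le> s / \<epsilon> * (\<integral>x. obstacle_violation (p x) * v x \<partial>lborel)"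
      using 2 \<epsilon>(1) s0 by (intro mult_left_mono) auto
    moreover have "s / \<epsilon> * (k * ?V + ?V2) = s / \<epsilon> * k * ?V + s / \<epsilon> * ?V2" by (simp add: algebra_simps)
    ultimately show ?thesis using eq[OF Hv] 3 4 5 6 unfolding E_def distrib_left by linarith
  qed
  have finA: "emeasure lborel A < \<infinity>" using \<Omega>(2) A\<Omega> emeasure_bounded_finite bounded_subset by metis
  let ?m = "measure lborel A"
  define B where "B = {x. p x > 1 + h}"
  have Bm [measurable]: "B \<in> sets borel" unfolding B_def by measurable
  have BA: "B \<subseteq> A" using k by (auto simp: A_def B_def)
  have mBA: "measure lborel B \<le> ?m" using BA finA by (intro measure_mono_fmeasurable) (auto simp: fmeasurable_def)
  have iB: "integrable lborel (indicator B :: 'a \<Rightarrow> real)"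
    using BA finA by (intro integrable_real_indicator) (auto intro: le_less_trans[OF emeasure_mono])
  have low: "w / 4 * measure lborel B \<le> ?V"
  proof -
    have "w / 4 * measure lborel B = (\<integral>x. w / 4 * indicator B x \<partial>lborel)" by simp
    also have "\<dots> \<le> ?V"
    proof (rule integral_mono[OF _ iv])
      show "integrable lborel (\<lambda>x. w / 4 * indicator B x)" using iB by (rule integrable_mult_right)
      fix x
      show "w / 4 * indicator B x \<le> v x"
      proof (cases "x \<in> B")
        case True
        then have "(p x - 1 - k) / w \<ge> 1" using w by (simp add: B_def w_def)
        then have "soft_step ((p x - 1 - k) / w) = 1 / 4" by (rule soft_step_bounds(2))
        then have "v x = w / 4" unfolding v_def F_def by (simp only: times_divide_eq_right mult_1_right)
        then show ?thesis using True by simp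
      qed (use v0 in simp)
    qed
    finally show ?thesis .
  qed
  show ?thesis
  proof (cases "?m = 0")
    case True
    then have "measure lborel B = 0" using mBA by (simp add: measure_le_0_iff)
    then show ?thesis using True by (simp add: A_def B_def)
  next
    case False
    then have m: "?m > 0" using zero_less_measure_iff by blast
    define q where "q = ?m powr \<theta>"
    have q: "q > 0" using m by (simp add: q_def)
    \<comment> \<open>The weight 2 * C * q / \<epsilon> gives E the coefficient \<epsilon> / 2, so
      it is absorbed into the left side of \<open>7\<close> and E is of order q^2 = |A| powr (2 *
      \<theta>).\<close>
    have "(\<integral>x. \<bar>a x\<bar> * \<bar>v x\<bar> \<partial>lborel) \<le> C * q * (2 * C * q / \<epsilon> * (\<integral>x. (a x)\<^sup>2 \<partial>lborel) + 1 / (2 * C * q / \<epsilon>) * E)"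
      unfolding q_def E_def using C q \<epsilon>(1) by (intro Schur[OF Hv Am A\<Omega> vA am ia2]) (auto simp: q_def[symmetric])
    also have "\<dots> \<le> C * q * (2 * C * q / \<epsilon> * D + 1 / (2 * C * q / \<epsilon>) * E)"
      using C q \<epsilon>(1) Da by (intro mult_left_mono add_right_mono) auto
    also have "\<dots> = 2 * C\<^sup>2 * q\<^sup>2 * D / \<epsilon> + \<epsilon> * E / 2"
      using C q \<epsilon>(1) by (simp add: field_simps power2_eq_square)
    finally have "\<epsilon> * E \<le> 4 * C\<^sup>2 * q\<^sup>2 * D / \<epsilon>" using 7 by simp
    then have "\<epsilon> * E / \<epsilon> \<le> 4 * C\<^sup>2 * q\<^sup>2 * D / \<epsilon> / \<epsilon>" using \<epsilon>(1) by (intro divide_right_mono) auto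
    then have Eb: "E \<le> (4 * C\<^sup>2 * D / \<epsilon>\<^sup>2) * q\<^sup>2" using \<epsilon>(1) by (simp add: power2_eq_square mult_ac)
    define r where "r = ?m powr (1/2)"
    have r: "r > 0" "r\<^sup>2 = ?m" using m by (auto simp: r_def powr_half_sqrt)
    \<comment> \<open>Balances the two terms: l * |A| = q * r, and E / l is of order q^2 / l = q *
      r. With the factor q in front the total is q^2 * r = |A| powr (2 * \<theta> + 1/2).\<close>
    define l where "l = q / r"
    have l: "l > 0" using q r by (simp add: l_def)
    have iA: "integrable lborel (\<lambda>x. (indicator A x)\<^sup>2 :: real)"
    proof -
      have "(indicator A x)\<^sup>2 = (indicator A x :: real)" for x by (simp add: indicator_def)
      then show ?thesis using finA by simp
    qed
    have IA: "(\<integral>x. (indicator A x)\<^sup>2 \<partial>lborel) = ?m"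
    proof -
      have "(indicator A x)\<^sup>2 = (indicator A x :: real)" for x by (simp add: indicator_def)
      then show ?thesis by simp
    qed
    have "?V = (\<integral>x. \<bar>indicator A x\<bar> * \<bar>v x\<bar> \<partial>lborel)"
    proof (rule Bochner_Integration.integral_cong[OF refl])
      show "v x = \<bar>indicator A x\<bar> * \<bar>v x\<bar>" for x using vA[of x] v0[of x] by (cases "x \<in> A") auto
    qed
    also have "\<dots> \<le> C * q * (l * ?m + 1 / l * E)"
      using Schur[OF Hv Am A\<Omega> vA _ iA l] unfolding q_def E_def IA by simp
    also have "\<dots> \<le> C * q * (l * ?m + 1 / l * ((4 * C\<^sup>2 * D / \<epsilon>\<^sup>2) * q\<^sup>2))"
      using C q l Eb by (intro mult_left_mono add_left_mono) auto
    also have "\<dots> = C * (1 + 4 * C\<^sup>2 * D / \<epsilon>\<^sup>2) * (q\<^sup>2 * r)"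
    proof -
      have e1: "l * ?m = q * r" using r(1) q unfolding r(2)[symmetric] l_def by (simp add: power2_eq_square)
      have e2: "1 / l * (z * q\<^sup>2) = z * (q * r)" for z
        using r(1) q unfolding l_def by (simp add: power2_eq_square)
      show ?thesis unfolding e1 e2 by (simp add: power2_eq_square algebra_simps)
    qed
    also have "q\<^sup>2 * r = ?m powr (2 * \<theta> + 1/2)"
      unfolding q_def r_def by (simp add: power2_eq_square powr_add[symmetric])
    finally have "w / 4 * measure lborel B \<le> C * (1 + 4 * C\<^sup>2 * D / \<epsilon>\<^sup>2) * ?m powr (2 * \<theta> + 1/2)" using low by linarith
    then have "w * measure lborel B \<le> 4 * (C * (1 + 4 * C\<^sup>2 * D / \<epsilon>\<^sup>2) * ?m powr (2 * \<theta> + 1/2))" by linarith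
    then show ?thesis by (simp only: w_def A_def B_def mult.assoc)
  qed
qed

text \<open>Along levels k j increasing to k0 + d with gaps halved each time, \<phi> decays
  geometrically with ratio q, so it vanishes at the limit level by monotonicity.\<close>

lemma Stampacchia_iteration:
  fixes \<phi> :: "real \<Rightarrow> real"
  assumes nonneg: "\<And>k. 0 \<le> \<phi> k" and mono: "\<And>k h. k \<le> h \<Longrightarrow> \<phi> h \<le> \<phi> k"
    and C: "C > 0" and \<gamma>: "\<gamma> > 0"
    and decay: "\<And>k h. k0 \<le> k \<Longrightarrow> k < h \<Longrightarrow> (h - k) * \<phi> h \<le> C * \<phi> k powr (1 + \<gamma>)"
  shows "\<phi> (k0 + 2 * 2 powr (1 / \<gamma>) * C * \<phi> k0 powr \<gamma>) = 0"
proof (cases "\<phi> k0 = 0")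
  case True
  \<comment> \<open>With \<phi> k0 = 0 the added height is 0, because 0 powr \<gamma> = 0.\<close>
  then show ?thesis using \<gamma> by simp
next
  case False
  then have a: "\<phi> k0 > 0" using nonneg[of k0] by simp
  \<comment> \<open>The height for which d * q = 2 * C * \<phi> k0 powr \<gamma>; this is what
    closes the induction step.\<close>
  define d where "d = 2 * 2 powr (1 / \<gamma>) * C * \<phi> k0 powr \<gamma>"
  have d: "d > 0" using C a by (simp add: d_def)
  define k where "k j = k0 + d * (1 - 1 / 2 ^ j)" for j :: nat
  have kge: "k0 \<le> k j" for j using d by (simp add: k_def)
  have kle: "k j \<le> k0 + d" for j using d by (simp add: k_def)
  \<comment> \<open>Then q powr \<gamma> = 1/2, so the superlinear exponent compensates the factor
    2^j coming from the shrinking gaps.\<close>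
  define q where "q = 2 powr (- 1 / \<gamma>)"
  have q: "0 < q" "q < 1"
  proof -
    show "0 < q" by (simp add: q_def)
    have "2 powr (- 1 / \<gamma>) < 2 powr (0::real)" using \<gamma> by (intro powr_less_mono) auto
    then show "q < 1" by (simp add: q_def)
  qed
  have bound: "\<phi> (k j) \<le> \<phi> k0 * q ^ j" for j
  proof (induction j)
    case 0
    then show ?case by (simp add: k_def)
  next
    case (Suc j)
    have diff: "k (Suc j) - k j = d / (2 * 2 ^ j)" by (simp add: k_def field_simps)
    then have "k j < k (Suc j)" using d by (smt (verit) divide_pos_pos zero_less_power mult_pos_pos)
    then have "d / (2 * 2 ^ j) * \<phi> (k (Suc j)) \<le> C * \<phi> (k j) powr (1 + \<gamma>)"
      using decay[OF kge] diff by metis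
    also have "\<dots> \<le> C * (\<phi> k0 * q ^ j) powr (1 + \<gamma>)"
      using C \<gamma> Suc.IH nonneg by (intro mult_left_mono powr_mono2) auto
    also have "(\<phi> k0 * q ^ j) powr (1 + \<gamma>) = \<phi> k0 powr \<gamma> * (\<phi> k0 * q ^ j / 2 ^ j)"
    proof -
      have "(q ^ j) powr \<gamma> = 1 / 2 ^ j"
      proof -
        have "q ^ j = q powr real j" using q by (simp add: powr_realpow)
        then have "(q ^ j) powr \<gamma> = 2 powr (- 1 / \<gamma> * real j * \<gamma>)" by (simp add: q_def powr_powr)
        also have "- 1 / \<gamma> * real j * \<gamma> = - real j" using \<gamma> by simp
        also have "2 powr (- real j) = 1 / 2 ^ j" by (simp add: powr_minus powr_realpow divide_inverse)
        finally show ?thesis .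
      qed
      then show ?thesis using a q by (simp add: powr_add powr_mult)
    qed
    also have "C * (\<phi> k0 powr \<gamma> * (\<phi> k0 * q ^ j / 2 ^ j)) = d / (2 * 2 ^ j) * (\<phi> k0 * q ^ Suc j)"
    proof -
      have "2 powr (1 / \<gamma>) * q = 1" by (simp add: q_def powr_add[symmetric])
      then have "d * q = 2 * C * \<phi> k0 powr \<gamma>" unfolding d_def by (metis (no_types, opaque_lifting) mult.assoc mult.commute mult.right_neutral)
      then have "d / (2 * 2 ^ j) * (\<phi> k0 * q ^ Suc j) = (2 * C * \<phi> k0 powr \<gamma>) / (2 * 2 ^ j) * (\<phi> k0 * q ^ j)"
        by (metis (no_types, opaque_lifting) mult.assoc mult.commute power_Suc times_divide_eq_left)
      then show ?thesis by simp
    qed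
    finally have "d / (2 * 2 ^ j) * \<phi> (k (Suc j)) \<le> d / (2 * 2 ^ j) * (\<phi> k0 * q ^ Suc j)" .
    then show ?case by (rule mult_left_le_imp_le) (use d in simp)
  qed
  have "\<phi> (k0 + d) \<le> \<phi> k0 * q ^ j" for j using bound[of j] mono[OF kle[of j]] by linarith
  moreover have "(\<lambda>j. \<phi> k0 * q ^ j) \<longlonglongrightarrow> \<phi> k0 * 0"
    using q by (intro tendsto_mult tendsto_const LIMSEQ_realpow_zero) auto
  ultimately have "\<phi> (k0 + d) \<le> \<phi> k0 * 0" by (intro LIMSEQ_le_const) auto
  then show ?thesis using nonneg[of "k0 + d"] by (simp add: d_def)
qed

section \<open>The uniform estimate\<close>

lemma integral_centered_eq_0:
  fixes u :: "'a::euclidean_space \<Rightarrow> real"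
  assumes "\<Omega> \<in> sets borel" "emeasure lborel \<Omega> < \<infinity>" "measure lborel \<Omega> > 0" "integrable lborel u"
  shows "(\<integral>x. u x + - ((\<integral>x. u x \<partial>lborel) / measure lborel \<Omega>) * indicator \<Omega> x \<partial>lborel) = 0"
proof -
  have "integrable lborel (indicator \<Omega> :: 'a \<Rightarrow> real)" using assms by (intro integrable_real_indicator) auto
  then show ?thesis using assms by simp
qed

text \<open>Testing the second equation with \<open>p\<close> minus its mean makes the penalty term nonnegative without
  any bound on \<open>q\<close>; testing the first with \<open>m\<close> minus its mean controls the coupling term.\<close>

lemma energy_estimate:
  fixes \<Omega> :: "'a::euclidean_space set" and p m q :: "'a \<Rightarrow> real"
  assumes \<Omega>: "open \<Omega>" "bounded \<Omega>" "measure lborel \<Omega> > 0" and P: "P > 0"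
    and Poin: "\<And>u g. H1_pair \<Omega> u g \<Longrightarrow>
      (\<integral>x. (u x - (\<integral>x. u x \<partial>lborel) / measure lborel \<Omega> * indicator \<Omega> x)\<^sup>2 \<partial>lborel)
        \<le> P * (\<integral>x. (norm (g x))\<^sup>2 \<partial>lborel)"
    and p: "H1_pair \<Omega> p gp" and m: "H1_pair \<Omega> m gm" and q: "H1_pair \<Omega> q gq"
    and pos: "\<epsilon> > 0" "\<tau> > 0" "s > 0"
    and eq1: "\<And>v gv. H1_pair \<Omega> v gv \<Longrightarrow>
      (\<integral>x. p x * v x \<partial>lborel) + \<tau> * (\<integral>x. gm x \<bullet> gv x \<partial>lborel) = (\<integral>x. q x * v x \<partial>lborel)"
    and eq2: "\<And>v gv. H1_pair \<Omega> v gv \<Longrightarrow> \<epsilon> * (\<integral>x. gp x \<bullet> gv x \<partial>lborel)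
      + s / \<epsilon> * (\<integral>x. obstacle_violation (p x) * v x \<partial>lborel) = (\<integral>x. (m x + 1 / \<epsilon> * q x) * v x \<partial>lborel)"
  shows "\<epsilon> * (\<integral>x. (norm (gp x))\<^sup>2 \<partial>lborel) + \<tau> * (\<integral>x. (norm (gm x))\<^sup>2 \<partial>lborel)
      \<le> (P / \<tau> + P / \<epsilon> ^ 3) * (\<integral>x. (q x)\<^sup>2 \<partial>lborel)"
    and "(\<integral>x. p x \<partial>lborel) = (\<integral>x. q x \<partial>lborel)"
proof -
  note DP = H1_pairD[OF p] and DM = H1_pairD[OF m] and DQ = H1_pairD[OF q]
  note [measurable] = DP(4,5) DM(4,5) DQ(4,5)
  have \<Omega>s [measurable]: "\<Omega> \<in> sets borel" using \<Omega>(1) by simp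
  have fin: "emeasure lborel \<Omega> < \<infinity>" using \<Omega>(2) by (rule emeasure_bounded_finite)
  have one: "H1_pair \<Omega> (indicator \<Omega>) (\<lambda>x. 0)" by (rule H1_pair_indicator[OF \<Omega>(1,2)])
  have u1: "(\<integral>x. u x * indicator \<Omega> x \<partial>lborel) = (\<integral>x. u x \<partial>lborel)" if "\<And>x. x \<notin> \<Omega> \<Longrightarrow> u x = 0" for u :: "'a \<Rightarrow> real"
    using that by (intro Bochner_Integration.integral_cong) (auto simp: indicator_def)
  \<comment> \<open>Conservation of mass: the constant 1 removes the gradient term from the first
    equation.\<close>
  show mass: "(\<integral>x. p x \<partial>lborel) = (\<integral>x. q x \<partial>lborel)"
    using eq1[OF one] u1[OF DP(8)] u1[OF DQ(8)] by simp
  define qb where "qb = (\<integral>x. p x \<partial>lborel) / measure lborel \<Omega>"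
  define mb where "mb = (\<integral>x. m x \<partial>lborel) / measure lborel \<Omega>"
  define p1 where "p1 x = p x + - qb * indicator \<Omega> x" for x
  define m1 where "m1 x = m x + - mb * indicator \<Omega> x" for x
  have Hp1: "H1_pair \<Omega> p1 gp" using H1_pair_add_cmult[OF p one, of "- qb"] by (simp add: p1_def[abs_def])
  have Hm1: "H1_pair \<Omega> m1 gm" using H1_pair_add_cmult[OF m one, of "- mb"] by (simp add: m1_def[abs_def])
  note P1 = H1_pairD[OF Hp1] and M1 = H1_pairD[OF Hm1]
  have ip1: "(\<integral>x. p1 x \<partial>lborel) = 0"
    unfolding p1_def qb_def by (rule integral_centered_eq_0[OF \<Omega>s fin \<Omega>(3) DP(2)])
  have im1: "(\<integral>x. m1 x \<partial>lborel) = 0"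
    unfolding m1_def mb_def by (rule integral_centered_eq_0[OF \<Omega>s fin \<Omega>(3) DM(2)])
  let ?X = "\<integral>x. (norm (gp x))\<^sup>2 \<partial>lborel" and ?Y = "\<integral>x. (norm (gm x))\<^sup>2 \<partial>lborel" and ?Q = "\<integral>x. (q x)\<^sup>2 \<partial>lborel"
  have p1P: "(\<integral>x. (p1 x)\<^sup>2 \<partial>lborel) \<le> P * ?X" using Poin[OF p] by (simp add: p1_def qb_def)
  have m1P: "(\<integral>x. (m1 x)\<^sup>2 \<partial>lborel) \<le> P * ?Y" using Poin[OF m] by (simp add: m1_def mb_def)
  note il2 = integrable_obstacle_violation_square[OF DP(4,6)]
  \<comment> \<open>Monotonicity of \<open>obstacle_violation\<close> bounds the integrand below by
    its value with p replaced by the constant qb, and that integrates to 0 since p1 has mean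
    zero.\<close>
  have penalty: "0 \<le> (\<integral>x. obstacle_violation (p x) * p1 x \<partial>lborel)"
  proof -
    have "(\<integral>x. obstacle_violation qb * p1 x \<partial>lborel) \<le> (\<integral>x. obstacle_violation (p x) * p1 x \<partial>lborel)"
    proof (rule integral_mono)
      show "integrable lborel (\<lambda>x. obstacle_violation qb * p1 x)" using P1(2) by simp
      show "integrable lborel (\<lambda>x. obstacle_violation (p x) * p1 x)"
        by (rule integrable_mult_L2[OF _ P1(4) il2 P1(6)]) simp
      fix x
      show "obstacle_violation qb * p1 x \<le> obstacle_violation (p x) * p1 x"
      proof (cases "x \<in> \<Omega>")
        case True
        then have e: "p1 x = p x - qb" by (simp add: p1_def)
        show ?thesis
        proof (cases "qb \<le> p x")
          case True
          then show ?thesis unfolding e using obstacle_violation_bounds(6)[OF True] by (intro mult_right_mono) auto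
        next
          case False
          then show ?thesis unfolding e using obstacle_violation_bounds(6)[of "p x" qb] by (intro mult_right_mono_neg) auto
        qed
      qed (use P1(8) in simp)
    qed
    then show ?thesis using ip1 by simp
  qed
  have imp: "integrable lborel (\<lambda>x. m x * p1 x)" and iqp: "integrable lborel (\<lambda>x. q x * p1 x)"
    and im1p1: "integrable lborel (\<lambda>x. m1 x * p1 x)"
    using integrable_mult_L2 DM(4,6) DQ(4,6) P1(4,6) M1(4,6) by blast+
  have e2: "\<epsilon> * ?X + s / \<epsilon> * (\<integral>x. obstacle_violation (p x) * p1 x \<partial>lborel)
      = (\<integral>x. m x * p1 x \<partial>lborel) + 1 / \<epsilon> * (\<integral>x. q x * p1 x \<partial>lborel)"
  proof -
    have "(\<integral>x. (m x + 1 / \<epsilon> * q x) * p1 x \<partial>lborel) = (\<integral>x. m x * p1 x + 1 / \<epsilon> * (q x * p1 x) \<partial>lborel)"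
      by (simp add: algebra_simps)
    also have "\<dots> = (\<integral>x. m x * p1 x \<partial>lborel) + 1 / \<epsilon> * (\<integral>x. q x * p1 x \<partial>lborel)"
      using imp iqp by simp
    finally show ?thesis using eq2[OF Hp1] by (simp add: power2_norm_eq_inner)
  qed
  \<comment> \<open>Centring may be moved from p to m because both p1 and m1 are orthogonal to
    constants. The centred m1 is then the test function of the first equation, and the gradient of m
    appears with a good sign.\<close>
  have e1: "(\<integral>x. m x * p1 x \<partial>lborel) = (\<integral>x. q x * m1 x \<partial>lborel) - \<tau> * ?Y"
  proof -
    have "(\<integral>x. m x * p1 x \<partial>lborel) = (\<integral>x. m1 x * p1 x + mb * p1 x \<partial>lborel)"
      using P1(8) by (intro Bochner_Integration.integral_cong refl) (auto simp: m1_def indicator_def algebra_simps)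
    also have "\<dots> = (\<integral>x. m1 x * p1 x \<partial>lborel)" using im1p1 P1(2) ip1 by simp
    also have "\<dots> = (\<integral>x. p x * m1 x + - qb * m1 x \<partial>lborel)"
      using M1(8) by (intro Bochner_Integration.integral_cong refl) (auto simp: p1_def indicator_def algebra_simps)
    also have "\<dots> = (\<integral>x. p x * m1 x \<partial>lborel)"
      using integrable_mult_L2[OF DP(4) M1(4) DP(6) M1(6)] M1(2) im1 by simp
    finally show ?thesis using eq1[OF Hm1] by (simp add: power2_norm_eq_inner)
  qed
  have y1: "(\<integral>x. q x * m1 x \<partial>lborel) \<le> \<tau> * ?Y / 2 + P / (2 * \<tau>) * ?Q"
  proof -
    \<comment> \<open>The weight \<tau> / P is chosen so that Poincare's inequality turns the first
      term into half of \<tau> times the gradient energy of m. The weight \<epsilon>^2 / P below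
      plays the same part for p.\<close>
    have "\<bar>\<integral>x. m1 x * q x \<partial>lborel\<bar> \<le> (\<tau> / P) / 2 * (\<integral>x. (m1 x)\<^sup>2 \<partial>lborel) + 1 / (2 * (\<tau> / P)) * ?Q"
      using pos P by (intro integral_Young M1(4,6) DQ(4,6)) auto
    moreover have "(\<tau> / P) / 2 * (\<integral>x. (m1 x)\<^sup>2 \<partial>lborel) \<le> (\<tau> / P) / 2 * (P * ?Y)"
      using m1P pos P by (intro mult_left_mono) auto
    moreover have "(\<tau> / P) / 2 * (P * ?Y) = \<tau> * ?Y / 2" "1 / (2 * (\<tau> / P)) = P / (2 * \<tau>)" using P by auto
    ultimately show ?thesis by (simp add: mult.commute[of "q _"] abs_le_iff)
  qed
  have y2: "1 / \<epsilon> * (\<integral>x. q x * p1 x \<partial>lborel) \<le> \<epsilon> * ?X / 2 + P / (2 * \<epsilon> ^ 3) * ?Q"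
  proof -
    have "\<bar>\<integral>x. p1 x * q x \<partial>lborel\<bar> \<le> (\<epsilon>\<^sup>2 / P) / 2 * (\<integral>x. (p1 x)\<^sup>2 \<partial>lborel) + 1 / (2 * (\<epsilon>\<^sup>2 / P)) * ?Q"
      using pos P by (intro integral_Young P1(4,6) DQ(4,6)) auto
    moreover have "(\<epsilon>\<^sup>2 / P) / 2 * (\<integral>x. (p1 x)\<^sup>2 \<partial>lborel) \<le> (\<epsilon>\<^sup>2 / P) / 2 * (P * ?X)"
      using p1P pos P by (intro mult_left_mono) auto
    ultimately have "(\<integral>x. q x * p1 x \<partial>lborel) \<le> (\<epsilon>\<^sup>2 / P) / 2 * (P * ?X) + 1 / (2 * (\<epsilon>\<^sup>2 / P)) * ?Q"
      by (simp add: mult.commute[of "q _"] abs_le_iff)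
    then have "1 / \<epsilon> * (\<integral>x. q x * p1 x \<partial>lborel) \<le> 1 / \<epsilon> * ((\<epsilon>\<^sup>2 / P) / 2 * (P * ?X) + 1 / (2 * (\<epsilon>\<^sup>2 / P)) * ?Q)"
      using pos by (intro mult_left_mono) auto
    also have "\<dots> = \<epsilon> * ?X / 2 + P / (2 * \<epsilon> ^ 3) * ?Q"
      using pos P by (simp add: field_simps power2_eq_square power3_eq_cube)
    finally show ?thesis .
  qed
  have "0 \<le> s / \<epsilon> * (\<integral>x. obstacle_violation (p x) * p1 x \<partial>lborel)" using penalty pos by simp
  then have "\<epsilon> * ?X + \<tau> * ?Y \<le> \<epsilon> * ?X / 2 + P / (2 * \<epsilon> ^ 3) * ?Q + (\<tau> * ?Y / 2 + P / (2 * \<tau>) * ?Q)"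
    using e1 e2 y1 y2 by linarith
  then show "\<epsilon> * ?X + \<tau> * ?Y \<le> (P / \<tau> + P / \<epsilon> ^ 3) * ?Q" by (simp add: algebra_simps)
qed

text \<open>Markov's inequality at the starting level followed by the iteration. The decay is
  available only from level N / |\<Omega>| upwards, so the starting level contains this
  summand.\<close>

lemma one_sided_bound:
  fixes \<Omega> :: "'a::euclidean_space set" and p :: "'a \<Rightarrow> real"
  assumes \<Omega>: "open \<Omega>" "bounded \<Omega>" "measure lborel \<Omega> > 0" and p: "H1_pair \<Omega> p gp"
    and C: "C > 0" and \<gamma>: "\<gamma> > 0"
    and N: "N = (\<integral>x. \<bar>obstacle_violation (p x)\<bar> \<partial>lborel)" "N > 0" "N \<le> Nmax"
    and decay: "\<And>k h. N / measure lborel \<Omega> \<le> k \<Longrightarrow> k < h \<Longrightarrow>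
      (h - k) * measure lborel {x. p x > 1 + h} \<le> C * measure lborel {x. p x > 1 + k} powr (1 + \<gamma>)"
  shows "AE x in lborel. p x \<le> 1 + (1 + Nmax powr (1 / (1 + \<gamma>)) / measure lborel \<Omega> + 2 * 2 powr (1 / \<gamma>) * C) * N powr (\<gamma> / (1 + \<gamma>))"
proof -
  note DP = H1_pairD[OF p]
  note [measurable] = DP(4)
  have Am [measurable]: "{x. p x > 1 + k} \<in> sets borel" for k by measurable
  have fin: "emeasure lborel {x. p x > 1 + k} < \<infinity>" if "k \<ge> 0" for k
  proof (rule emeasure_bounded_finite)
    have "{x. p x > 1 + k} \<subseteq> \<Omega>" using DP(8) that by force
    then show "bounded {x. p x > 1 + k}" using \<Omega>(2) bounded_subset by blast
  qed
  let ?\<omega> = "measure lborel \<Omega>"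
  \<comment> \<open>The solution of e = (1 - e) * \<gamma>, which makes starting level and added
    height of the same order N powr e.\<close>
  define e where "e = \<gamma> / (1 + \<gamma>)"
  have e: "1 - e = 1 / (1 + \<gamma>)" "e = (1 - e) * \<gamma>" using \<gamma> by (auto simp: e_def field_simps)
  define k0 where "k0 = N powr e + N / ?\<omega>"
  have k0: "N powr e \<le> k0" "N / ?\<omega> \<le> k0" "0 < k0"
    using N(2) \<Omega>(3) by (auto simp: k0_def intro!: add_pos_pos)
  have NN: "N / ?\<omega> \<ge> 0" using N(2) \<Omega>(3) by simp
  \<comment> \<open>Frozen below N / |\<Omega>|, so that \<phi> is monotone on all reals: every set
    involved lies in \<Omega> and has finite measure.\<close>
  define \<phi> where "\<phi> k = measure lborel {x. p x > 1 + max (N / ?\<omega>) k}" for k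
  have \<phi>eq: "\<phi> k = measure lborel {x. p x > 1 + k}" if "N / ?\<omega> \<le> k" for k using that by (simp add: \<phi>_def)
  define d where "d = 2 * 2 powr (1 / \<gamma>) * C * \<phi> k0 powr \<gamma>"
  have "\<phi> (k0 + d) = 0"
    unfolding d_def
  proof (rule Stampacchia_iteration[OF _ _ C \<gamma>])
    show "0 \<le> \<phi> k" for k by (simp add: \<phi>_def)
    show "\<phi> h \<le> \<phi> k" if "k \<le> h" for k h
      unfolding \<phi>_def using that fin[of "max (N / ?\<omega>) k"] NN
      by (intro measure_mono_fmeasurable) (auto simp: fmeasurable_def)
    show "(h - k) * \<phi> h \<le> C * \<phi> k powr (1 + \<gamma>)" if "k0 \<le> k" "k < h" for k h
      using decay[of k h] that k0(2) by (simp add: \<phi>eq)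
  qed
  moreover have d0: "d \<ge> 0" using C by (simp add: d_def)
  ultimately have z: "measure lborel {x. p x > 1 + (k0 + d)} = 0" using k0(2) by (simp add: \<phi>eq)
  have "emeasure lborel {x. p x > 1 + (k0 + d)} = 0"
    using z fin[of "k0 + d"] k0(3) d0 by (simp add: emeasure_eq_ennreal_measure less_top[symmetric])
  then have "{x. p x > 1 + (k0 + d)} \<in> null_sets lborel" by (simp add: null_sets_def)
  then have AE: "AE x in lborel. p x \<le> 1 + (k0 + d)" by (rule AE_I') auto
  \<comment> \<open>Markov's inequality: where p > 1 + k0 the violation exceeds k0 \<ge> N powr
    e.\<close>
  have "N powr e * \<phi> k0 \<le> N"
  proof -
    have il: "integrable lborel (\<lambda>x. \<bar>obstacle_violation (p x)\<bar>)"
      by (rule Bochner_Integration.integrable_bound[OF DP(2)]) (auto simp: obstacle_violation_bounds(1))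
    have "N powr e * \<phi> k0 = (\<integral>x. N powr e * indicator {x. p x > 1 + k0} x \<partial>lborel)"
      using k0(2) by (simp add: \<phi>eq)
    also have "\<dots> \<le> (\<integral>x. \<bar>obstacle_violation (p x)\<bar> \<partial>lborel)"
    proof (rule integral_mono[OF _ il])
      show "integrable lborel (\<lambda>x. N powr e * indicator {x. p x > 1 + k0} x)"
        using fin[of k0] k0(3) by (intro integrable_mult_right integrable_real_indicator) auto
      fix x
      show "N powr e * indicator {x. p x > 1 + k0} x \<le> \<bar>obstacle_violation (p x)\<bar>"
        using k0 obstacle_violation_bounds(4)[of "p x"] by (auto simp: indicator_def)
    qed
    finally show ?thesis using N(1) by simp
  qed
  also have "N = N powr e * N powr (1 - e)" using N(2) by (simp add: powr_add[symmetric])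
  finally have "\<phi> k0 \<le> N powr (1 - e)" by (rule mult_left_le_imp_le) (use N(2) in simp)
  then have "\<phi> k0 powr \<gamma> \<le> (N powr (1 - e)) powr \<gamma>" using \<gamma> by (intro powr_mono2) (auto simp: \<phi>_def)
  also have "\<dots> = N powr e" using e(2) by (simp add: powr_powr)
  finally have "d \<le> 2 * 2 powr (1 / \<gamma>) * C * N powr e" unfolding d_def using C by (intro mult_left_mono) auto
  \<comment> \<open>The linear term is of lower order only for bounded N; here the uniform bound
    Nmax is spent.\<close>
  moreover have "N / ?\<omega> \<le> Nmax powr (1 / (1 + \<gamma>)) / ?\<omega> * N powr e"
  proof -
    have "N = N powr (1 - e) * N powr e" using N(2) by (simp add: powr_add[symmetric])
    also have "\<dots> \<le> Nmax powr (1 - e) * N powr e" using N \<gamma> e(1) by (intro mult_right_mono powr_mono2) auto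
    finally have "N / ?\<omega> \<le> Nmax powr (1 - e) * N powr e / ?\<omega>" using \<Omega>(3) by (intro divide_right_mono) auto
    then show ?thesis by (simp add: e(1))
  qed
  ultimately have "k0 + d \<le> (1 + Nmax powr (1 / (1 + \<gamma>)) / ?\<omega> + 2 * 2 powr (1 / \<gamma>) * C) * N powr e"
    unfolding k0_def distrib_right by simp
  then show ?thesis
    using AE unfolding e_def[symmetric] by (auto elim!: eventually_mono)
qed

text \<open>Rewrites both equations as integrals over the whole space against arbitrary pairs, with
  the old phase field moved to the right-hand side. \<open>H1_pair_imp_H1_space\<close> makes each
  pair an admissible test function with gradient gv.\<close>

lemma relaxed_CH_solution_borel_rep:
  fixes \<Omega> :: "'a::euclidean_space set"
  assumes \<Omega>: "open \<Omega>" "bounded \<Omega>" and sol: "relaxed_CH_solution \<Omega> \<epsilon> \<tau> \<phi>old s \<phi> \<mu>"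
    and q: "borel_rep \<Omega> \<phi>old q" "\<phi>old \<in> borel_measurable (lebesgue_on \<Omega>)" "H1_pair \<Omega> q gq"
  obtains p gp m gm where "H1_pair \<Omega> p gp" "H1_pair \<Omega> m gm" "borel_rep \<Omega> \<phi> p" "\<phi> \<in> borel_measurable (lebesgue_on \<Omega>)"
    "\<And>v gv. H1_pair \<Omega> v gv \<Longrightarrow> (\<integral>x. p x * v x \<partial>lborel) + \<tau> * (\<integral>x. gm x \<bullet> gv x \<partial>lborel) = (\<integral>x. q x * v x \<partial>lborel)"
    "\<And>v gv. H1_pair \<Omega> v gv \<Longrightarrow> \<epsilon> * (\<integral>x. gp x \<bullet> gv x \<partial>lborel)
      + s / \<epsilon> * (\<integral>x. obstacle_violation (p x) * v x \<partial>lborel) = (\<integral>x. (m x + 1 / \<epsilon> * q x) * v x \<partial>lborel)"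
proof -
  have \<phi>: "\<phi> \<in> H1_space \<Omega>" and \<mu>: "\<mu> \<in> H1_space \<Omega>" using sol by (auto simp: relaxed_CH_solution_def)
  obtain p gp where P: "H1_pair \<Omega> p gp" "borel_rep \<Omega> \<phi> p" "borel_rep \<Omega> (weak_grad \<Omega> \<phi>) gp"
    "\<phi> \<in> borel_measurable (lebesgue_on \<Omega>)" "weak_grad \<Omega> \<phi> \<in> borel_measurable (lebesgue_on \<Omega>)"
    using H1_space_borel_rep[OF \<Omega> \<phi>] by metis
  obtain m gm where M: "H1_pair \<Omega> m gm" "borel_rep \<Omega> \<mu> m" "borel_rep \<Omega> (weak_grad \<Omega> \<mu>) gm"
    "\<mu> \<in> borel_measurable (lebesgue_on \<Omega>)" "weak_grad \<Omega> \<mu> \<in> borel_measurable (lebesgue_on \<Omega>)"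
    using H1_space_borel_rep[OF \<Omega> \<mu>] by metis
  show ?thesis
  proof (rule that[OF P(1) M(1) P(2) P(4)])
    fix v gv assume v: "H1_pair \<Omega> v gv"
    note V = H1_pair_imp_H1_space[OF \<Omega> v]
    note I = L2_inner_borel_rep[OF \<Omega>(1)]
    have "L2_inner \<Omega> \<phi> v + \<tau> * L2_inner \<Omega> (weak_grad \<Omega> \<mu>) (weak_grad \<Omega> v) = L2_inner \<Omega> \<phi>old v"
      using sol V(1) by (simp add: relaxed_CH_solution_def)
    then show "(\<integral>x. p x * v x \<partial>lborel) + \<tau> * (\<integral>x. gm x \<bullet> gv x \<partial>lborel) = (\<integral>x. q x * v x \<partial>lborel)"
      using I[OF P(4) V(4) P(2) V(2)] I[OF M(5) V(5) M(3) V(3)] I[OF q(2) V(4) q(1) V(2)] by simp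
    have ro: "borel_rep \<Omega> (\<lambda>x. s * obstacle_violation (\<phi> x)) (\<lambda>x. s * obstacle_violation (p x))"
      by (rule borel_rep_compose[OF P(2)]) (auto simp: obstacle_violation_bounds(3))
    have mo: "(\<lambda>x. s * obstacle_violation (\<phi> x)) \<in> borel_measurable (lebesgue_on \<Omega>)"
      using measurable_compose[OF P(4) obstacle_violation_measurable] by simp
    have "\<epsilon> * L2_inner \<Omega> (weak_grad \<Omega> \<phi>) (weak_grad \<Omega> v)
        + inverse \<epsilon> * L2_inner \<Omega> (\<lambda>x. s * obstacle_violation (\<phi> x)) v
        - inverse \<epsilon> * L2_inner \<Omega> \<phi>old v = L2_inner \<Omega> \<mu> v"
      using sol V(1) by (simp add: relaxed_CH_solution_def)
    then have "\<epsilon> * (\<integral>x. gp x \<bullet> gv x \<partial>lborel) + inverse \<epsilon> * (\<integral>x. s * obstacle_violation (p x) * v x \<partial>lborel)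
        - inverse \<epsilon> * (\<integral>x. q x * v x \<partial>lborel) = (\<integral>x. m x * v x \<partial>lborel)"
      using I[OF P(5) V(5) P(3) V(3)] I[OF mo V(4) ro V(2)] I[OF q(2) V(4) q(1) V(2)] I[OF M(4) V(4) M(2) V(2)] by simp
    moreover have "(\<integral>x. s * obstacle_violation (p x) * v x \<partial>lborel) = s * (\<integral>x. obstacle_violation (p x) * v x \<partial>lborel)"
      by (simp only: mult.assoc integral_mult_right_zero)
    moreover have "(\<integral>x. (m x + 1 / \<epsilon> * q x) * v x \<partial>lborel) = (\<integral>x. m x * v x \<partial>lborel) + 1 / \<epsilon> * (\<integral>x. q x * v x \<partial>lborel)"
    proof -
      have "integrable lborel (\<lambda>x. m x * v x)" "integrable lborel (\<lambda>x. q x * v x)"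
        using integrable_mult_L2 H1_pairD(4,6)[OF v] H1_pairD(4,6)[OF M(1)] H1_pairD(4,6)[OF q(3)] by blast+
      then have "(\<integral>x. m x * v x + 1 / \<epsilon> * (q x * v x) \<partial>lborel) = (\<integral>x. m x * v x \<partial>lborel) + 1 / \<epsilon> * (\<integral>x. q x * v x \<partial>lborel)"
        by simp
      then show ?thesis by (simp add: algebra_simps)
    qed
    ultimately show "\<epsilon> * (\<integral>x. gp x \<bullet> gv x \<partial>lborel)
      + s / \<epsilon> * (\<integral>x. obstacle_violation (p x) * v x \<partial>lborel) = (\<integral>x. (m x + 1 / \<epsilon> * q x) * v x \<partial>lborel)"
      by (simp add: divide_inverse mult_ac)
  qed
qed

text \<open>K is assembled before s is introduced: the energy estimate bounds the centred right-hand
  side by D and the L^1 norm of the violation by Nmax, both in terms of the domain, \<epsilon>,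
  \<tau> and q alone. The two signs of the violation are treated by applying the one-sided bound to
  p and to -p.\<close>

lemma obstacle_violation_uniform_bound:
  fixes \<Omega> :: "'a::euclidean_space set" and q :: "'a \<Rightarrow> real"
  assumes \<Omega>: "open \<Omega>" "connected \<Omega>" "\<Omega> \<noteq> {}" "bounded \<Omega>" "cone_condition \<Omega>"
    and \<epsilon>: "\<epsilon> > 0" and \<tau>: "\<tau> > 0" and q: "H1_pair \<Omega> q gq"
    and \<gamma>: "0 < \<gamma>" "\<gamma> < 2 / real DIM('a) - 1 / 2"
  shows "\<exists>K>0. \<forall>s p gp m gm. s \<ge> \<epsilon>\<^sup>2 \<longrightarrow> H1_pair \<Omega> p gp \<longrightarrow> H1_pair \<Omega> m gm \<longrightarrow>
    (\<forall>v gv. H1_pair \<Omega> v gv \<longrightarrow> (\<integral>x. p x * v x \<partial>lborel) + \<tau> * (\<integral>x. gm x \<bullet> gv x \<partial>lborel) = (\<integral>x. q x * v x \<partial>lborel)) \<longrightarrow>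
    (\<forall>v gv. H1_pair \<Omega> v gv \<longrightarrow> \<epsilon> * (\<integral>x. gp x \<bullet> gv x \<partial>lborel)
      + s / \<epsilon> * (\<integral>x. obstacle_violation (p x) * v x \<partial>lborel) = (\<integral>x. (m x + 1 / \<epsilon> * q x) * v x \<partial>lborel)) \<longrightarrow>
    (AE x in lborel. \<bar>obstacle_violation (p x)\<bar>
      \<le> K * (\<integral>x. \<bar>obstacle_violation (p x)\<bar> \<partial>lborel) powr (\<gamma> / (1 + \<gamma>)))"
proof -
  let ?\<omega> = "measure lborel \<Omega>" and ?n = "real DIM('a)"
  have \<Omega>s [measurable]: "\<Omega> \<in> sets borel" using \<Omega>(1) by simp
  have fin: "emeasure lborel \<Omega> < \<infinity>" using \<Omega>(4) by (rule emeasure_bounded_finite)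
  have \<omega>: "?\<omega> > 0" by (rule measure_open_pos[OF \<Omega>(1,4,3)])
  \<comment> \<open>Solves 2 * \<theta> + 1/2 = 1 + \<gamma>; the upper bound on \<gamma> is
    precisely \<theta> < 1 / n.\<close>
  define \<theta> where "\<theta> = (\<gamma> + 1/2) / 2"
  have \<theta>: "0 < \<theta>" "\<theta> < 1 / ?n" "2 * \<theta> + 1/2 = 1 + \<gamma>" using \<gamma> by (auto simp: \<theta>_def field_simps)
  obtain C where C: "C > 0" and Schur: "\<And>u g a A l. H1_pair \<Omega> u g \<Longrightarrow> A \<in> sets borel \<Longrightarrow> A \<subseteq> \<Omega> \<Longrightarrow>
      (\<And>x. x \<notin> A \<Longrightarrow> u x = 0 \<and> g x = 0) \<Longrightarrow> a \<in> borel_measurable borel \<Longrightarrow>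
      integrable lborel (\<lambda>x. (a x)\<^sup>2) \<Longrightarrow> l > 0 \<Longrightarrow>
      (\<integral>x. \<bar>a x\<bar> * \<bar>u x\<bar> \<partial>lborel) \<le> C * measure lborel A powr \<theta> * (l * (\<integral>x. (a x)\<^sup>2 \<partial>lborel)
        + 1 / l * ((\<integral>x. (u x)\<^sup>2 \<partial>lborel) + (\<integral>x. (norm (g x))\<^sup>2 \<partial>lborel)))"
    using H1_Schur_bound[OF \<Omega> \<theta>(1,2)] by blast
  obtain P where P: "P > 0" and Poin: "\<And>u g. H1_pair \<Omega> u g \<Longrightarrow>
      (\<integral>x. (u x - (\<integral>x. u x \<partial>lborel) / measure lborel \<Omega> * indicator \<Omega> x)\<^sup>2 \<partial>lborel)
        \<le> P * (\<integral>x. (norm (g x))\<^sup>2 \<partial>lborel)"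
    using L2_Poincare[OF \<Omega>] by blast
  note DQ = H1_pairD[OF q]
  define Q where "Q = (\<integral>x. (q x)\<^sup>2 \<partial>lborel)"
  define qb where "qb = (\<integral>x. q x \<partial>lborel) / ?\<omega>"
  define E where "E = (P / \<tau> + P / \<epsilon> ^ 3) * Q"
  have Q0: "Q \<ge> 0" unfolding Q_def by (intro Bochner_Integration.integral_nonneg) simp
  have E0: "E \<ge> 0" unfolding E_def using P \<tau> \<epsilon> Q0 by (intro mult_nonneg_nonneg add_nonneg_nonneg) auto
  \<comment> \<open>From (a + b)^2 \<le> 2 * a^2 + 2 * b^2 for the centred m and the centred q /
    \<epsilon>: Poincare's inequality with the energy bound for the first, minimality of the mean
    for the second.\<close>
  define D where "D = 2 * (P * E / \<tau>) + 2 * (Q / \<epsilon>\<^sup>2)"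
  have D0: "D \<ge> 0" unfolding D_def using P E0 \<tau> \<epsilon> Q0 by simp
  \<comment> \<open>From |p| \<le> p^2 + 1 \<le> 2 * p1^2 + 2 * qb^2 + 1 on \<Omega>, with p1 = p -
    qb controlled by Poincare's inequality and the mean qb of p known by conservation of
    mass.\<close>
  define Nmax where "Nmax = 2 * (P * E / \<epsilon>) + (2 * qb\<^sup>2 + 1) * ?\<omega>"
  have Nmax: "Nmax > 0" unfolding Nmax_def using P E0 \<epsilon> \<omega> by (intro add_nonneg_pos mult_pos_pos) (auto intro: add_nonneg_pos)
  define C' where "C' = 4 * C * (1 + 4 * C\<^sup>2 * D / \<epsilon>\<^sup>2)"
  have C': "C' > 0" unfolding C'_def using C D0 by (intro mult_pos_pos add_pos_nonneg) auto
  define K where "K = 1 + Nmax powr (1 / (1 + \<gamma>)) / ?\<omega> + 2 * 2 powr (1 / \<gamma>) * C'"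
  have K: "K > 0" unfolding K_def using C' \<omega> by (intro add_pos_nonneg) auto
  show ?thesis
  proof (rule exI[of _ K], rule conjI[OF K], intro allI impI)
    fix s :: real and p m :: "'a \<Rightarrow> real" and gp gm
    assume s: "s \<ge> \<epsilon>\<^sup>2" and p: "H1_pair \<Omega> p gp" and m: "H1_pair \<Omega> m gm"
      and "\<forall>v gv. H1_pair \<Omega> v gv \<longrightarrow> (\<integral>x. p x * v x \<partial>lborel) + \<tau> * (\<integral>x. gm x \<bullet> gv x \<partial>lborel) = (\<integral>x. q x * v x \<partial>lborel)"
      and "\<forall>v gv. H1_pair \<Omega> v gv \<longrightarrow> \<epsilon> * (\<integral>x. gp x \<bullet> gv x \<partial>lborel)
      + s / \<epsilon> * (\<integral>x. obstacle_violation (p x) * v x \<partial>lborel) = (\<integral>x. (m x + 1 / \<epsilon> * q x) * v x \<partial>lborel)"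
    then have eq1: "\<And>v gv. H1_pair \<Omega> v gv \<Longrightarrow> (\<integral>x. p x * v x \<partial>lborel) + \<tau> * (\<integral>x. gm x \<bullet> gv x \<partial>lborel) = (\<integral>x. q x * v x \<partial>lborel)"
      and eq2: "\<And>v gv. H1_pair \<Omega> v gv \<Longrightarrow> \<epsilon> * (\<integral>x. gp x \<bullet> gv x \<partial>lborel)
      + s / \<epsilon> * (\<integral>x. obstacle_violation (p x) * v x \<partial>lborel) = (\<integral>x. (m x + 1 / \<epsilon> * q x) * v x \<partial>lborel)"
      by blast+
    note DP = H1_pairD[OF p] and DM = H1_pairD[OF m]
    note [measurable] = DP(4,5) DM(4,5) DQ(4,5)
    have s0: "s > 0" using \<epsilon> s by (meson less_le_trans zero_less_power)
    let ?X = "\<integral>x. (norm (gp x))\<^sup>2 \<partial>lborel" and ?Y = "\<integral>x. (norm (gm x))\<^sup>2 \<partial>lborel"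
    note energy = energy_estimate[OF \<Omega>(1,4) \<omega> P Poin p m q \<epsilon> \<tau> s0 eq1 eq2]
    have X0: "?X \<ge> 0" "?Y \<ge> 0" by (auto intro: Bochner_Integration.integral_nonneg)
    have "\<epsilon> * ?X + \<tau> * ?Y \<le> E" using energy(1) by (simp add: E_def Q_def)
    moreover have "0 \<le> \<epsilon> * ?X" "0 \<le> \<tau> * ?Y" using X0 \<epsilon> \<tau> by auto
    ultimately have "\<epsilon> * ?X \<le> E" "\<tau> * ?Y \<le> E" by linarith+
    then have X: "?X \<le> E / \<epsilon>" and Y: "?Y \<le> E / \<tau>" using \<epsilon> \<tau> by (auto simp: field_simps)
    define f where "f x = m x + 1 / \<epsilon> * q x" for x
    define c where "c = (\<integral>x. f x \<partial>lborel) / ?\<omega>"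
    define mb where "mb = (\<integral>x. m x \<partial>lborel) / ?\<omega>"
    have cmb: "c = mb + 1 / \<epsilon> * qb" using DM(2) DQ(2) by (simp add: c_def f_def mb_def qb_def add_divide_distrib)
    have fm [measurable]: "f \<in> borel_measurable borel" by (simp add: f_def[abs_def])
    have f2: "integrable lborel (\<lambda>x. (f x)\<^sup>2)"
      using integrable_power2_add[of m "\<lambda>x. 1 / \<epsilon> * q x"] DM(4,6) DQ(4,6) by (simp add: f_def power_mult_distrib power_divide)
    have one: "H1_pair \<Omega> (indicator \<Omega>) (\<lambda>x. 0)" by (rule H1_pair_indicator[OF \<Omega>(1,4)])
    have Dle: "(\<integral>x. (f x - c * indicator \<Omega> x)\<^sup>2 \<partial>lborel) \<le> D"
    proof -
      define m1 where "m1 x = m x + - mb * indicator \<Omega> x" for x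
      define q1 where "q1 x = q x + - qb * indicator \<Omega> x" for x
      have Hm1: "H1_pair \<Omega> m1 (\<lambda>x. gm x + - mb *\<^sub>R 0)" unfolding m1_def[abs_def] by (rule H1_pair_add_cmult[OF m one])
      have Hq1: "H1_pair \<Omega> q1 (\<lambda>x. gq x + - qb *\<^sub>R 0)" unfolding q1_def[abs_def] by (rule H1_pair_add_cmult[OF q one])
      have i: "integrable lborel (\<lambda>x. 2 * (m1 x)\<^sup>2 + 2 / \<epsilon>\<^sup>2 * (q1 x)\<^sup>2)" using H1_pairD(6)[OF Hm1] H1_pairD(6)[OF Hq1] by simp
      have le: "(f x - c * indicator \<Omega> x)\<^sup>2 \<le> 2 * (m1 x)\<^sup>2 + 2 / \<epsilon>\<^sup>2 * (q1 x)\<^sup>2" for x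
      proof -
        have "f x - c * indicator \<Omega> x = m1 x + 1 / \<epsilon> * q1 x" by (simp add: f_def cmb m1_def q1_def algebra_simps)
        moreover have "(a + b)\<^sup>2 \<le> 2 * a\<^sup>2 + 2 * b\<^sup>2" for a b :: real
          using zero_le_power2[of "a - b"] by (simp add: power2_sum power2_diff)
        ultimately have "(f x - c * indicator \<Omega> x)\<^sup>2 \<le> 2 * (m1 x)\<^sup>2 + 2 * (1 / \<epsilon> * q1 x)\<^sup>2" by metis
        then show ?thesis by (simp add: power_mult_distrib power_divide)
      qed
      have "(\<integral>x. (f x - c * indicator \<Omega> x)\<^sup>2 \<partial>lborel) \<le> (\<integral>x. 2 * (m1 x)\<^sup>2 + 2 / \<epsilon>\<^sup>2 * (q1 x)\<^sup>2 \<partial>lborel)"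
      proof (rule integral_mono[OF _ i le])
        show "integrable lborel (\<lambda>x. (f x - c * indicator \<Omega> x)\<^sup>2)"
          by (rule Bochner_Integration.integrable_bound[OF i]) (use le in \<open>auto intro!: always_eventually\<close>)
      qed
      also have "\<dots> = 2 * (\<integral>x. (m1 x)\<^sup>2 \<partial>lborel) + 2 / \<epsilon>\<^sup>2 * (\<integral>x. (q1 x)\<^sup>2 \<partial>lborel)"
        using H1_pairD(6)[OF Hm1] H1_pairD(6)[OF Hq1] by simp
      also have "\<dots> \<le> 2 * (P * (E / \<tau>)) + 2 / \<epsilon>\<^sup>2 * Q"
      proof (intro add_mono mult_left_mono)
        have "(\<integral>x. (m1 x)\<^sup>2 \<partial>lborel) \<le> P * ?Y" using Poin[OF m] by (simp add: m1_def mb_def)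
        also have "\<dots> \<le> P * (E / \<tau>)" using Y P by (intro mult_left_mono) auto
        finally show "(\<integral>x. (m1 x)\<^sup>2 \<partial>lborel) \<le> P * (E / \<tau>)" .
        show "(\<integral>x. (q1 x)\<^sup>2 \<partial>lborel) \<le> Q"
          using L2_mean_minimal[OF \<Omega>s fin \<omega> DQ(2,6,8), of 0] by (simp add: q1_def qb_def Q_def)
      qed auto
      finally show ?thesis by (simp add: D_def)
    qed
    define N where "N = (\<integral>x. \<bar>obstacle_violation (p x)\<bar> \<partial>lborel)"
    have il: "integrable lborel (\<lambda>x. obstacle_violation (p x))"
      by (rule Bochner_Integration.integrable_bound[OF DP(2)]) (auto simp: obstacle_violation_bounds(1))
    have N0: "N \<ge> 0" unfolding N_def by (intro Bochner_Integration.integral_nonneg) simp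
    have NNmax: "N \<le> Nmax"
    proof -
      define p1 where "p1 x = p x + - qb * indicator \<Omega> x" for x
      have Hp1: "H1_pair \<Omega> p1 (\<lambda>x. gp x + - qb *\<^sub>R 0)" unfolding p1_def[abs_def] by (rule H1_pair_add_cmult[OF p one])
      have i\<Omega>: "integrable lborel (indicator \<Omega> :: 'a \<Rightarrow> real)" using fin by (intro integrable_real_indicator) auto
      have le: "\<bar>obstacle_violation (p x)\<bar> \<le> 2 * (p1 x)\<^sup>2 + (2 * qb\<^sup>2 + 1) * indicator \<Omega> x" for x
      proof (cases "x \<in> \<Omega>")
        case True
        have sq: "2 * \<bar>a\<bar> \<le> a\<^sup>2 + 1" for a :: real
          using zero_le_power2[of "\<bar>a\<bar> - 1"] by (simp add: power2_diff)
        have "(a + b)\<^sup>2 \<le> 2 * a\<^sup>2 + 2 * b\<^sup>2" for a b :: real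
          using zero_le_power2[of "a - b"] by (simp add: power2_sum power2_diff)
        from this[of "p1 x" qb] have "(p x)\<^sup>2 \<le> 2 * (p1 x)\<^sup>2 + 2 * qb\<^sup>2" using True by (simp add: p1_def)
        then show ?thesis
          using sq[of "p x"] obstacle_violation_bounds(1)[of "p x"] abs_ge_zero[of "p x"] True by simp
      qed (use DP(8) in \<open>simp add: obstacle_violation_bounds(3)\<close>)
      have "N \<le> (\<integral>x. 2 * (p1 x)\<^sup>2 + (2 * qb\<^sup>2 + 1) * indicator \<Omega> x \<partial>lborel)"
        unfolding N_def using il H1_pairD(6)[OF Hp1] i\<Omega> le by (intro integral_mono) auto
      also have "\<dots> = 2 * (\<integral>x. (p1 x)\<^sup>2 \<partial>lborel) + (2 * qb\<^sup>2 + 1) * ?\<omega>"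
        using H1_pairD(6)[OF Hp1] i\<Omega> by simp
      also have "(\<integral>x. (p1 x)\<^sup>2 \<partial>lborel) \<le> P * ?X" using Poin[OF p] energy(2) by (simp add: p1_def qb_def)
      also have "P * ?X \<le> P * (E / \<epsilon>)" using X P by (intro mult_left_mono) auto
      finally show ?thesis by (simp add: Nmax_def)
    qed
    \<comment> \<open>Testing with 1 identifies \<epsilon> / s * c as the mean of the violation. Its
      modulus is at most N / |\<Omega>|, so levels above N / |\<Omega>| satisfy the condition of
      \<open>level_set_decay\<close> for both signs.\<close>
    have c_eq: "\<epsilon> / s * c = (\<integral>x. obstacle_violation (p x) \<partial>lborel) / ?\<omega>"
    proof -
      have "(\<integral>x. obstacle_violation (p x) * indicator \<Omega> x \<partial>lborel) = (\<integral>x. obstacle_violation (p x) \<partial>lborel)"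
        using DP(8) by (intro Bochner_Integration.integral_cong) (auto simp: indicator_def obstacle_violation_bounds(3))
      moreover have "(\<integral>x. (m x + 1 / \<epsilon> * q x) * indicator \<Omega> x \<partial>lborel) = (\<integral>x. f x \<partial>lborel)"
        using DM(8) DQ(8) by (intro Bochner_Integration.integral_cong) (auto simp: indicator_def f_def)
      ultimately have "s / \<epsilon> * (\<integral>x. obstacle_violation (p x) \<partial>lborel) = c * ?\<omega>"
        using eq2[OF one] \<omega> by (simp add: c_def)
      then show ?thesis using s0 \<epsilon> \<omega> by (simp add: field_simps)
    qed
    have absI: "\<bar>\<integral>x. obstacle_violation (p x) \<partial>lborel\<bar> \<le> N" unfolding N_def by (rule integral_abs_bound)
    show "AE x in lborel. \<bar>obstacle_violation (p x)\<bar> \<le> K * (\<integral>x. \<bar>obstacle_violation (p x)\<bar> \<partial>lborel) powr (\<gamma> / (1 + \<gamma>))"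
    \<comment> \<open>\<open>one_sided_bound\<close> requires N > 0; for N = 0 the violation
      vanishes almost everywhere.\<close>
    proof (cases "N = 0")
      case True
      then have "AE x in lborel. \<bar>obstacle_violation (p x)\<bar> = 0"
        unfolding N_def using il by (subst (asm) integral_nonneg_eq_0_iff_AE) auto
      then show ?thesis by eventually_elim (use K in simp)
    next
      case False
      then have N: "N > 0" using N0 by simp
      let ?B = "K * N powr (\<gamma> / (1 + \<gamma>))"
      have up: "AE x in lborel. p x \<le> 1 + ?B"
        unfolding K_def
      proof (rule one_sided_bound[OF \<Omega>(1,4) \<omega> p C' \<gamma>(1) N_def N NNmax])
        fix k h assume k: "N / ?\<omega> \<le> k" "k < h"
        have "\<epsilon> / s * c \<le> N / ?\<omega>" unfolding c_eq using absI \<omega> by (intro divide_right_mono) auto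
        moreover have "0 \<le> N / ?\<omega>" using N \<omega> by simp
        ultimately show "(h - k) * measure lborel {x. p x > 1 + h} \<le> C' * measure lborel {x. p x > 1 + k} powr (1 + \<gamma>)"
          unfolding C'_def \<theta>(3)[symmetric] using k eq2
          by (intro level_set_decay[OF \<Omega>(1,4) C Schur p fm f2 \<epsilon> s _ _ _ _ Dle]) (auto simp: f_def)
      qed
      \<comment> \<open>The lower bound: \<open>obstacle_violation\<close> is odd, so -p solves the
        same equation with f and c replaced by -f and -c, and D and N are unchanged.\<close>
      define p' where "p' x = - p x" for x
      define gp' where "gp' x = - gp x" for x
      have p': "H1_pair \<Omega> p' gp'"
      proof -
        have "(\<lambda>x. p x + -2 * p x) = p'" "(\<lambda>x. gp x + -2 *\<^sub>R gp x) = gp'"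
          by (auto simp: p'_def gp'_def fun_eq_iff scaleR_2)
        then show ?thesis using H1_pair_add_cmult[OF p p, of "-2"] by simp
      qed
      have N': "N = (\<integral>x. \<bar>obstacle_violation (p' x)\<bar> \<partial>lborel)"
        by (simp add: N_def p'_def obstacle_violation_bounds(2))
      have down: "AE x in lborel. p' x \<le> 1 + ?B"
        unfolding K_def
      proof (rule one_sided_bound[OF \<Omega>(1,4) \<omega> p' C' \<gamma>(1) N' N NNmax])
        fix k h assume k: "N / ?\<omega> \<le> k" "k < h"
        have "\<epsilon> / s * (- c) = - ((\<integral>x. obstacle_violation (p x) \<partial>lborel) / ?\<omega>)" using c_eq by simp
        also have "\<dots> = (- (\<integral>x. obstacle_violation (p x) \<partial>lborel)) / ?\<omega>" by simp
        also have "\<dots> \<le> N / ?\<omega>" using absI \<omega> by (intro divide_right_mono) auto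
        finally have 1: "\<epsilon> / s * (- c) \<le> k" using k by linarith
        have 2: "0 \<le> k" using k N \<omega> by (meson divide_nonneg_pos less_imp_le order_trans)
        have f': "(\<lambda>x. - f x) \<in> borel_measurable borel" "integrable lborel (\<lambda>x. (- f x)\<^sup>2)" using f2 by auto
        have "(- f x - - c * indicator \<Omega> x)\<^sup>2 = (f x - c * indicator \<Omega> x)\<^sup>2" for x
          by (simp add: power2_eq_square algebra_simps)
        then have D': "(\<integral>x. (- f x - - c * indicator \<Omega> x)\<^sup>2 \<partial>lborel) \<le> D" using Dle by simp
        have eq': "\<epsilon> * (\<integral>x. gp' x \<bullet> gv x \<partial>lborel) + s / \<epsilon> * (\<integral>x. obstacle_violation (p' x) * v x \<partial>lborel)
          = (\<integral>x. - f x * v x \<partial>lborel)" if "H1_pair \<Omega> v gv" for v gv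
        proof -
          have "(\<integral>x. - f x * v x \<partial>lborel) = - (\<integral>x. (m x + 1 / \<epsilon> * q x) * v x \<partial>lborel)"
            by (simp only: f_def mult_minus_left Bochner_Integration.integral_minus)
          then show ?thesis
            unfolding eq2[OF that, symmetric] by (simp add: p'_def gp'_def obstacle_violation_bounds(2))
        qed
        show "(h - k) * measure lborel {x. p' x > 1 + h} \<le> C' * measure lborel {x. p' x > 1 + k} powr (1 + \<gamma>)"
          unfolding C'_def \<theta>(3)[symmetric]
          by (rule level_set_decay[OF \<Omega>(1,4) C Schur p' f' \<epsilon> s eq' 2 1 k(2) D'])
      qed
      have B0: "?B \<ge> 0" using K by simp
      show ?thesis
        unfolding N_def[symmetric] using up down
      proof eventually_elim
        case (elim x)
        then show ?case using B0 by (auto simp: p'_def obstacle_violation_def)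
      qed
    qed
  qed
qed

theorem theorem6:
  fixes \<Omega> :: "(real ^ 'n) set"
    and \<epsilon> \<tau> \<beta> :: real
    and \<phi>old :: "real ^ 'n \<Rightarrow> real"
  assumes "CARD('n) \<in> {2, 3}"
    and "open \<Omega>" and "connected \<Omega>" and "\<Omega> \<noteq> {}" and "bounded \<Omega>"
    and "cone_condition \<Omega>"
    and "\<epsilon> > 0" and "\<tau> > 0"
    and "\<phi>old \<in> H1_space \<Omega>"
    and "0 < \<beta>" and "\<beta> < 2 - real CARD('n) / 2"
  shows "\<exists>C>0. \<forall>\<^sub>F s in at_top. \<forall>\<phi> \<mu>. relaxed_CH_solution \<Omega> \<epsilon> \<tau> \<phi>old s \<phi> \<mu> \<longrightarrow>
           Linf_norm \<Omega> (\<lambda>x. obstacle_violation (\<phi> x))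
           \<le> ereal (C * L1_norm \<Omega> (\<lambda>x. obstacle_violation (\<phi> x)) powr (\<beta> / (\<beta> + real CARD('n))))"
proof -
  note \<Omega> = \<open>open \<Omega>\<close> \<open>connected \<Omega>\<close> \<open>\<Omega> \<noteq> {}\<close> \<open>bounded \<Omega>\<close> \<open>cone_condition \<Omega>\<close>
  let ?n = "real CARD('n)"
  have n: "?n > 0" by simp
  \<comment> \<open>With this \<gamma> the exponent \<gamma> / (1 + \<gamma>) becomes \<beta> /
    (\<beta> + n), and dividing \<beta> < 2 - n / 2 by n gives the range required of
    \<gamma>.\<close>
  define \<gamma> where "\<gamma> = \<beta> / ?n"
  have \<gamma>: "0 < \<gamma>" "\<gamma> < 2 / real DIM(real ^ 'n) - 1 / 2"
  proof -
    show "0 < \<gamma>" using \<open>0 < \<beta>\<close> n by (simp add: \<gamma>_def)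
    have "\<beta> / ?n < (2 - ?n / 2) / ?n" using \<open>\<beta> < 2 - ?n / 2\<close> n by (rule divide_strict_right_mono)
    then show "\<gamma> < 2 / real DIM(real ^ 'n) - 1 / 2" by (simp add: \<gamma>_def diff_divide_distrib)
  qed
  have ex: "\<gamma> / (1 + \<gamma>) = \<beta> / (\<beta> + ?n)" using n \<open>0 < \<beta>\<close> by (simp add: \<gamma>_def field_simps)
  obtain q gq where q: "H1_pair \<Omega> q gq" "borel_rep \<Omega> \<phi>old q" "\<phi>old \<in> borel_measurable (lebesgue_on \<Omega>)"
    using H1_space_borel_rep[OF \<Omega>(1,4) \<open>\<phi>old \<in> H1_space \<Omega>\<close>] by metis
  obtain K where K: "K > 0" and bound: "\<forall>s p gp m gm. s \<ge> \<epsilon>\<^sup>2 \<longrightarrow> H1_pair \<Omega> p gp \<longrightarrow> H1_pair \<Omega> m gm \<longrightarrow>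
    (\<forall>v gv. H1_pair \<Omega> v gv \<longrightarrow> (\<integral>x. p x * v x \<partial>lborel) + \<tau> * (\<integral>x. gm x \<bullet> gv x \<partial>lborel) = (\<integral>x. q x * v x \<partial>lborel)) \<longrightarrow>
    (\<forall>v gv. H1_pair \<Omega> v gv \<longrightarrow> \<epsilon> * (\<integral>x. gp x \<bullet> gv x \<partial>lborel)
      + s / \<epsilon> * (\<integral>x. obstacle_violation (p x) * v x \<partial>lborel) = (\<integral>x. (m x + 1 / \<epsilon> * q x) * v x \<partial>lborel)) \<longrightarrow>
    (AE x in lborel. \<bar>obstacle_violation (p x)\<bar>
      \<le> K * (\<integral>x. \<bar>obstacle_violation (p x)\<bar> \<partial>lborel) powr (\<gamma> / (1 + \<gamma>)))"
    using obstacle_violation_uniform_bound[OF \<Omega> \<open>\<epsilon> > 0\<close> \<open>\<tau> > 0\<close> q(1) \<gamma>] by blast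
  have \<Omega>s: "\<Omega> \<in> sets lebesgue" using \<Omega>(1) sets_completionI_sets[of \<Omega> lborel] by simp
  show ?thesis
  \<comment> \<open>"Large" is made explicit: every s \<ge> \<epsilon>^2 qualifies.\<close>
  proof (rule exI[of _ K], rule conjI[OF K], rule eventually_mono[OF eventually_ge_at_top[of "\<epsilon>\<^sup>2"]], intro allI impI)
    fix s \<phi> \<mu> assume s: "\<epsilon>\<^sup>2 \<le> s" and sol: "relaxed_CH_solution \<Omega> \<epsilon> \<tau> \<phi>old s \<phi> \<mu>"
    obtain p gp m gm where P: "H1_pair \<Omega> p gp" "H1_pair \<Omega> m gm" "borel_rep \<Omega> \<phi> p" "\<phi> \<in> borel_measurable (lebesgue_on \<Omega>)"
      and eq1: "\<And>v gv. H1_pair \<Omega> v gv \<Longrightarrow> (\<integral>x. p x * v x \<partial>lborel) + \<tau> * (\<integral>x. gm x \<bullet> gv x \<partial>lborel) = (\<integral>x. q x * v x \<partial>lborel)"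
      and eq2: "\<And>v gv. H1_pair \<Omega> v gv \<Longrightarrow> \<epsilon> * (\<integral>x. gp x \<bullet> gv x \<partial>lborel)
        + s / \<epsilon> * (\<integral>x. obstacle_violation (p x) * v x \<partial>lborel) = (\<integral>x. (m x + 1 / \<epsilon> * q x) * v x \<partial>lborel)"
      by (rule relaxed_CH_solution_borel_rep[OF \<Omega>(1,4) sol q(2,3,1)]) (rule that)
    let ?N = "\<integral>x. \<bar>obstacle_violation (p x)\<bar> \<partial>lborel"
    let ?B = "K * ?N powr (\<gamma> / (1 + \<gamma>))"
    have AE: "AE x in lborel. \<bar>obstacle_violation (p x)\<bar> \<le> ?B" using bound s P(1,2) eq1 eq2 by blast
    have m: "(\<lambda>x. \<bar>obstacle_violation (\<phi> x)\<bar>) \<in> borel_measurable (lebesgue_on \<Omega>)"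
      using measurable_compose[OF P(4) obstacle_violation_measurable] by simp
    have rep: "borel_rep \<Omega> (\<lambda>x. \<bar>obstacle_violation (\<phi> x)\<bar>) (\<lambda>x. \<bar>obstacle_violation (p x)\<bar>)"
      by (rule borel_rep_compose[OF P(3)]) (auto simp: obstacle_violation_bounds(3))
    have N: "L1_norm \<Omega> (\<lambda>x. obstacle_violation (\<phi> x)) = ?N"
      unfolding L1_norm_def by (rule borel_rep_integral(2)[OF \<Omega>(1) m rep])
    have "AE x in lborel. x \<in> \<Omega> \<longrightarrow> \<bar>obstacle_violation (\<phi> x)\<bar> \<le> ?B"
      using AE rep unfolding borel_rep_def by (auto elim: eventually_elim2)
    then have "AE x in lebesgue. x \<in> \<Omega> \<longrightarrow> \<bar>obstacle_violation (\<phi> x)\<bar> \<le> ?B" by (rule AE_completion)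
    then have "AE x in lebesgue_on \<Omega>. ereal \<bar>obstacle_violation (\<phi> x)\<bar> \<le> ereal ?B"
      using \<Omega>s by (simp add: AE_restrict_space_iff)
    then have "Linf_norm \<Omega> (\<lambda>x. obstacle_violation (\<phi> x)) \<le> ereal ?B"
      unfolding Linf_norm_def using m by (intro esssup_I) auto
    then show "Linf_norm \<Omega> (\<lambda>x. obstacle_violation (\<phi> x))
           \<le> ereal (K * L1_norm \<Omega> (\<lambda>x. obstacle_violation (\<phi> x)) powr (\<beta> / (\<beta> + real CARD('n))))"
      unfolding N ex .
  qed
qed

end
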